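(* Let $S$ be a Morse tileable (resp. Morse shellable) set. Then for every $i\geq 0$ the $i$-skeleton $S^{(i)}$ of $S$ is Morse tileable (resp. Morse shellable), and for every $d\geq 1$ the $d$-th barycentric subdivision $\mathrm{Sd}^d(S)$ is Morse tileable (resp. Morse shellable). Moreover, every Morse tiling on $S$ induces, on each barycentric subdivision $\mathrm{Sd}^d(S)$, $d\ge 1$, Morse tilings containing the same number of critical tiles with the same indices (that is, for every $k$, the same number of critical tiles of index $k$ as the given tiling of $S$).
   Context: Tiles. Let $\Delta_n$ be the closed standard $n$-simplex and $\sigma_1,\dots,\sigma_{n+1}$ its facets (codimension one faces). For $0\le k\le l+1\le n$ set $T^{n,l}_k=\Delta_n\setminus(\sigma_1\cup\dots\cup\sigma_k\cup\tau)$, where $\tau$ is an $l$-dimensional face of $\Delta_n$ not contained in $\sigma_1\cup\dots\cup\sigma_k$ (with $\tau=\emptyset$ when $l=-1$, $k=0$); it is well defined up to permutation of the vertices. A Morse tile of dimension $n$ is a subset of a simplex that is isomorphic to some $T^{n,l}_k$ via an affine isomorphism. It is critical of index $k$ when $l=k-1$, and regular otherwise. (In particular the closed $n$-simplex is critical of index $0$ and the open $n$-simplex is critical of index $n$.) Morse tilings. A subset $S$ of (the geometric realization of) a finite simplicial complex $K$ is Morse tileable iff it admits a partition by Morse tiles (each a subset of a simplex of $K$) such that for every $j\ge 0$ the union of the tiles of dimension greater than $j$ is the intersection with $S$ of a simplicial subcomplex of $K$. Such a partition is a Morse tiling, and $S$ is Morse tiled if one is given. A subset $S'$ of a Morse tiled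 set $S$ is a Morse tiled subset iff it is a union of tiles of $S$ and $S'=S\cap L$ for some subcomplex $L$ of a finite simplicial complex $K\supset S$. Morse shellability. $S$ is Morse shellable iff there exist a Morse tiling on $S$ and a filtration $\emptyset=S_0\subset S_1\subset\dots\subset S_N=S$ by Morse tiled subsets of $S$ such that each $S_i\setminus S_{i-1}$, $1\le i\le N$, is a single Morse tile of the tiling. Skeletons and subdivisions. $S^{(i)}$ is the intersection of $S$ with the $i$-skeleton of $K$. $\mathrm{Sd}$ denotes the first barycentric subdivision and $\mathrm{Sd}^d$ its $d$-th iterate; for $S\subset K$, $\mathrm{Sd}(S)$ is $S$ viewed as a subset of $\mathrm{Sd}(K)$ (so for a tile, $\mathrm{Sd}(\Delta_n\setminus(\sigma_1\cup\dots\cup\sigma_k\cup\tau))=\mathrm{Sd}(\Delta_n)\setminus(\bigcup_i\mathrm{Sd}(\sigma_i)\cup\mathrm{Sd}(\tau))$). A Morse tiling of $\mathrm{Sd}^d(S)$ induced by a tiling of $S$ is one obtained by partitioning each (subdivided) tile of $S$ into Morse tiles, so that each tile of $\mathrm{Sd}^d(S)$ is contained in a tile of $S$. *)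

theory Defs
  imports "HOL-Analysis.Analysis" "HOL-Library.Disjoint_Sets"
begin

text \<open>
  Finite simplicial complexes are the geometric ones of the library (which contain the empty
  simplex as soon as they are nonempty); \<open>\<Union>K\<close> is the geometric realization of \<open>K\<close>. A set \<open>S\<close> is
  always considered together with the complex \<open>K\<close> in which it lies, so that
  the subdivided set \<open>Sd(S)\<close> is the same point set \<open>S\<close>, regarded as a subset of \<open>Sd(K)\<close>.
\<close>

definition subcomplex :: "'a::euclidean_space set set \<Rightarrow> 'a set set \<Rightarrow> bool" where
  "subcomplex L K \<longleftrightarrow> simplicial_complex L \<and> L \<subseteq> K"

definition skeleton :: "nat \<Rightarrow> 'a::euclidean_space set set \<Rightarrow> 'a set set" where
  "skeleton i K = {\<sigma> \<in> K. aff_dim \<sigma> \<le> int i}"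

definition barycenter :: "'a::euclidean_space set \<Rightarrow> 'a" where
  "barycenter \<sigma> =
     (1 / real (card {v. v extreme_point_of \<sigma>})) *\<^sub>R (\<Sum>v\<in>{v. v extreme_point_of \<sigma>}. v)"

text \<open>
  The simplices of the first barycentric subdivision are spanned by the barycenters of the
  flags of nonempty simplices; the empty flag yields the empty simplex.
\<close>

definition barycentric_subdivision :: "'a::euclidean_space set set \<Rightarrow> 'a set set" where
  "barycentric_subdivision K =
     {convex hull (barycenter ` c) | c.
        c \<subseteq> K - {{}} \<and> (\<forall>\<sigma>\<in>c. \<forall>\<tau>\<in>c. \<sigma> face_of \<tau> \<or> \<tau> face_of \<sigma>)}"

text \<open>
  \<open>tile_of_simplex \<Delta> n l k T\<close>: the set \<open>T\<close> is a copy of \<open>T\<^sup>n\<^sup>,\<^sup>l\<^sub>k\<close> in the \<open>n\<close>-simplex \<open>\<Delta>\<close>,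
  obtained by removing \<open>k\<close> facets and an \<open>l\<close>-dimensional face \<open>\<tau>\<close> not contained in them. As every
  \<open>n\<close>-simplex is the image of the standard one under an affine isomorphism, and affine isomorphisms
  preserve faces and their dimensions, these are exactly the images of \<open>T\<^sup>n\<^sup>,\<^sup>l\<^sub>k\<close> under affine
  isomorphisms from the standard simplex onto \<open>\<Delta>\<close>.
  The face \<open>\<tau>\<close> is empty iff \<open>l = -1\<close>, which forces \<open>k = 0\<close>; only then may \<open>\<tau>\<close> be contained in the
  (empty) union of the removed facets.
\<close>

definition tile_of_simplex ::
    "'a::euclidean_space set \<Rightarrow> nat \<Rightarrow> int \<Rightarrow> nat \<Rightarrow> 'a set \<Rightarrow> bool" where
  "tile_of_simplex \<Delta> n l k T \<longleftrightarrow>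
     int n simplex \<Delta> \<and> int k \<le> l + 1 \<and> l + 1 \<le> int n \<and>
     (\<exists>F \<tau>. F \<subseteq> {\<sigma>. \<sigma> facet_of \<Delta>} \<and> finite F \<and> card F = k \<and>
            \<tau> face_of \<Delta> \<and> aff_dim \<tau> = l \<and> (l = -1 \<or> \<not> \<tau> \<subseteq> \<Union>F) \<and>
            T = \<Delta> - (\<Union>F \<union> \<tau>))"

definition morse_tile :: "'a::euclidean_space set set \<Rightarrow> nat \<Rightarrow> 'a set \<Rightarrow> bool" where
  "morse_tile K n T \<longleftrightarrow> (\<exists>\<Delta>\<in>K. \<exists>l k. tile_of_simplex \<Delta> n l k T)"

definition critical_tile :: "nat \<Rightarrow> 'a::euclidean_space set \<Rightarrow> bool" where
  "critical_tile k T \<longleftrightarrow> (\<exists>\<Delta> n. tile_of_simplex \<Delta> n (int k - 1) k T)"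

definition morse_tiling :: "'a::euclidean_space set set \<Rightarrow> 'a set \<Rightarrow> 'a set set \<Rightarrow> bool" where
  "morse_tiling K S \<T> \<longleftrightarrow>
     simplicial_complex K \<and> S \<subseteq> \<Union>K \<and>
     partition_on S \<T> \<and> (\<forall>T\<in>\<T>. \<exists>n. morse_tile K n T) \<and>
     (\<forall>j::nat. \<exists>L. subcomplex L K \<and> \<Union>{T \<in> \<T>. \<exists>n>j. morse_tile K n T} = S \<inter> \<Union>L)"

definition morse_tileable :: "'a::euclidean_space set set \<Rightarrow> 'a set \<Rightarrow> bool" where
  "morse_tileable K S \<longleftrightarrow> (\<exists>\<T>. morse_tiling K S \<T>)"

definition morse_tiled_subset ::
    "'a::euclidean_space set set \<Rightarrow> 'a set \<Rightarrow> 'a set set \<Rightarrow> 'a set \<Rightarrow> bool" where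
  "morse_tiled_subset K S \<T> S' \<longleftrightarrow>
     (\<exists>\<U>\<subseteq>\<T>. S' = \<Union>\<U>) \<and> (\<exists>L. subcomplex L K \<and> S' = S \<inter> \<Union>L)"

definition morse_shellable :: "'a::euclidean_space set set \<Rightarrow> 'a set \<Rightarrow> bool" where
  "morse_shellable K S \<longleftrightarrow>
     (\<exists>\<T>. morse_tiling K S \<T> \<and>
       (\<exists>(N::nat) (A :: nat \<Rightarrow> 'a set). A 0 = {} \<and> A N = S \<and>
          (\<forall>i\<le>N. morse_tiled_subset K S \<T> (A i)) \<and>
          (\<forall>i\<in>{1..N}. A (i - 1) \<subset> A i \<and> A i - A (i - 1) \<in> \<T>)))"

definition induced_morse_tiling ::
    "'a::euclidean_space set set \<Rightarrow> 'a set \<Rightarrow> 'a set set \<Rightarrow> nat \<Rightarrow> 'a set set \<Rightarrow> bool" where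
  "induced_morse_tiling K S \<T> d \<T>' \<longleftrightarrow>
     morse_tiling ((barycentric_subdivision ^^ d) K) S \<T>' \<and> (\<forall>T'\<in>\<T>'. \<exists>T\<in>\<T>. T' \<subseteq> T)"

end

theory Submission
  imports Defs
begin

text \<open>
  Let a simplex have vertex set \<open>V\<close>, and let \<open>R \<subseteq> t \<subset> V\<close>. Removing the facets opposite to the
  vertices of \<open>R\<close> and the face spanned by \<open>t\<close> leaves the points whose support \<open>P\<close>, the set of
  vertices with nonzero barycentric coordinate, satisfies \<open>R \<subseteq> P\<close> and \<open>\<not> P \<subseteq> t\<close>. So a tile
  is the set difference of two intervals of faces, and it is critical exactly when \<open>R = t\<close>, its
  index then being the number of elements of \<open>R\<close>. A simplex with any nonempty set \<open>R\<close> of facets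
  removed is a tile as well: take one element \<open>a\<close> out of \<open>R\<close> and let \<open>t\<close> be the facet opposite to \<open>a\<close>.

  Subdivision. Fix a total order \<open>\<rho>\<close> on \<open>V\<close> and sort the vertices by decreasing coordinate of a
  point \<open>x\<close>, breaking ties by \<open>\<rho>\<close>. The points that produce the list \<open>w\<close> lie in the
  simplex of the subdivision spanned by the centroids \<open>b\<^sub>i\<close> of the prefixes of \<open>w\<close>; in it, the
  inequality between two neighbours of \<open>w\<close> is strict precisely off the facet opposite to the
  corresponding \<open>b\<^sub>i\<close>, and it is required to be strict exactly at the descents of \<open>w\<close>. The points of
  the tile with list \<open>w\<close> are thus obtained by removing the facets at the descents and the face
  spanned by the prefixes that are not faces of the tile, an initial segment \<open>b\<^sub>0, \<dots>, b\<^sub>j\<^sub>-\<^sub>1\<close>.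
  This is a tile, critical (of index \<open>j\<close>) iff the descents of \<open>w\<close> are precisely its first
  \<open>j\<close> positions. Then \<open>w\<close> decreases down to the \<open>\<rho>\<close>-smallest vertex \<open>m\<close> and increases after it.
  If \<open>R \<noteq> t\<close>, choose \<open>\<rho>\<close> with \<open>m \<in> t - R\<close>; then \<open>m\<close> cannot be the vertex at which the prefixes
  enter the tile, and no piece is critical. If \<open>R = t\<close>, choose any \<open>m \<notin> t\<close>; the prefix before \<open>m\<close>
  must then be \<open>R\<close>, which leaves one list, and one critical piece, of the same index
  (\<open>tile_subdivision\<close>).

  Instead of the list \<open>w\<close> the proof records its set of inversions. A point in the closed simplex of
  a piece has only inversions of that piece, so adding the pieces along any linear extension of
  inclusion gives sets that are relatively closed in the tile. This is the shelling of the
  subdivided tile.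

  Skeleta. One passes from dimension \<open>i + 1\<close> to \<open>i\<close>: a tile of dimension \<open>i + 1\<close> loses its
  open top cell, and the rest is divided according to the \<open>\<rho>\<close>-smallest vertex missing from the
  support. Each piece is a part of one facet, again a tile, of dimension \<open>i\<close>
  (\<open>tile_skeleton\<close>); tiles of smaller dimension are kept.

  In both cases all pieces of a tile have the same dimension, so the condition on the unions of tiles
  of large dimension carries over, and a shelling of \<open>S\<close> is refined by shelling its tiles one after
  another (\<open>morse_tiling_refine\<close>, \<open>shelled_refine\<close>). The refinement of a shelling rests
  on relatively closed sets being stable under finite unions and intersections.
\<close>

section \<open>Barycentric coordinates and supports\<close>

definition bary_coord :: "'a::euclidean_space set \<Rightarrow> 'a \<Rightarrow> 'a \<Rightarrow> real" where
  "bary_coord B x = (SOME u. sum u B = 1 \<and> (\<Sum>v\<in>B. u v *\<^sub>R v) = x)"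

definition supp :: "'a::euclidean_space set \<Rightarrow> 'a \<Rightarrow> 'a set" where
  "supp B x = {v \<in> B. bary_coord B x v \<noteq> 0}"

definition centroid :: "'a::euclidean_space set \<Rightarrow> 'a" where
  "centroid P = (1 / real (card P)) *\<^sub>R (\<Sum>v\<in>P. v)"

lemma bary_coord_eq:
  fixes B :: "'a::euclidean_space set"
  assumes indep: "\<not> affine_dependent B" and u: "sum u B = 1" "(\<Sum>v\<in>B. u v *\<^sub>R v) = x" and v: "v \<in> B"
  shows "bary_coord B x v = u v"
proof -
  let ?c = "bary_coord B x"
  have c: "sum ?c B = 1 \<and> (\<Sum>v\<in>B. ?c v *\<^sub>R v) = x"
    unfolding bary_coord_def by (rule someI[of _ u]) (use u in blast)
  have "sum (\<lambda>v. ?c v - u v) B = 0" "(\<Sum>v\<in>B. (?c v - u v) *\<^sub>R v) = 0"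
    using c u by (simp_all add: sum_subtractf scaleR_left_diff_distrib)
  then have "?c v - u v = 0"
    using affine_dependent_explicit_finite[OF aff_independent_finite[OF indep]] indep v by blast
  then show ?thesis by simp
qed

text \<open>A point outside the affine hull of \<open>B\<close> has unspecified coordinates; on the convex hull
  they are the usual nonnegative ones.\<close>

lemma bary_coord_hull:
  fixes B :: "'a::euclidean_space set"
  assumes indep: "\<not> affine_dependent B" and x: "x \<in> convex hull B"
  shows "sum (bary_coord B x) B = 1" and "(\<Sum>v\<in>B. bary_coord B x v *\<^sub>R v) = x"
    and "v \<in> B \<Longrightarrow> 0 \<le> bary_coord B x v"
proof -
  obtain u where u: "\<forall>v\<in>B. 0 \<le> u v" "sum u B = 1" "(\<Sum>v\<in>B. u v *\<^sub>R v) = x"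
    using x convex_hull_finite[OF aff_independent_finite[OF indep]] by auto
  have eq: "bary_coord B x v = u v" if "v \<in> B" for v
    by (rule bary_coord_eq[OF indep u(2,3) that])
  show "sum (bary_coord B x) B = 1" "(\<Sum>v\<in>B. bary_coord B x v *\<^sub>R v) = x"
    using u eq by simp_all
  show "v \<in> B \<Longrightarrow> 0 \<le> bary_coord B x v" using u eq by simp
qed

lemma convex_combination_in_hull:
  fixes B :: "'a::euclidean_space set"
  assumes "finite B" "\<And>v. v \<in> B \<Longrightarrow> 0 \<le> u v" "sum u B = 1"
  shows "(\<Sum>v\<in>B. u v *\<^sub>R v) \<in> convex hull B"
  using assms by (subst convex_hull_finite) auto

lemma supp_subset: "supp B x \<subseteq> B"
  by (auto simp: supp_def)

text \<open>Faces are recognised by supports. This turns every question about the faces of one simplex into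
  one about subsets of its vertex set.\<close>

lemma in_hull_subset_iff:
  fixes B :: "'a::euclidean_space set"
  assumes indep: "\<not> affine_dependent B" and P: "P \<subseteq> B" and x: "x \<in> convex hull B"
  shows "x \<in> convex hull P \<longleftrightarrow> supp B x \<subseteq> P"
proof
  have fin: "finite B" by (rule aff_independent_finite[OF indep])
  then have finP: "finite P" using P by (rule rev_finite_subset)
  assume "x \<in> convex hull P"
  then obtain u where u: "\<forall>v\<in>P. 0 \<le> u v" "sum u P = 1" "(\<Sum>v\<in>P. u v *\<^sub>R v) = x"
    using convex_hull_finite[OF finP] by auto
  let ?w = "\<lambda>v. if v \<in> P then u v else 0"
  have "sum ?w B = sum u P"
    using P fin by (subst sum.mono_neutral_right[of B P]) auto
  moreover have "(\<Sum>v\<in>B. ?w v *\<^sub>R v) = (\<Sum>v\<in>P. u v *\<^sub>R v)"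
    using P fin by (subst sum.mono_neutral_right[of B P]) auto
  ultimately have "bary_coord B x v = ?w v" if "v \<in> B" for v
    using bary_coord_eq[OF indep, of ?w x v] u that by simp
  then show "supp B x \<subseteq> P" by (force simp: supp_def split: if_splits)
next
  have fin: "finite B" by (rule aff_independent_finite[OF indep])
  then have finP: "finite P" using P by (rule rev_finite_subset)
  assume s: "supp B x \<subseteq> P"
  note c = bary_coord_hull[OF indep x]
  have "sum (bary_coord B x) P = 1"
    using c(1) s P fin by (subst sum.mono_neutral_left[of B P]) (auto simp: supp_def)
  moreover have "(\<Sum>v\<in>P. bary_coord B x v *\<^sub>R v) = x"
    using s P fin by (subst sum.mono_neutral_left[of B P]) (auto simp: supp_def c(2))
  ultimately show "x \<in> convex hull P"
    using convex_combination_in_hull[OF finP, of "bary_coord B x"] c(3) P by auto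
qed

lemma centroid_combination:
  "centroid P = (\<Sum>v\<in>P. (1 / real (card P)) *\<^sub>R v)"
  by (simp add: centroid_def scaleR_sum_right)

lemma centroid_in_hull:
  assumes "finite P" "P \<noteq> {}"
  shows "centroid P \<in> convex hull P"
  unfolding centroid_combination
  using assms by (intro convex_combination_in_hull) auto

lemma bary_coord_centroid:
  fixes B :: "'a::euclidean_space set"
  assumes indep: "\<not> affine_dependent B" and P: "P \<subseteq> B" "P \<noteq> {}" and v: "v \<in> B"
  shows "bary_coord B (centroid P) v = (if v \<in> P then 1 / real (card P) else 0)"
proof -
  have fin: "finite B" by (rule aff_independent_finite[OF indep])
  then have finP: "finite P" using P(1) by (rule rev_finite_subset)
  let ?w = "\<lambda>v. if v \<in> P then 1 / real (card P) else 0"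
  have "sum ?w B = sum (\<lambda>v. 1 / real (card P)) P"
    using P fin by (subst sum.mono_neutral_right[of B P]) auto
  moreover have "(\<Sum>v\<in>B. ?w v *\<^sub>R v) = centroid P"
    unfolding centroid_combination
    using P fin by (subst sum.mono_neutral_right[of B P]) auto
  ultimately show ?thesis
    using bary_coord_eq[OF indep, of ?w "centroid P" v] v P finP by simp
qed

lemma supp_centroid:
  fixes B :: "'a::euclidean_space set"
  assumes "\<not> affine_dependent B" "P \<subseteq> B" "P \<noteq> {}"
  shows "supp B (centroid P) = P"
proof -
  have "finite P" using assms aff_independent_finite finite_subset by metis
  then show ?thesis
    using assms bary_coord_centroid[OF assms] by (auto simp: supp_def split: if_splits)
qed

lemma rel_interior_iff_supp:
  fixes B :: "'a::euclidean_space set"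
  assumes indep: "\<not> affine_dependent B" and x: "x \<in> convex hull B"
  shows "x \<in> rel_interior (convex hull B) \<longleftrightarrow> supp B x = B"
proof
  assume "x \<in> rel_interior (convex hull B)"
  then obtain u where u: "\<forall>v\<in>B. 0 < u v" "sum u B = 1" "(\<Sum>v\<in>B. u v *\<^sub>R v) = x"
    using rel_interior_convex_hull_explicit[OF indep] by auto
  have "bary_coord B x v = u v" if "v \<in> B" for v
    by (rule bary_coord_eq[OF indep u(2,3) that])
  then show "supp B x = B" using u by (force simp: supp_def)
next
  assume s: "supp B x = B"
  have "0 < bary_coord B x v" if "v \<in> B" for v
    using bary_coord_hull(3)[OF indep x that] s that by (auto simp: supp_def less_le)
  then show "x \<in> rel_interior (convex hull B)"
    using rel_interior_convex_hull_explicit[OF indep] bary_coord_hull[OF indep x] by blast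
qed

lemma affine_independent_subset:
  "\<not> affine_dependent B \<Longrightarrow> P \<subseteq> B \<Longrightarrow> \<not> affine_dependent P"
  using affine_dependent_subset by auto

lemma hull_subset_face:
  fixes B :: "'a::euclidean_space set"
  shows "\<not> affine_dependent B \<Longrightarrow> P \<subseteq> B \<Longrightarrow> convex hull P face_of convex hull B"
  by (subst face_of_convex_hull_affine_independent) auto

section \<open>Tiles as differences of face intervals\<close>

definition interval_tile :: "'a::euclidean_space set \<Rightarrow> 'a set \<Rightarrow> 'a set \<Rightarrow> 'a set" where
  "interval_tile B R t = {x \<in> convex hull B. R \<subseteq> supp B x \<and> \<not> supp B x \<subseteq> t}"

lemma convex_hull_inj:
  fixes B :: "'a::euclidean_space set"
  assumes "\<not> affine_dependent B" "P \<subseteq> B" "Q \<subseteq> B" "convex hull P = convex hull Q"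
  shows "P = Q"
proof -
  have "\<not> affine_dependent P" "\<not> affine_dependent Q"
    using assms affine_dependent_subset by blast+
  then show ?thesis
    using assms(4) extreme_point_of_convex_hull_affine_independent[of P]
      extreme_point_of_convex_hull_affine_independent[of Q] by auto
qed

text \<open>A point avoids the facet opposite to \<open>v\<close> iff \<open>v\<close> is in its support. Facets are nonempty by
  definition, so in dimension \<open>0\<close> there are none and \<open>R\<close> below is empty.\<close>

lemma tile_of_simplex_imp_interval_tile:
  fixes \<Delta> :: "'a::euclidean_space set"
  assumes "tile_of_simplex \<Delta> n l k T"
  obtains B R t where "\<not> affine_dependent B" "\<Delta> = convex hull B" "card B = Suc n"
    "R \<subseteq> t" "t \<subset> B" "card R = k" "int (card t) = l + 1" "T = interval_tile B R t"
proof -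
  from assms obtain F \<tau> where simp: "int n simplex \<Delta>" and kl: "int k \<le> l + 1" "l + 1 \<le> int n"
    and F: "F \<subseteq> {\<sigma>. \<sigma> facet_of \<Delta>}" "finite F" "card F = k"
    and \<tau>: "\<tau> face_of \<Delta>" "aff_dim \<tau> = l" "l = -1 \<or> \<not> \<tau> \<subseteq> \<Union>F"
    and T: "T = \<Delta> - (\<Union>F \<union> \<tau>)"
    unfolding tile_of_simplex_def by auto
  from simp obtain B where indep: "\<not> affine_dependent B" and B: "int (card B) = int n + 1"
    "\<Delta> = convex hull B"
    unfolding simplex_def by blast
  have fin: "finite B" by (rule aff_independent_finite[OF indep])
  obtain t where t: "t \<subseteq> B" "\<tau> = convex hull t"
    using \<tau>(1) face_of_convex_hull_affine_independent[OF indep] B by blast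
  have "\<not> affine_dependent t" using indep t affine_dependent_subset by blast
  then have cardt: "int (card t) = l + 1"
    using \<tau>(2) t aff_dim_affine_independent[of t] by (simp add: aff_dim_convex_hull)
  define R where "R = {v \<in> B. convex hull (B - {v}) \<in> F}"
  have FR: "F = (\<lambda>v. convex hull (B - {v})) ` R"
    using F(1) facet_of_convex_hull_affine_independent[OF indep] B(2) by (auto simp: R_def)
  have "inj_on (\<lambda>v. convex hull (B - {v})) R"
  proof (rule inj_onI)
    fix v w assume "v \<in> R" "w \<in> R" "convex hull (B - {v}) = convex hull (B - {w})"
    then have "B - {v} = B - {w}" using convex_hull_inj[OF indep] by blast
    then show "v = w" using \<open>v \<in> R\<close> \<open>w \<in> R\<close> by (auto simp: R_def)
  qed
  then have cardR: "card R = k" using F(3) FR card_image by metis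
  have RB: "R \<subseteq> B" by (auto simp: R_def)
  have notin: "x \<notin> \<Union>F \<longleftrightarrow> R \<subseteq> supp B x" if x: "x \<in> convex hull B" for x
  proof -
    have "x \<in> convex hull (B - {v}) \<longleftrightarrow> v \<notin> supp B x" if "v \<in> R" for v
      using in_hull_subset_iff[OF indep _ x, of "B - {v}"] supp_subset[of B x] by auto
    then show ?thesis by (auto simp: FR)
  qed
  have "R \<subseteq> t"
  proof (cases "l = -1")
    case True
    then have "k = 0" using kl by simp
    then have "R = {}" using cardR fin RB finite_subset by (metis card_0_eq)
    then show ?thesis by simp
  next
    case False
    then obtain y where y: "y \<in> \<tau>" "y \<notin> \<Union>F" using \<tau>(3) by blast
    then have "y \<in> convex hull B" using t hull_mono by blast
    then show ?thesis
      using y t notin in_hull_subset_iff[OF indep t(1)] by blast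
  qed
  moreover have "t \<noteq> B" using cardt kl B by auto
  moreover have "T = interval_tile B R t"
    unfolding T interval_tile_def B(2) t(2)
    using notin in_hull_subset_iff[OF indep t(1)] by auto
  ultimately have Rt: "R \<subseteq> t" "t \<subset> B" "T = interval_tile B R t" using t by auto
  have "card B = Suc n" using B(1) by simp
  then show ?thesis by (rule that[OF indep B(2) _ Rt(1,2) cardR cardt Rt(3)])
qed

text \<open>If \<open>R\<close> is nonempty then so is \<open>t\<close>, hence \<open>B\<close> has two elements and the faces opposite to the
  vertices in \<open>R\<close> are nonempty, as facets have to be. The centroid of \<open>t\<close> has support \<open>t \<supseteq> R\<close> and so is a point of the removed face
  outside the removed facets.\<close>

lemma interval_tile_is_tile:
  fixes B :: "'a::euclidean_space set"
  assumes indep: "\<not> affine_dependent B" and "R \<subseteq> t" "t \<subset> B"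
  shows "tile_of_simplex (convex hull B) (card B - 1) (int (card t) - 1) (card R) (interval_tile B R t)"
proof -
  have fin: "finite B" by (rule aff_independent_finite[OF indep])
  have fint: "finite t" using fin assms finite_subset by blast
  have RB: "R \<subseteq> B" using assms by auto
  have ct: "card t < card B" using assms fin psubset_card_mono by blast
  have cR: "card R \<le> card t" using assms fint card_mono by blast
  define F where "F = (\<lambda>v. convex hull (B - {v})) ` R"
  have "inj_on (\<lambda>v. convex hull (B - {v})) R"
  proof (rule inj_onI)
    fix v w assume "v \<in> R" "w \<in> R" "convex hull (B - {v}) = convex hull (B - {w})"
    then have "B - {v} = B - {w}" using convex_hull_inj[OF indep] by blast
    then show "v = w" using \<open>v \<in> R\<close> \<open>w \<in> R\<close> RB by auto
  qed
  then have cF: "card F = card R" by (simp add: F_def card_image)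
  have notin: "x \<notin> \<Union>F \<longleftrightarrow> R \<subseteq> supp B x" if x: "x \<in> convex hull B" for x
  proof -
    have "x \<in> convex hull (B - {v}) \<longleftrightarrow> v \<notin> supp B x" if "v \<in> R" for v
      using in_hull_subset_iff[OF indep _ x, of "B - {v}"] supp_subset[of B x] by auto
    then show ?thesis by (auto simp: F_def)
  qed
  have facets: "F \<subseteq> {\<sigma>. \<sigma> facet_of convex hull B}"
  proof
    fix \<sigma> assume "\<sigma> \<in> F"
    then obtain v where v: "v \<in> R" "\<sigma> = convex hull (B - {v})" by (auto simp: F_def)
    have "B - {v} \<noteq> {}" using assms v by auto
    then show "\<sigma> \<in> {\<sigma>. \<sigma> facet_of convex hull B}"
      using facet_of_convex_hull_affine_independent[OF indep] v RB by auto
  qed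
  have it: "\<not> affine_dependent t" using indep assms affine_dependent_subset by blast
  have "t = {} \<or> \<not> convex hull t \<subseteq> \<Union>F"
  proof (cases "t = {}")
    case False
    have "centroid t \<in> convex hull t" using centroid_in_hull fint False by blast
    moreover have "centroid t \<notin> \<Union>F"
      using notin[of "centroid t"] calculation supp_centroid[OF indep, of t] assms False
        hull_mono[of t B convex] by auto
    ultimately show ?thesis by blast
  qed simp
  then have "int (card t) - 1 = -1 \<or> \<not> convex hull t \<subseteq> \<Union>F" by auto
  moreover have "convex hull t face_of convex hull B"
    using face_of_convex_hull_affine_independent[OF indep] assms by blast
  moreover have "aff_dim (convex hull t) = int (card t) - 1"
    using aff_dim_affine_independent[OF it] by (simp add: aff_dim_convex_hull)
  moreover have "interval_tile B R t = convex hull B - (\<Union>F \<union> convex hull t)"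
    unfolding interval_tile_def
    using notin in_hull_subset_iff[OF indep] assms by auto
  moreover have "int (card B - 1) simplex convex hull B"
    using indep ct by (intro simplex_convex_hull) auto
  moreover have "finite F" using RB fin finite_subset by (auto simp: F_def)
  ultimately show ?thesis
    unfolding tile_of_simplex_def using facets cF ct cR
    by (intro conjI exI[of _ F] exI[of _ "convex hull t"]) auto
qed

lemma interval_tile_iff_centroid:
  fixes B :: "'a::euclidean_space set"
  assumes indep: "\<not> affine_dependent B" and P: "P \<subseteq> B" "P \<noteq> {}"
  shows "centroid P \<in> interval_tile B R t \<longleftrightarrow> R \<subseteq> P \<and> \<not> P \<subseteq> t"
proof -
  have "finite P" using assms aff_independent_finite finite_subset by metis
  then have "centroid P \<in> convex hull B"
    using centroid_in_hull[of P] P hull_mono[of P B convex] by auto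
  then show ?thesis using supp_centroid[OF indep P] by (simp add: interval_tile_def)
qed

lemma rel_interior_subset_interval_tile:
  fixes B :: "'a::euclidean_space set"
  assumes indep: "\<not> affine_dependent B" and "R \<subseteq> t" "t \<subset> B"
  shows "rel_interior (convex hull B) \<subseteq> interval_tile B R t"
proof
  fix x assume x: "x \<in> rel_interior (convex hull B)"
  then have xB: "x \<in> convex hull B" using rel_interior_subset by blast
  then have "supp B x = B" using rel_interior_iff_supp[OF indep xB] x by simp
  then show "x \<in> interval_tile B R t" using assms xB by (auto simp: interval_tile_def)
qed

text \<open>The closure recovers the simplex, and with it the vertex set, from the point set of a tile.\<close>

lemma closure_interval_tile:
  fixes B :: "'a::euclidean_space set"
  assumes indep: "\<not> affine_dependent B" and "R \<subseteq> t" "t \<subset> B"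
  shows "closure (interval_tile B R t) = convex hull B"
proof
  have cl: "closure (convex hull B) = convex hull B"
    by (intro closure_closed compact_imp_closed finite_imp_compact_convex_hull
        aff_independent_finite[OF indep])
  show "closure (interval_tile B R t) \<subseteq> convex hull B"
    using closure_mono[of "interval_tile B R t" "convex hull B"] cl by (auto simp: interval_tile_def)
  have "convex hull B = closure (rel_interior (convex hull B))"
    using convex_closure_rel_interior[of "convex hull B"] cl by simp
  then show "convex hull B \<subseteq> closure (interval_tile B R t)"
    using closure_mono[OF rel_interior_subset_interval_tile[OF assms]] by simp
qed

lemma tile_aff_dim:
  fixes T :: "'a::euclidean_space set"
  assumes "tile_of_simplex \<Delta> n l k T"
  shows "aff_dim T = int n"
proof -
  obtain B R t where B: "\<not> affine_dependent B" "\<Delta> = convex hull B" "card B = Suc n"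
    "R \<subseteq> t" "t \<subset> B" "card R = k" "int (card t) = l + 1" "T = interval_tile B R t"
    using tile_of_simplex_imp_interval_tile[OF assms] .
  have "aff_dim (convex hull B) = int n"
    using aff_dim_affine_independent[OF B(1)] B(3) by (simp add: aff_dim_convex_hull)
  then show ?thesis
    using closure_interval_tile[OF B(1,4,5)] B(8) closure_same_affine_hull[of T]
      aff_dim_affine_hull[of "closure T"] aff_dim_affine_hull[of T] by simp
qed

lemma morse_tile_aff_dim: "morse_tile K n T \<Longrightarrow> aff_dim T = int n"
  unfolding morse_tile_def using tile_aff_dim by blast

text \<open>The index is determined by the point set: the minimal faces of a tile are the sets
  \<open>R \<union> {x}\<close> with \<open>x \<notin> t\<close>, which have \<open>card R + 1\<close> elements each. If the same faces also are those
  of a critical tile with set \<open>R'\<close>, then \<open>R\<close> and \<open>R'\<close> have the same size. When there are two minimal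
  faces, \<open>R\<close> is their intersection, and so equal to \<open>R'\<close>; then \<open>t = R\<close> since every \<open>x \<notin> R\<close>
  occurs. When there is only one, the tile is an open simplex and \<open>t\<close> can only be \<open>R\<close>.\<close>

lemma critical_interval_tile_iff:
  fixes B :: "'a::euclidean_space set"
  assumes indep: "\<not> affine_dependent B" and Rt: "R \<subseteq> t" "t \<subset> B"
  shows "critical_tile k (interval_tile B R t) \<longleftrightarrow> R = t \<and> card R = k"
proof
  assume "R = t \<and> card R = k"
  then show "critical_tile k (interval_tile B R t)"
    unfolding critical_tile_def using interval_tile_is_tile[OF assms] by auto
next
  have fin: "finite B" by (rule aff_independent_finite[OF indep])
  assume "critical_tile k (interval_tile B R t)"
  then obtain \<Delta> n where "tile_of_simplex \<Delta> n (int k - 1) k (interval_tile B R t)"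
    unfolding critical_tile_def by blast
  then obtain B' R' t' where B': "\<not> affine_dependent B'" "R' \<subseteq> t'" "t' \<subset> B'" "card R' = k"
    "card t' = k" and eq: "interval_tile B R t = interval_tile B' R' t'"
    by (rule tile_of_simplex_imp_interval_tile) auto
  have "convex hull B = convex hull B'"
    using closure_interval_tile[OF assms] closure_interval_tile[OF B'(1-3)] eq by simp
  then have BB: "B' = B"
    using extreme_point_of_convex_hull_affine_independent[OF indep]
      extreme_point_of_convex_hull_affine_independent[OF B'(1)] by auto
  have "finite t'" using BB B' fin finite_subset by blast
  then have t': "t' = R'" using B' by (metis card_subset_eq)
  have R'B: "R' \<subset> B" using B' BB t' by simp
  have faces: "R \<subseteq> P \<and> \<not> P \<subseteq> t \<longleftrightarrow> R' \<subset> P" if "P \<subseteq> B" "P \<noteq> {}" for P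
    using interval_tile_iff_centroid[OF indep that, of R t]
      interval_tile_iff_centroid[OF indep that, of R' R'] eq BB t' by auto
  obtain x where x: "x \<in> B" "x \<notin> t" using Rt by blast
  obtain y where y: "y \<in> B" "y \<notin> R'" using R'B by blast
  have "R \<subseteq> B" using Rt by auto
  then have finR: "finite R" "finite R'"
    using fin R'B by (auto intro: finite_subset)
  have xB: "insert x R \<subseteq> B" using x Rt by auto
  have "R' \<subset> insert x R" using faces[OF xB] x by blast
  then have "card R' < card (insert x R)" using finR by (intro psubset_card_mono) auto
  moreover have "x \<notin> R" using x Rt by blast
  ultimately have le1: "card R' \<le> card R" using finR by simp
  have mem: "R \<subseteq> insert z R' \<and> \<not> insert z R' \<subseteq> t" if "z \<in> B" "z \<notin> R'" for z
    using faces[of "insert z R'"] that R'B by blast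
  have "R \<subset> insert y R'" using mem[OF y] Rt by blast
  then have "card R < card (insert y R')" using finR by (intro psubset_card_mono) auto
  then have "card R \<le> card R'" using finR y by simp
  then have cRR: "card R = card R'" using le1 by simp
  show "R = t \<and> card R = k"
  proof (cases "B = insert y R'")
    case True
    then have "card B = Suc (card R)" using cRR y finR by simp
    moreover have "card t < card B" using Rt fin psubset_card_mono by blast
    moreover have "finite t" using fin Rt by (auto intro: finite_subset)
    ultimately have "R = t" using Rt by (intro card_seteq) auto
    then show ?thesis using cRR B' by simp
  next
    case False
    then obtain z where z: "z \<in> B" "z \<notin> R'" "z \<noteq> y" using y R'B by blast
    have "R \<subseteq> R'" using mem[OF y] mem[OF z(1,2)] z by blast
    then have RR: "R = R'" using cRR finR card_subset_eq by metis
    have "t \<subseteq> R"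
    proof
      fix w assume w: "w \<in> t"
      show "w \<in> R"
      proof (rule ccontr)
        assume "w \<notin> R"
        then have "\<not> insert w R' \<subseteq> t" using mem[of w] w Rt RR by blast
        then show False using w Rt RR by blast
      qed
    qed
    then show ?thesis using Rt RR B' by blast
  qed
qed

section \<open>The barycentric subdivision of a complex\<close>

abbreviation verts :: "'a::euclidean_space set \<Rightarrow> 'a set" where
  "verts \<sigma> \<equiv> {v. v extreme_point_of \<sigma>}"

lemma verts_hull:
  fixes P :: "'a::euclidean_space set"
  shows "\<not> affine_dependent P \<Longrightarrow> verts (convex hull P) = P"
  using extreme_point_of_convex_hull_affine_independent by auto

lemma simplex_verts:
  assumes "n simplex \<sigma>"
  shows "\<not> affine_dependent (verts \<sigma>)" "finite (verts \<sigma>)" "convex hull (verts \<sigma>) = \<sigma>"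
proof -
  obtain P where P: "\<not> affine_dependent P" "\<sigma> = convex hull P"
    using assms unfolding simplex_def by blast
  then have "verts \<sigma> = P" using verts_hull by blast
  then show "\<not> affine_dependent (verts \<sigma>)" "finite (verts \<sigma>)" "convex hull (verts \<sigma>) = \<sigma>"
    using P aff_independent_finite by auto
qed

lemma barycenter_eq: "barycenter \<sigma> = centroid (verts \<sigma>)"
  by (simp add: barycenter_def centroid_def)

lemma complex_simplex:
  assumes "simplicial_complex K" "\<sigma> \<in> K"
  shows "\<not> affine_dependent (verts \<sigma>)" "finite (verts \<sigma>)" "convex hull (verts \<sigma>) = \<sigma>"
    "\<sigma> \<noteq> {} \<Longrightarrow> verts \<sigma> \<noteq> {}" "convex \<sigma>"
proof -
  obtain n where "n simplex \<sigma>" using assms unfolding simplicial_complex_def by blast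
  note s = simplex_verts[OF this]
  show "\<not> affine_dependent (verts \<sigma>)" "finite (verts \<sigma>)" "convex hull (verts \<sigma>) = \<sigma>"
    by (fact s)+
  show "verts \<sigma> \<noteq> {}" if "\<sigma> \<noteq> {}" using s(3) that by (metis convex_hull_empty)
  show "convex \<sigma>" using s(3) by (metis convex_convex_hull)
qed

lemma barycenter_in_rel_interior:
  assumes "simplicial_complex K" "\<sigma> \<in> K" "\<sigma> \<noteq> {}"
  shows "barycenter \<sigma> \<in> rel_interior \<sigma>"
proof -
  note s = complex_simplex[OF assms(1,2)]
  have "centroid (verts \<sigma>) \<in> convex hull (verts \<sigma>)"
    using centroid_in_hull s(2) s(4)[OF assms(3)] by blast
  then show ?thesis
    using rel_interior_iff_supp[OF s(1)] supp_centroid[OF s(1) subset_refl s(4)[OF assms(3)]] s(3)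
    by (simp add: barycenter_eq)
qed

lemma barycenter_in_simplex:
  assumes "simplicial_complex K" "\<sigma> \<in> K" "\<sigma> \<noteq> {}"
  shows "barycenter \<sigma> \<in> \<sigma>"
  using barycenter_in_rel_interior[OF assms] rel_interior_subset by blast

definition face_chain :: "'a::euclidean_space set set \<Rightarrow> 'a set set \<Rightarrow> bool" where
  "face_chain K c \<longleftrightarrow> c \<subseteq> K - {{}} \<and> (\<forall>\<sigma>\<in>c. \<forall>\<tau>\<in>c. \<sigma> face_of \<tau> \<or> \<tau> face_of \<sigma>)"

lemma barycentric_subdivision_eq:
  "barycentric_subdivision K = {convex hull (barycenter ` c) | c. face_chain K c}"
  by (simp add: barycentric_subdivision_def face_chain_def)

lemma face_chain_subset: "face_chain K c \<Longrightarrow> d \<subseteq> c \<Longrightarrow> face_chain K d"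
  unfolding face_chain_def by blast

lemma face_chain_finite: "simplicial_complex K \<Longrightarrow> face_chain K c \<Longrightarrow> finite c"
  unfolding face_chain_def simplicial_complex_def by (meson Diff_subset finite_subset)

lemma face_chain_top:
  assumes K: "simplicial_complex K" and c: "face_chain K c" "c \<noteq> {}"
  obtains \<sigma> where "\<sigma> \<in> c" "\<And>\<tau>. \<tau> \<in> c \<Longrightarrow> \<tau> face_of \<sigma>"
proof -
  obtain m where m: "m \<in> c" "\<And>\<tau>. \<tau> \<in> c \<Longrightarrow> m \<subseteq> \<tau> \<Longrightarrow> m = \<tau>"
    using finite_has_maximal[OF face_chain_finite[OF K c(1)] c(2)] by metis
  have "\<tau> face_of m" if t: "\<tau> \<in> c" for \<tau>
  proof (cases "\<tau> face_of m")
    case False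
    then have f: "m face_of \<tau>" using c(1) m(1) t unfolding face_chain_def by blast
    then have "m = \<tau>" using m(2)[OF t face_of_imp_subset[OF f]] by simp
    then show ?thesis using f by simp
  qed
  then show ?thesis using that m(1) by blast
qed

text \<open>The barycenter of the largest simplex of a flag lies outside the affine hull of any proper
  face, and hence of all the others.\<close>

lemma barycenters_independent:
  assumes K: "simplicial_complex K"
  shows "face_chain K c \<Longrightarrow> inj_on barycenter c \<and> \<not> affine_dependent (barycenter ` c)"
proof (induction "card c" arbitrary: c)
  case 0
  then have "c = {}" using face_chain_finite[OF K] by auto
  then show ?case by (simp add: affine_independent_0)
next
  case (Suc n)
  then have fin: "finite c" and "c \<noteq> {}" using face_chain_finite[OF K] by auto
  obtain \<sigma> where \<sigma>: "\<sigma> \<in> c" "\<And>\<tau>. \<tau> \<in> c \<Longrightarrow> \<tau> face_of \<sigma>"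
    using face_chain_top[OF K Suc.prems \<open>c \<noteq> {}\<close>] by blast
  let ?d = "c - {\<sigma>}"
  have d: "face_chain K ?d" using face_chain_subset[OF Suc.prems] by blast
  have "card ?d = n" using Suc.hyps(2) fin \<sigma>(1) by simp
  then have IH: "inj_on barycenter ?d" "\<not> affine_dependent (barycenter ` ?d)"
    using Suc.hyps(1) d by blast+
  have \<sigma>K: "\<sigma> \<in> K" "\<sigma> \<noteq> {}" using Suc.prems \<sigma>(1) unfolding face_chain_def by blast+
  have out: "barycenter \<sigma> \<notin> affine hull (barycenter ` ?d)"
  proof (cases "?d = {}")
    case True
    then show ?thesis by (simp only: image_empty affine_hull_empty) simp
  next
    case False
    obtain \<rho> where \<rho>: "\<rho> \<in> ?d" "\<And>\<tau>. \<tau> \<in> ?d \<Longrightarrow> \<tau> face_of \<rho>"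
      using face_chain_top[OF K d False] by blast
    have "barycenter \<tau> \<in> \<rho>" if t: "\<tau> \<in> ?d" for \<tau>
    proof -
      have "\<tau> \<in> K" "\<tau> \<noteq> {}" using d t unfolding face_chain_def by blast+
      then show ?thesis
        using barycenter_in_simplex[OF K] face_of_imp_subset[OF \<rho>(2)[OF t]] by blast
    qed
    then have "affine hull (barycenter ` ?d) \<subseteq> affine hull \<rho>" by (intro hull_mono) blast
    moreover have "affine hull \<rho> \<inter> rel_interior \<sigma> = {}"
      using \<rho>(1) \<sigma>(2)[of \<rho>] complex_simplex(5)[OF K \<sigma>K(1)]
      by (intro affine_hull_face_of_disjoint_rel_interior) auto
    ultimately show ?thesis using barycenter_in_rel_interior[OF K \<sigma>K] by blast
  qed
  have ins: "insert \<sigma> ?d = c" using \<sigma>(1) by blast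
  have "\<not> affine_dependent (insert (barycenter \<sigma>) (barycenter ` ?d))"
    by (rule affine_independent_insert[OF IH(2) out])
  then have "\<not> affine_dependent (barycenter ` c)" using ins by (metis image_insert)
  moreover have "barycenter \<sigma> \<notin> barycenter ` ?d" using out by (meson hull_inc)
  then have "inj_on barycenter (insert \<sigma> ?d)" using IH(1) by (subst inj_on_insert) auto
  ultimately show ?case using ins by simp
qed

text \<open>If a member of the chain contains \<open>w\<close> but not \<open>v\<close>, then it is contained in every member that contains
  \<open>v\<close>, and so \<open>u v < u w\<close>. This makes each member a superlevel set of \<open>u\<close>, at its smallest
  value there; conversely the superlevel set at \<open>w\<close> is the smallest member containing \<open>w\<close>.\<close>

lemma chain_eq_superlevel_sets:
  fixes P :: "'i \<Rightarrow> 'v set" and a u :: "_ \<Rightarrow> real"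
  assumes fin: "finite I" "finite V"
    and chain: "\<And>i j. i \<in> I \<Longrightarrow> j \<in> I \<Longrightarrow> P i \<subseteq> P j \<or> P j \<subseteq> P i"
    and ne: "\<And>i. i \<in> I \<Longrightarrow> P i \<noteq> {}" and V: "(\<Union>i\<in>I. P i) = V"
    and pos: "\<And>i. i \<in> I \<Longrightarrow> 0 < a i"
    and u: "\<And>v. v \<in> V \<Longrightarrow> u v = (\<Sum>i\<in>I. if v \<in> P i then a i else 0)"
  shows "P ` I = (\<lambda>w. {v \<in> V. u w \<le> u v}) ` V"
proof -
  have sep: "u v < u w" if "i \<in> I" "w \<in> P i" "v \<notin> P i" "v \<in> V" for v w i
  proof -
    have w: "w \<in> V" using that V by blast
    have "(\<Sum>i\<in>I. if v \<in> P i then a i else 0) < (\<Sum>i\<in>I. if w \<in> P i then a i else 0)"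
    proof (rule sum_strict_mono_ex1[OF fin(1)])
      show "\<forall>j\<in>I. (if v \<in> P j then a j else 0) \<le> (if w \<in> P j then a j else 0)"
      proof
        fix j assume j: "j \<in> I"
        have "w \<in> P j" if "v \<in> P j" using chain[OF j \<open>i \<in> I\<close>] that \<open>w \<in> P i\<close> \<open>v \<notin> P i\<close> by blast
        then show "(if v \<in> P j then a j else 0) \<le> (if w \<in> P j then a j else 0)"
          using pos[OF j] by auto
      qed
      show "\<exists>j\<in>I. (if v \<in> P j then a j else 0) < (if w \<in> P j then a j else 0)"
        using that pos[of i] by (intro bexI[of _ i]) auto
    qed
    then show ?thesis using u[OF w] u[OF that(4)] by simp
  qed
  have le: "u w \<le> u v" if "w \<in> V" "v \<in> V" "\<And>j. j \<in> I \<Longrightarrow> w \<in> P j \<Longrightarrow> v \<in> P j" for v w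
  proof -
    have "(if w \<in> P j then a j else 0) \<le> (if v \<in> P j then a j else 0)" if "j \<in> I" for j
      using \<open>\<And>j. j \<in> I \<Longrightarrow> w \<in> P j \<Longrightarrow> v \<in> P j\<close>[OF that] pos[OF that] by auto
    then show ?thesis unfolding u[OF that(1)] u[OF that(2)] by (rule sum_mono)
  qed
  show ?thesis
  proof (intro equalityI subsetI)
    fix X assume "X \<in> P ` I"
    then obtain i where i: "i \<in> I" "X = P i" by blast
    have sub: "P i \<subseteq> V" using i V by blast
    then have "finite (u ` P i)" "u ` P i \<noteq> {}" using fin finite_subset ne[OF i(1)] by auto
    then obtain w where w: "w \<in> P i" "u w = Min (u ` P i)" using Min_in by (metis imageE)
    then have "u w \<le> u v" if "v \<in> P i" for v using \<open>finite (u ` P i)\<close> that by simp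
    then have "P i = {v \<in> V. u w \<le> u v}" using sub sep[OF i(1) w(1)] by fastforce
    then show "X \<in> (\<lambda>w. {v \<in> V. u w \<le> u v}) ` V" using i w sub by blast
  next
    fix X assume "X \<in> (\<lambda>w. {v \<in> V. u w \<le> u v}) ` V"
    then obtain w where w: "w \<in> V" "X = {v \<in> V. u w \<le> u v}" by blast
    define J where "J = P ` {i \<in> I. w \<in> P i}"
    have "finite J" "J \<noteq> {}" using fin V w by (auto simp: J_def)
    from finite_has_minimal[OF this]
    obtain Q where QJ: "Q \<in> J" and Qmin: "\<forall>Y\<in>J. Y \<le> Q \<longrightarrow> Q = Y" by (rule bexE)
    obtain i where i: "i \<in> I" "w \<in> P i" "Q = P i" using QJ by (auto simp: J_def)
    have least: "P i \<subseteq> P j" if j: "j \<in> I" "w \<in> P j" for j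
    proof -
      have "P j \<in> J" using j by (auto simp: J_def)
      then show ?thesis using Qmin i(3) chain[OF i(1) j(1)] by auto
    qed
    have "u w \<le> u v" if "v \<in> P i" for v
      using le[OF w(1), of v] that least V i(1) by blast
    then have "X = P i" using w sep[OF i(1,2)] V i(1) by fastforce
    then show "X \<in> P ` I" using i by blast
  qed
qed

text \<open>Among the flags that carry \<open>x\<close> there is a smallest one \<open>d\<close>, formed by the barycenters with nonzero
  coefficient. Its top simplex \<open>G\<close> is the simplex of the complex that has \<open>x\<close> in its relative
  interior, and its other members are the superlevel sets of the coordinates of \<open>x\<close> in \<open>G\<close>. So \<open>d\<close>
  depends on \<open>x\<close> only.\<close>

lemma chain_point_carrier:
  assumes K: "simplicial_complex K" and c: "face_chain K c" and x: "x \<in> convex hull (barycenter ` c)"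
  obtains d G where "d \<subseteq> c" "x \<in> convex hull (barycenter ` d)" "G \<in> d" "x \<in> rel_interior G"
    "verts ` d = (\<lambda>w. {v \<in> verts G. bary_coord (verts G) x w \<le> bary_coord (verts G) x v}) ` verts G"
proof -
  have inj: "inj_on barycenter c" and indep: "\<not> affine_dependent (barycenter ` c)"
    using barycenters_independent[OF K c] by blast+
  have finc: "finite c" by (rule face_chain_finite[OF K c])
  define a where "a \<sigma> = bary_coord (barycenter ` c) x (barycenter \<sigma>)" for \<sigma>
  note coord = bary_coord_hull[OF indep x]
  have a1: "sum a c = 1" using coord(1) inj by (simp add: sum.reindex a_def)
  have ax: "(\<Sum>\<sigma>\<in>c. a \<sigma> *\<^sub>R barycenter \<sigma>) = x" using coord(2) inj by (simp add: sum.reindex a_def)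
  have a0: "0 \<le> a \<sigma>" if "\<sigma> \<in> c" for \<sigma> using coord(3)[of "barycenter \<sigma>"] that by (simp add: a_def)
  define d where "d = {\<sigma> \<in> c. a \<sigma> \<noteq> 0}"
  have dc: "d \<subseteq> c" by (auto simp: d_def)
  have find: "finite d" using dc finc finite_subset by blast
  have d: "face_chain K d" by (rule face_chain_subset[OF c dc])
  have d1: "sum a d = 1"
    using a1 finc by (subst sum.mono_neutral_left[of c d]) (auto simp: d_def)
  have dx: "(\<Sum>\<sigma>\<in>d. a \<sigma> *\<^sub>R barycenter \<sigma>) = x"
    using finc by (subst sum.mono_neutral_left[of c d]) (auto simp: d_def ax)
  have dpos: "0 < a \<sigma>" if "\<sigma> \<in> d" for \<sigma> using that a0[of \<sigma>] by (auto simp: d_def)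
  have xd: "x \<in> convex hull (barycenter ` d)"
    using in_hull_subset_iff[OF indep _ x, of "barycenter ` d"] dc
    by (auto simp: supp_def d_def a_def)
  have "d \<noteq> {}" using d1 by auto
  then obtain G where G: "G \<in> d" "\<And>\<tau>. \<tau> \<in> d \<Longrightarrow> \<tau> face_of G"
    using face_chain_top[OF K d] by blast
  have dK: "\<sigma> \<in> K" "\<sigma> \<noteq> {}" if "\<sigma> \<in> d" for \<sigma> using d that unfolding face_chain_def by blast+
  let ?V = "verts G"
  note s = complex_simplex[OF K dK(1)]
  have V: "\<not> affine_dependent ?V" "finite ?V" "convex hull ?V = G" using s G(1) by blast+
  have sub: "verts \<sigma> \<subseteq> ?V" if "\<sigma> \<in> d" for \<sigma>
    using extreme_point_of_face[OF G(2)[OF that]] by blast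
  define b where "b \<sigma> = a \<sigma> / real (card (verts \<sigma>))" for \<sigma>
  have cardpos: "0 < card (verts \<sigma>)" if "\<sigma> \<in> d" for \<sigma>
    using s(2)[OF that] s(4)[OF that] dK(2)[OF that] by (simp add: card_gt_0_iff)
  then have bpos: "0 < b \<sigma>" if "\<sigma> \<in> d" for \<sigma> using dpos that by (simp add: b_def)
  define u where "u v = (\<Sum>\<sigma>\<in>d. if v \<in> verts \<sigma> then b \<sigma> else 0)" for v
  have swap: "(\<Sum>v\<in>?V. u v *\<^sub>R h v) = (\<Sum>\<sigma>\<in>d. b \<sigma> *\<^sub>R (\<Sum>v\<in>verts \<sigma>. h v))"
    for h :: "'a \<Rightarrow> 'b::real_vector"
  proof -
    have "(\<Sum>v\<in>?V. u v *\<^sub>R h v) = (\<Sum>v\<in>?V. \<Sum>\<sigma>\<in>d. (if v \<in> verts \<sigma> then b \<sigma> *\<^sub>R h v else 0))"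
      by (intro sum.cong refl) (simp add: u_def scaleR_left.sum if_distrib[of "\<lambda>r. r *\<^sub>R _"] cong: if_cong)
    also have "\<dots> = (\<Sum>\<sigma>\<in>d. \<Sum>v\<in>?V. (if v \<in> verts \<sigma> then b \<sigma> *\<^sub>R h v else 0))"
      by (rule sum.swap)
    also have "\<dots> = (\<Sum>\<sigma>\<in>d. \<Sum>v\<in>verts \<sigma>. b \<sigma> *\<^sub>R h v)"
    proof (rule sum.cong[OF refl])
      fix \<sigma> assume \<sigma>: "\<sigma> \<in> d"
      have "(\<Sum>v\<in>?V. if v \<in> verts \<sigma> then b \<sigma> *\<^sub>R h v else 0)
        = (\<Sum>v\<in>verts \<sigma>. if v \<in> verts \<sigma> then b \<sigma> *\<^sub>R h v else 0)"
        by (rule sum.mono_neutral_right) (use V(2) sub[OF \<sigma>] in auto)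
      then show "(\<Sum>v\<in>?V. if v \<in> verts \<sigma> then b \<sigma> *\<^sub>R h v else 0) = (\<Sum>v\<in>verts \<sigma>. b \<sigma> *\<^sub>R h v)"
        by simp
    qed
    finally show ?thesis by (simp add: scaleR_sum_right)
  qed
  have ux: "(\<Sum>v\<in>?V. u v *\<^sub>R v) = x"
  proof -
    have "b \<sigma> *\<^sub>R (\<Sum>v\<in>verts \<sigma>. v) = a \<sigma> *\<^sub>R barycenter \<sigma>" for \<sigma>
      by (simp add: b_def barycenter_eq centroid_def)
    then show ?thesis using swap[of "\<lambda>v. v"] dx by simp
  qed
  have u1: "sum u ?V = 1"
  proof -
    have "b \<sigma> *\<^sub>R (\<Sum>v\<in>verts \<sigma>. 1::real) = a \<sigma>" if "\<sigma> \<in> d" for \<sigma>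
      using cardpos[OF that] by (simp add: b_def)
    then show ?thesis using swap[of "\<lambda>v. 1::real"] d1 by simp
  qed
  have coordu: "bary_coord ?V x v = u v" if "v \<in> ?V" for v
    by (rule bary_coord_eq[OF V(1) u1 ux that])
  have upos: "0 < u v" if "v \<in> ?V" for v
  proof -
    have "0 \<le> (if v \<in> verts \<sigma> then b \<sigma> else 0)" if "\<sigma> \<in> d" for \<sigma>
      using bpos[OF that] by simp
    then have "(if v \<in> verts G then b G else 0) \<le> u v"
      unfolding u_def using find G(1) by (intro member_le_sum) auto
    then show ?thesis using bpos[OF G(1)] that by simp
  qed
  have "x \<in> convex hull ?V"
    using convex_combination_in_hull[OF V(2), of u] upos u1 ux by (simp add: less_imp_le)
  moreover have "supp ?V x = ?V" using coordu upos by (force simp: supp_def)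
  ultimately have xr: "x \<in> rel_interior G" using rel_interior_iff_supp[OF V(1), of x] V(3) by simp
  have "verts ` d = (\<lambda>w. {v \<in> ?V. u w \<le> u v}) ` ?V"
  proof (rule chain_eq_superlevel_sets[where a = b])
    show "verts \<sigma> \<subseteq> verts \<tau> \<or> verts \<tau> \<subseteq> verts \<sigma>" if st: "\<sigma> \<in> d" "\<tau> \<in> d" for \<sigma> \<tau>
    proof -
      have "\<sigma> face_of \<tau> \<or> \<tau> face_of \<sigma>" using st d unfolding face_chain_def by blast
      then show ?thesis using extreme_point_of_face by blast
    qed
    show "(\<Union>\<sigma>\<in>d. verts \<sigma>) = ?V" using sub G(1) by blast
  qed (use find V(2) s(4) dK(2) bpos u_def in auto)
  also have "\<dots> = (\<lambda>w. {v \<in> ?V. bary_coord ?V x w \<le> bary_coord ?V x v}) ` ?V"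
    by (rule image_cong[OF refl]) (use coordu in auto)
  finally show ?thesis by (rule that[OF dc xd G(1) xr])
qed

text \<open>A common point has one smallest flag, which is therefore contained in both flags.\<close>

lemma subdivision_simplices_inter:
  assumes K: "simplicial_complex K" and c: "face_chain K c" and d: "face_chain K d"
  shows "convex hull (barycenter ` c) \<inter> convex hull (barycenter ` d) = convex hull (barycenter ` (c \<inter> d))"
proof
  show "convex hull (barycenter ` (c \<inter> d)) \<subseteq> convex hull (barycenter ` c) \<inter> convex hull (barycenter ` d)"
    by (simp add: hull_mono image_mono)
next
  show "convex hull (barycenter ` c) \<inter> convex hull (barycenter ` d) \<subseteq> convex hull (barycenter ` (c \<inter> d))"
  proof
    fix x assume x: "x \<in> convex hull (barycenter ` c) \<inter> convex hull (barycenter ` d)"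
    obtain c' G where c': "c' \<subseteq> c" "x \<in> convex hull (barycenter ` c')" "G \<in> c'" "x \<in> rel_interior G"
      "verts ` c' = (\<lambda>w. {v \<in> verts G. bary_coord (verts G) x w \<le> bary_coord (verts G) x v}) ` verts G"
      using chain_point_carrier[OF K c, of x] x by blast
    obtain d' H where d': "d' \<subseteq> d" "x \<in> convex hull (barycenter ` d')" "H \<in> d'" "x \<in> rel_interior H"
      "verts ` d' = (\<lambda>w. {v \<in> verts H. bary_coord (verts H) x w \<le> bary_coord (verts H) x v}) ` verts H"
      using chain_point_carrier[OF K d, of x] x by blast
    have cK: "c' \<subseteq> K" and dK: "d' \<subseteq> K" using c d c'(1) d'(1) unfolding face_chain_def by blast+
    have xGH: "x \<in> G \<inter> H" using c'(4) d'(4) rel_interior_subset by blast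
    have f: "G \<inter> H face_of G" "H \<inter> G face_of H"
      using K cK dK c'(3) d'(3) unfolding simplicial_complex_def by blast+
    have "G \<subseteq> G \<inter> H" using subset_of_face_of[OF f(1), of G] xGH c'(4) by blast
    moreover have "H \<subseteq> H \<inter> G" using subset_of_face_of[OF f(2), of H] xGH d'(4) by blast
    ultimately have "G = H" by blast
    then have "verts ` c' = verts ` d'" using c'(5) d'(5) by simp
    then have "(\<lambda>P. convex hull P) ` verts ` c' = (\<lambda>P. convex hull P) ` verts ` d'" by simp
    moreover have "(\<lambda>P. convex hull P) ` verts ` e = e" if "e \<subseteq> K" for e
    proof -
      have "convex hull verts \<sigma> = \<sigma>" if "\<sigma> \<in> e" for \<sigma>
        using complex_simplex(3)[OF K] that \<open>e \<subseteq> K\<close> by blast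
      then show ?thesis by (simp add: image_image)
    qed
    ultimately have "c' = d'" using cK dK by simp
    then have "c' \<subseteq> c \<inter> d" using c'(1) d'(1) by blast
    then show "x \<in> convex hull (barycenter ` (c \<inter> d))"
      using c'(2) hull_mono[of "barycenter ` c'" "barycenter ` (c \<inter> d)" convex] by blast
  qed
qed

lemma simplicial_complex_subdivision:
  assumes K: "simplicial_complex K"
  shows "simplicial_complex (barycentric_subdivision K)"
proof -
  have "finite K" using K unfolding simplicial_complex_def by blast
  moreover have "barycentric_subdivision K \<subseteq> (\<lambda>c. convex hull (barycenter ` c)) ` Pow K"
    unfolding barycentric_subdivision_eq face_chain_def by blast
  ultimately have "finite (barycentric_subdivision K)"
    by (meson finite_Pow_iff finite_imageI finite_subset)
  moreover have "\<exists>n. n simplex \<Delta>" if D: "\<Delta> \<in> barycentric_subdivision K" for \<Delta>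
  proof -
    obtain c where c: "face_chain K c" "\<Delta> = convex hull (barycenter ` c)"
      using D unfolding barycentric_subdivision_eq by blast
    have "\<not> affine_dependent (barycenter ` c)" using barycenters_independent[OF K c(1)] by blast
    then show ?thesis
      unfolding simplex_def c(2)
      by (intro exI[of _ "int (card (barycenter ` c)) - 1"] exI[of _ "barycenter ` c"]) simp
  qed
  moreover have "F \<in> barycentric_subdivision K"
    if "\<Delta> \<in> barycentric_subdivision K" and F: "F face_of \<Delta>" for F \<Delta>
  proof -
    obtain c where c: "face_chain K c" "\<Delta> = convex hull (barycenter ` c)"
      using \<open>\<Delta> \<in> _\<close> unfolding barycentric_subdivision_eq by blast
    obtain P where P: "P \<subseteq> barycenter ` c" "F = convex hull P"
      using face_of_convex_hull_affine_independent barycenters_independent[OF K c(1)] F c(2) by blast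
    obtain d where "d \<subseteq> c" "P = barycenter ` d" using P(1) by (rule subset_imageE)
    then show ?thesis
      using face_chain_subset[OF c(1)] P(2) unfolding barycentric_subdivision_eq by blast
  qed
  moreover have "\<Delta> \<inter> \<Delta>' face_of \<Delta>"
    if D: "\<Delta> \<in> barycentric_subdivision K" "\<Delta>' \<in> barycentric_subdivision K" for \<Delta> \<Delta>'
  proof -
    obtain c where c: "face_chain K c" "\<Delta> = convex hull (barycenter ` c)"
      using D(1) unfolding barycentric_subdivision_eq by blast
    obtain d where d: "face_chain K d" "\<Delta>' = convex hull (barycenter ` d)"
      using D(2) unfolding barycentric_subdivision_eq by blast
    have "barycenter ` (c \<inter> d) \<subseteq> barycenter ` c" by blast
    then show ?thesis
      using subdivision_simplices_inter[OF K c(1) d(1)] c d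
        face_of_convex_hull_affine_independent barycenters_independent[OF K c(1)] by metis
  qed
  ultimately show ?thesis unfolding simplicial_complex_def by blast
qed

lemma subdivision_mono: "L \<subseteq> K \<Longrightarrow> barycentric_subdivision L \<subseteq> barycentric_subdivision K"
  unfolding barycentric_subdivision_eq face_chain_def by blast

lemma subdivision_simplex_subset:
  assumes K: "simplicial_complex K" and c: "face_chain K c" and ne: "c \<noteq> {}"
  obtains \<sigma> where "\<sigma> \<in> c" "convex hull (barycenter ` c) \<subseteq> \<sigma>"
proof -
  obtain \<sigma> where \<sigma>: "\<sigma> \<in> c" "\<And>\<tau>. \<tau> \<in> c \<Longrightarrow> \<tau> face_of \<sigma>"
    using face_chain_top[OF K c ne] by blast
  have cK: "\<tau> \<in> K" "\<tau> \<noteq> {}" if "\<tau> \<in> c" for \<tau> using c that unfolding face_chain_def by blast+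
  have "barycenter \<tau> \<in> \<sigma>" if "\<tau> \<in> c" for \<tau>
    using barycenter_in_simplex[OF K cK[OF that]] face_of_imp_subset[OF \<sigma>(2)[OF that]] by blast
  then have "barycenter ` c \<subseteq> \<sigma>" by blast
  then have "convex hull (barycenter ` c) \<subseteq> \<sigma>"
    using complex_simplex(5)[OF K cK(1)[OF \<sigma>(1)]] by (rule hull_minimal)
  then show ?thesis using that \<sigma>(1) by blast
qed

section \<open>The simplex of a sorted vertex list\<close>

text \<open>A list \<open>w\<close> of the vertices of a simplex describes a maximal flag of its faces, the prefixes of
  \<open>w\<close>. The centroids of these prefixes span a simplex of the barycentric subdivision, and every
  simplex of full dimension in the subdivision of that simplex arises in this way.\<close>

definition prefix_centroid :: "'a::euclidean_space list \<Rightarrow> nat \<Rightarrow> 'a" where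
  "prefix_centroid w i = centroid (set (take (Suc i) w))"

definition prefix_vertices :: "'a::euclidean_space list \<Rightarrow> 'a set" where
  "prefix_vertices w = prefix_centroid w ` {..<length w}"

lemma set_take_nth: "n \<le> length w \<Longrightarrow> set (take n w) = (!) w ` {..<n}"
  using nth_image[of n w] by (simp add: atLeast0LessThan)

lemma sum_set_nth:
  assumes "distinct w" "n \<le> length w"
  shows "sum h (set (take n w)) = (\<Sum>k<n. h (w ! k))"
proof -
  have "inj_on ((!) w) {..<n}" using assms by (intro inj_on_nth) auto
  then show ?thesis using assms(2) by (simp add: set_take_nth sum.reindex)
qed

lemma prefix_centroid_sum:
  assumes "distinct w" "i < length w"
  shows "prefix_centroid w i = (1 / real (Suc i)) *\<^sub>R (\<Sum>k<Suc i. w ! k)"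
proof -
  have "card (set (take (Suc i) w)) = Suc i"
    using assms by (simp add: distinct_card)
  then show ?thesis
    using sum_set_nth[OF assms(1), of "Suc i" "\<lambda>v. v"] assms(2)
    by (simp add: prefix_centroid_def centroid_def)
qed

lemma prefix_face_chain:
  fixes w :: "'a::euclidean_space list"
  assumes K: "simplicial_complex K" and hull: "convex hull (set w) \<in> K"
    and indep: "\<not> affine_dependent (set w)"
  shows "face_chain K ((\<lambda>i. convex hull (set (take (Suc i) w))) ` {..<length w})"
proof -
  have "convex hull (set (take (Suc i) w)) \<in> K - {{}}" if "i < length w" for i
  proof -
    have "convex hull (set (take (Suc i) w)) face_of convex hull (set w)"
      by (rule hull_subset_face[OF indep set_take_subset])
    moreover have "set (take (Suc i) w) \<noteq> {}" using that by auto
    ultimately show ?thesis using K hull unfolding simplicial_complex_def by force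
  qed
  moreover have faces: "convex hull (set (take (Suc i) w)) face_of convex hull (set (take (Suc j) w))"
    if "i \<le> j" for i j
  proof -
    have "\<not> affine_dependent (set (take (Suc j) w))"
      by (rule affine_independent_subset[OF indep set_take_subset])
    moreover have "set (take (Suc i) w) \<subseteq> set (take (Suc j) w)"
      by (rule set_take_subset_set_take) (use that in simp)
    ultimately show ?thesis by (rule hull_subset_face)
  qed
  moreover have "convex hull (set (take (Suc i) w)) face_of convex hull (set (take (Suc j) w)) \<or>
      convex hull (set (take (Suc j) w)) face_of convex hull (set (take (Suc i) w))" for i j
    using faces[of i j] faces[of j i] linear[of i j] by argo
  ultimately show ?thesis
    unfolding face_chain_def by (simp add: image_subset_iff)
qed

lemma prefix_simplex:
  fixes w :: "'a::euclidean_space list"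
  assumes K: "simplicial_complex K" and hull: "convex hull (set w) \<in> K"
    and indep: "\<not> affine_dependent (set w)" and dist: "distinct w"
  shows "inj_on (prefix_centroid w) {..<length w}" "\<not> affine_dependent (prefix_vertices w)"
    "convex hull (prefix_vertices w) \<in> barycentric_subdivision K"
    "card (prefix_vertices w) = length w"
proof -
  let ?h = "\<lambda>i. convex hull (set (take (Suc i) w))"
  let ?c = "?h ` {..<length w}"
  have c: "face_chain K ?c" by (rule prefix_face_chain[OF K hull indep])
  have indep': "\<not> affine_dependent (set (take (Suc i) w))" for i
    by (rule affine_independent_subset[OF indep set_take_subset])
  have eq: "barycenter (?h i) = prefix_centroid w i" for i
    using verts_hull[OF indep'[of i]] by (simp add: barycenter_eq prefix_centroid_def)
  have img: "barycenter ` ?c = prefix_vertices w"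
    unfolding prefix_vertices_def by (simp add: image_image eq)
  have inj: "inj_on ?h {..<length w}"
  proof (rule inj_onI)
    fix i j assume ij: "i \<in> {..<length w}" "j \<in> {..<length w}" "?h i = ?h j"
    then have "set (take (Suc i) w) = set (take (Suc j) w)"
      by (intro convex_hull_inj[OF indep set_take_subset set_take_subset]) simp
    then have "card (set (take (Suc i) w)) = card (set (take (Suc j) w))" by simp
    then show "i = j" using ij dist by (simp add: distinct_card)
  qed
  have "inj_on (barycenter \<circ> ?h) {..<length w}"
    using inj barycenters_independent[OF K c] by (intro comp_inj_on) blast+
  then show injc: "inj_on (prefix_centroid w) {..<length w}" by (simp add: comp_def eq)
  show "\<not> affine_dependent (prefix_vertices w)" using barycenters_independent[OF K c] img by simp
  show "convex hull (prefix_vertices w) \<in> barycentric_subdivision K"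
    unfolding barycentric_subdivision_eq by (rule CollectI, rule exI[of _ ?c]) (simp only: c img simp_thms)
  show "card (prefix_vertices w) = length w"
    unfolding prefix_vertices_def using card_image[OF injc] by simp
qed

lemma nested_sum_swap:
  fixes h :: "nat \<Rightarrow> 'b::real_vector"
  shows "(\<Sum>i<N. a i *\<^sub>R (\<Sum>k<Suc i. h k)) = (\<Sum>k<N. (\<Sum>i\<in>{k..<N}. a i) *\<^sub>R h k)"
proof (induction N)
  case (Suc N)
  have "(\<Sum>k<N. (\<Sum>i\<in>{k..<Suc N}. a i) *\<^sub>R h k) = (\<Sum>k<N. (\<Sum>i\<in>{k..<N}. a i) *\<^sub>R h k + a N *\<^sub>R h k)"
    by (intro sum.cong refl) (simp add: scaleR_left_distrib)
  then show ?case using Suc by (simp add: sum.distrib scaleR_sum_right scaleR_right_distrib)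
qed simp

text \<open>The value \<open>0\<close> beyond the end of \<open>w\<close> makes the last prefix behave like the others: the
  coordinate at the \<open>k\<close>-th prefix centroid is always a multiple of the drop from \<open>k\<close> to \<open>k + 1\<close>.\<close>

definition listed_coord :: "'a::euclidean_space list \<Rightarrow> 'a \<Rightarrow> nat \<Rightarrow> real" where
  "listed_coord w x k = (if k < length w then bary_coord (set w) x (w ! k) else 0)"

lemma listed_coord_eq:
  fixes w :: "'a::euclidean_space list"
  assumes indep: "\<not> affine_dependent (set w)" and dist: "distinct w"
    and s: "(\<Sum>k<length w. s k) = 1" "(\<Sum>k<length w. s k *\<^sub>R (w ! k)) = x" and k: "k < length w"
  shows "listed_coord w x k = s k"
proof -
  have inj: "inj_on ((!) w) {..<length w}" using dist by (intro inj_on_nth) auto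
  define U where "U v = s (the_inv_into {..<length w} ((!) w) v)" for v
  have U: "U (w ! k) = s k" if "k < length w" for k
    using the_inv_into_f_f[OF inj, of k] that by (simp add: U_def)
  have "sum U (set w) = 1" using sum_set_nth[OF dist, of "length w" U] U s(1) by simp
  moreover have "(\<Sum>v\<in>set w. U v *\<^sub>R v) = x"
    using sum_set_nth[OF dist, of "length w" "\<lambda>v. U v *\<^sub>R v"] U s(2) by simp
  ultimately show ?thesis
    using bary_coord_eq[OF indep, of U x "w ! k"] U k by (simp add: listed_coord_def)
qed

lemma listed_coord_hull:
  fixes w :: "'a::euclidean_space list"
  assumes indep: "\<not> affine_dependent (set w)" and dist: "distinct w" and x: "x \<in> convex hull (set w)"
  shows "(\<Sum>k<length w. listed_coord w x k) = 1" "(\<Sum>k<length w. listed_coord w x k *\<^sub>R (w ! k)) = x"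
    "0 \<le> listed_coord w x k"
proof -
  note c = bary_coord_hull[OF indep x]
  show "(\<Sum>k<length w. listed_coord w x k) = 1"
    using sum_set_nth[OF dist, of "length w" "bary_coord (set w) x"] c(1) by (simp add: listed_coord_def)
  show "(\<Sum>k<length w. listed_coord w x k *\<^sub>R (w ! k)) = x"
    using sum_set_nth[OF dist, of "length w" "\<lambda>v. bary_coord (set w) x v *\<^sub>R v"] c(2)
    by (simp add: listed_coord_def)
  show "0 \<le> listed_coord w x k" using c(3)[of "w ! k"] by (simp add: listed_coord_def)
qed

text \<open>The vertex at position \<open>k\<close> receives the share \<open>1 / (i + 1)\<close> of the weight \<open>a i\<close> from every prefix
  with \<open>i \<ge> k\<close>.\<close>

lemma prefix_combination:
  fixes w :: "'a::euclidean_space list"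
  assumes dist: "distinct w"
  shows "(\<Sum>i<length w. a i *\<^sub>R prefix_centroid w i) =
      (\<Sum>k<length w. (\<Sum>i\<in>{k..<length w}. a i / real (Suc i)) *\<^sub>R (w ! k))"
    and "(\<Sum>i<length w. a i) = (\<Sum>k<length w. (\<Sum>i\<in>{k..<length w}. a i / real (Suc i)))"
proof -
  have "a i *\<^sub>R prefix_centroid w i = (a i / real (Suc i)) *\<^sub>R (\<Sum>k<Suc i. w ! k)" if "i < length w" for i
    using prefix_centroid_sum[OF dist that] by simp
  then have "(\<Sum>i<length w. a i *\<^sub>R prefix_centroid w i)
      = (\<Sum>i<length w. (a i / real (Suc i)) *\<^sub>R (\<Sum>k<Suc i. w ! k))"
    by (intro sum.cong) auto
  also have "\<dots> = (\<Sum>k<length w. (\<Sum>i\<in>{k..<length w}. a i / real (Suc i)) *\<^sub>R (w ! k))"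
    by (rule nested_sum_swap)
  finally show "(\<Sum>i<length w. a i *\<^sub>R prefix_centroid w i) =
      (\<Sum>k<length w. (\<Sum>i\<in>{k..<length w}. a i / real (Suc i)) *\<^sub>R (w ! k))" .
  have "(a i / real (Suc i)) *\<^sub>R (\<Sum>k<Suc i. 1::real) = a i" for i by simp
  then have "(\<Sum>i<length w. a i) = (\<Sum>i<length w. (a i / real (Suc i)) *\<^sub>R (\<Sum>k<Suc i. 1::real))"
    by (intro sum.cong refl) (simp only:)
  also have "\<dots> = (\<Sum>k<length w. (\<Sum>i\<in>{k..<length w}. a i / real (Suc i)) *\<^sub>R 1)"
    by (rule nested_sum_swap)
  finally show "(\<Sum>i<length w. a i) = (\<Sum>k<length w. (\<Sum>i\<in>{k..<length w}. a i / real (Suc i)))"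
    by simp
qed

lemma listed_coord_prefix_simplex:
  fixes w :: "'a::euclidean_space list"
  assumes K: "simplicial_complex K" and hull: "convex hull (set w) \<in> K"
    and indep: "\<not> affine_dependent (set w)" and dist: "distinct w"
    and x: "x \<in> convex hull (prefix_vertices w)"
  shows "x \<in> convex hull (set w)"
    and "k < length w \<Longrightarrow> listed_coord w x k - listed_coord w x (Suc k)
      = bary_coord (prefix_vertices w) x (prefix_centroid w k) / real (Suc k)"
proof -
  note p = prefix_simplex[OF K hull indep dist]
  have "prefix_centroid w i \<in> convex hull (set w)" if "i < length w" for i
  proof -
    have "set (take (Suc i) w) \<noteq> {}" using that by auto
    then have "prefix_centroid w i \<in> convex hull (set (take (Suc i) w))"
      unfolding prefix_centroid_def by (intro centroid_in_hull) simp_all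
    then show ?thesis using hull_mono[OF set_take_subset, of convex "Suc i" w] by blast
  qed
  then have "prefix_vertices w \<subseteq> convex hull (set w)" by (auto simp: prefix_vertices_def)
  then have "convex hull (prefix_vertices w) \<subseteq> convex hull (set w)"
    by (intro hull_minimal convex_convex_hull)
  then show "x \<in> convex hull (set w)" using x by blast
  define a where "a i = bary_coord (prefix_vertices w) x (prefix_centroid w i)" for i
  note c = bary_coord_hull[OF p(2) x]
  have a1: "(\<Sum>i<length w. a i) = 1"
    using c(1) p(1) by (simp add: prefix_vertices_def sum.reindex a_def)
  have ax: "(\<Sum>i<length w. a i *\<^sub>R prefix_centroid w i) = x"
    using c(2) p(1) by (simp add: prefix_vertices_def sum.reindex a_def)
  define s where "s k = (\<Sum>i\<in>{k..<length w}. a i / real (Suc i))" for k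
  have s: "(\<Sum>k<length w. s k) = 1" "(\<Sum>k<length w. s k *\<^sub>R (w ! k)) = x"
    using prefix_combination[OF dist, of a] a1 ax by (simp_all add: s_def)
  have eq: "listed_coord w x k = s k" for k
    using listed_coord_eq[OF indep dist s, of k] by (cases "k < length w") (auto simp: listed_coord_def s_def)
  assume "k < length w"
  then have "s k = a k / real (Suc k) + s (Suc k)"
    unfolding s_def by (subst sum.atLeast_Suc_lessThan) auto
  then show "listed_coord w x k - listed_coord w x (Suc k)
      = bary_coord (prefix_vertices w) x (prefix_centroid w k) / real (Suc k)"
    by (simp add: eq a_def)
qed

text \<open>Nonnegative weights on the prefix centroids and nonincreasing coordinates along \<open>w\<close> determine each
  other by summation by parts.\<close>

lemma prefix_simplex_iff:
  fixes w :: "'a::euclidean_space list"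
  assumes K: "simplicial_complex K" and hull: "convex hull (set w) \<in> K"
    and indep: "\<not> affine_dependent (set w)" and dist: "distinct w"
  shows "x \<in> convex hull (prefix_vertices w) \<longleftrightarrow>
    x \<in> convex hull (set w) \<and> (\<forall>k. listed_coord w x (Suc k) \<le> listed_coord w x k)"
proof
  assume x: "x \<in> convex hull (prefix_vertices w)"
  note p = prefix_simplex[OF K hull indep dist]
  note l = listed_coord_prefix_simplex[OF K hull indep dist x]
  have "listed_coord w x (Suc k) \<le> listed_coord w x k" for k
  proof (cases "k < length w")
    case True
    then have "0 \<le> bary_coord (prefix_vertices w) x (prefix_centroid w k)"
      by (intro bary_coord_hull(3)[OF p(2) x]) (auto simp: prefix_vertices_def)
    then have "0 \<le> listed_coord w x k - listed_coord w x (Suc k)" using l(2)[OF True] by simp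
    then show ?thesis by simp
  qed (simp add: listed_coord_def)
  then show "x \<in> convex hull (set w) \<and> (\<forall>k. listed_coord w x (Suc k) \<le> listed_coord w x k)"
    using l(1) by blast
next
  assume x: "x \<in> convex hull (set w) \<and> (\<forall>k. listed_coord w x (Suc k) \<le> listed_coord w x k)"
  define s where "s = listed_coord w x"
  define a where "a k = real (Suc k) * (s k - s (Suc k))" for k
  have apos: "0 \<le> a k" for k using x by (simp add: a_def s_def)
  have tele: "(\<Sum>i\<in>{k..<length w}. a i / real (Suc i)) = s k" if "k \<le> length w" for k
  proof -
    have "(\<Sum>i\<in>{k..<length w}. s (Suc i) - s i) = s (length w) - s k"
      using sum_Suc_diff'[OF that] .
    moreover have "a i / real (Suc i) = - (s (Suc i) - s i)" for i by (simp add: a_def)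
    ultimately show ?thesis by (simp only: sum_negf) (simp add: s_def listed_coord_def)
  qed
  note sh = listed_coord_hull[OF indep dist conjunct1[OF x]]
  have "(\<Sum>i<length w. a i) = 1" using prefix_combination(2)[OF dist, of a] tele sh(1) by (simp add: s_def)
  moreover have "(\<Sum>i<length w. a i *\<^sub>R prefix_centroid w i) = x"
    using prefix_combination(1)[OF dist, of a] tele sh(2) by (simp add: s_def)
  moreover have "(\<Sum>i<length w. a i *\<^sub>R prefix_centroid w i) \<in> convex hull (prefix_vertices w)"
  proof (rule convex_sum)
    show "prefix_centroid w i \<in> convex hull prefix_vertices w" if "i \<in> {..<length w}" for i
      using that by (intro hull_inc) (simp add: prefix_vertices_def)
  qed (use calculation apos in auto)
  ultimately show "x \<in> convex hull (prefix_vertices w)" by simp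
qed

lemma prefix_simplexI:
  fixes w :: "'a::euclidean_space list"
  assumes K: "simplicial_complex K" and hull: "convex hull (set w) \<in> K"
    and indep: "\<not> affine_dependent (set w)" and dist: "distinct w" and x: "x \<in> convex hull (set w)"
    and dec: "\<And>k. Suc k < length w \<Longrightarrow> listed_coord w x (Suc k) \<le> listed_coord w x k"
  shows "x \<in> convex hull (prefix_vertices w)"
proof -
  have "listed_coord w x (Suc k) \<le> listed_coord w x k" for k
  proof (cases "Suc k < length w")
    case False
    then have "listed_coord w x (Suc k) = 0" by (simp add: listed_coord_def)
    then show ?thesis using listed_coord_hull(3)[OF indep dist x] by simp
  qed (rule dec)
  then show ?thesis using prefix_simplex_iff[OF K hull indep dist] x by blast
qed

lemma supp_prefix_simplex:
  fixes w :: "'a::euclidean_space list"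
  assumes K: "simplicial_complex K" and hull: "convex hull (set w) \<in> K"
    and indep: "\<not> affine_dependent (set w)" and dist: "distinct w"
    and x: "x \<in> convex hull (prefix_vertices w)" and k: "k < length w"
  shows "prefix_centroid w k \<in> supp (prefix_vertices w) x \<longleftrightarrow> listed_coord w x (Suc k) < listed_coord w x k"
proof -
  have "prefix_centroid w k \<in> supp (prefix_vertices w) x \<longleftrightarrow>
      listed_coord w x k - listed_coord w x (Suc k) \<noteq> 0"
    using listed_coord_prefix_simplex(2)[OF K hull indep dist x k] k
    by (simp add: supp_def prefix_vertices_def)
  moreover have "listed_coord w x (Suc k) \<le> listed_coord w x k"
    using prefix_simplex_iff[OF K hull indep dist] x by blast
  ultimately show ?thesis by auto
qed

lemma listed_coord_antimono:
  assumes "\<And>k. listed_coord w x (Suc k) \<le> listed_coord w x k" "i \<le> j"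
  shows "listed_coord w x j \<le> listed_coord w x i"
  using assms by (rule lift_Suc_antimono_le)

text \<open>Along a list, a strict inequality at position \<open>i\<close> excludes the facet opposite to the
  \<open>i\<close>-th prefix centroid. The support of a point in the simplex of \<open>w\<close> is the prefix ending at the
  last position with a positive drop, so it is a face of the tile iff some drop at a position
  \<open>m \<ge> j\<close> is positive, that is, iff the point is outside the face spanned by the first \<open>j\<close> centroids.
  If a strict inequality is required at some \<open>i \<ge> j\<close>, then this face is contained in a removed facet,
  and the part is a simplex without some of its facets. Such a part is not critical because the
  last centroid, for which no strict inequality is required, keeps it from being open.\<close>

lemma sorted_part_of_tile:
  fixes w :: "'a::euclidean_space list"
  assumes K: "simplicial_complex K" and hull: "convex hull (set w) \<in> K"
    and indep: "\<not> affine_dependent (set w)" and dist: "distinct w"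
    and Rt: "R \<subseteq> t" "t \<subset> set w" and D: "\<And>i. i \<in> D \<Longrightarrow> Suc i < length w"
    and j: "j = (LEAST m. R \<subseteq> set (take (Suc m) w) \<and> \<not> set (take (Suc m) w) \<subseteq> t)"
  defines "G \<equiv> {x \<in> interval_tile (set w) R t. (\<forall>i. Suc i < length w \<longrightarrow>
      listed_coord w x (Suc i) \<le> listed_coord w x i) \<and> (\<forall>i\<in>D. listed_coord w x (Suc i) < listed_coord w x i)}"
  shows "G \<subseteq> convex hull (prefix_vertices w)"
    and "\<exists>R' t'. R' \<subseteq> t' \<and> t' \<subset> prefix_vertices w \<and> G = interval_tile (prefix_vertices w) R' t'"
    and "critical_tile k G \<longleftrightarrow> D = {..<j} \<and> k = j"
proof -
  let ?N = "length w" and ?s = "listed_coord w" and ?B = "prefix_vertices w" and ?b = "prefix_centroid w"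
  note p = prefix_simplex[OF K hull indep dist]
  have sep: "?b a \<noteq> ?b c" if "a < ?N" "c < ?N" "a \<noteq> c" for a c
    using inj_onD[OF p(1), of a c] that by auto
  define good where "good P \<longleftrightarrow> R \<subseteq> P \<and> \<not> P \<subseteq> t" for P
  have up: "good Q" if "good P" "P \<subseteq> Q" for P Q using that by (auto simp: good_def)
  have N: "0 < ?N" using Rt by (cases w) auto
  have goodN: "good (set (take (Suc (?N - 1)) w))" using Rt N by (auto simp: good_def)
  have jL: "j = (LEAST m. good (set (take (Suc m) w)))" by (simp add: j good_def)
  have goodj: "good (set (take (Suc j) w))" unfolding jL by (rule LeastI[of _ "?N - 1"]) (rule goodN)
  have "j \<le> ?N - 1" unfolding jL by (rule Least_le) (rule goodN)
  then have jN: "j < ?N" using N by linarith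
  have notgood: "\<not> good (set (take j w))"
  proof (cases j)
    case 0
    then show ?thesis by (simp add: good_def)
  next
    case (Suc i)
    then have "\<not> good (set (take (Suc i) w))" using not_less_Least[of i "\<lambda>m. good (set (take (Suc m) w))"] jL by simp
    then show ?thesis using Suc by simp
  qed
  have goodsupp: "good (supp (set w) x) \<longleftrightarrow> (\<exists>m. j \<le> m \<and> m < ?N \<and> ?s x (Suc m) < ?s x m)"
    if x: "x \<in> convex hull ?B" for x
  proof -
    have xV: "x \<in> convex hull (set w)" and dec: "\<And>k. ?s x (Suc k) \<le> ?s x k"
      using x prefix_simplex_iff[OF K hull indep dist] by blast+
    have s0: "0 \<le> ?s x k" for k by (rule listed_coord_hull(3)[OF indep dist xV])
    have supp: "w ! k \<in> supp (set w) x \<longleftrightarrow> ?s x k \<noteq> 0" if "k < ?N" for k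
      using that by (simp add: supp_def listed_coord_def)
    show ?thesis
    proof
      assume g: "good (supp (set w) x)"
      show "\<exists>m. j \<le> m \<and> m < ?N \<and> ?s x (Suc m) < ?s x m"
      proof (rule ccontr)
        assume "\<not> ?thesis"
        then have eq: "?s x (Suc m) = ?s x m" if "j \<le> m" "m < ?N" for m
          using that dec[of m] by (metis less_le)
        have zero: "m \<le> ?N \<Longrightarrow> j \<le> m \<Longrightarrow> ?s x m = 0" for m
        proof (induction m rule: inc_induct)
          case base
          then show ?case by (simp add: listed_coord_def)
        next
          case (step m)
          then show ?case using eq[of m] by simp
        qed
        have "supp (set w) x \<subseteq> set (take j w)"
        proof
          fix v assume v: "v \<in> supp (set w) x"
          then obtain k where k: "k < ?N" "v = w ! k"
            using supp_subset by (metis in_set_conv_nth subset_iff)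
          then have "?s x k \<noteq> 0" using supp v by simp
          then have "k < j" using zero[of k] k by (metis less_imp_le not_le)
          then show "v \<in> set (take j w)" using k jN by (simp add: set_take_nth)
        qed
        then show False using up[OF g] notgood by blast
      qed
    next
      assume "\<exists>m. j \<le> m \<and> m < ?N \<and> ?s x (Suc m) < ?s x m"
      then obtain m where m: "j \<le> m" "m < ?N" "?s x (Suc m) < ?s x m" by blast
      have pos: "0 < ?s x m" using s0[of "Suc m"] m(3) by linarith
      have "set (take (Suc j) w) \<subseteq> supp (set w) x"
      proof
        fix v assume "v \<in> set (take (Suc j) w)"
        then obtain k where k: "k < Suc j" "v = w ! k" using jN by (auto simp: set_take_nth)
        then have "?s x m \<le> ?s x k" using m(1) by (intro listed_coord_antimono[OF dec]) simp
        then show "v \<in> supp (set w) x" using supp[of k] k jN pos by auto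
      qed
      then show "good (supp (set w) x)" using up[OF goodj] by blast
    qed
  qed
  have Gmem: "x \<in> G \<longleftrightarrow> x \<in> convex hull ?B \<and> ?b ` D \<subseteq> supp ?B x \<and> \<not> supp ?B x \<subseteq> ?b ` {..<j}" for x
  proof (cases "x \<in> convex hull ?B")
    case True
    have xV: "x \<in> convex hull (set w)" and dec: "\<And>k. ?s x (Suc k) \<le> ?s x k"
      using True prefix_simplex_iff[OF K hull indep dist] by blast+
    note sb = supp_prefix_simplex[OF K hull indep dist True]
    have 1: "?b ` D \<subseteq> supp ?B x \<longleftrightarrow> (\<forall>i\<in>D. ?s x (Suc i) < ?s x i)"
      using sb D by (auto simp: Suc_lessD)
    have 2: "\<not> supp ?B x \<subseteq> ?b ` {..<j} \<longleftrightarrow> (\<exists>m. j \<le> m \<and> m < ?N \<and> ?s x (Suc m) < ?s x m)"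
    proof
      assume "\<not> supp ?B x \<subseteq> ?b ` {..<j}"
      then obtain v where v: "v \<in> supp ?B x" "v \<notin> ?b ` {..<j}" by blast
      then have "v \<in> ?B" using supp_subset by blast
      then obtain m where "m < ?N" "v = ?b m" by (auto simp: prefix_vertices_def)
      then show "\<exists>m. j \<le> m \<and> m < ?N \<and> ?s x (Suc m) < ?s x m"
        using v sb[of m] by (intro exI[of _ m]) (auto simp: not_less[symmetric])
    next
      assume "\<exists>m. j \<le> m \<and> m < ?N \<and> ?s x (Suc m) < ?s x m"
      then obtain m where m: "j \<le> m" "m < ?N" "?s x (Suc m) < ?s x m" by blast
      then have "?b m \<in> supp ?B x" using sb by blast
      moreover have "?b m \<notin> ?b ` {..<j}"
        using sep m(1,2) by force
      ultimately show "\<not> supp ?B x \<subseteq> ?b ` {..<j}" by blast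
    qed
    show ?thesis
      unfolding G_def interval_tile_def using True xV dec goodsupp[OF True] 1 2 by (auto simp: good_def)
  next
    case False
    have "x \<notin> G"
    proof
      assume x: "x \<in> G"
      then have xV: "x \<in> convex hull (set w)" by (simp add: G_def interval_tile_def)
      have "x \<in> convex hull ?B"
        by (rule prefix_simplexI[OF K hull indep dist xV]) (use x in \<open>simp add: G_def\<close>)
      then show False using False by simp
    qed
    then show ?thesis using False by simp
  qed
  show "G \<subseteq> convex hull ?B" using Gmem by blast
  have bB: "?b i \<in> ?B" if "i < ?N" for i using that by (simp add: prefix_vertices_def)
  have DN: "D \<subseteq> {..<?N}" using D by (auto dest: Suc_lessD)
  have "\<exists>R' t'. R' \<subseteq> t' \<and> t' \<subset> ?B \<and> G = interval_tile ?B R' t' \<and>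
      (\<forall>k. R' = t' \<and> card R' = k \<longleftrightarrow> D = {..<j} \<and> k = j)"
  proof (cases "D \<subseteq> {..<j}")
    case True
    have "{..<j} \<subseteq> {..<?N}" using jN by auto
    then have jB: "?b ` {..<j} \<subseteq> ?B" by (auto simp: prefix_vertices_def)
    have "?b j \<notin> ?b ` {..<j}" using sep jN by force
    then have "?b ` {..<j} \<subset> ?B" using jB bB[OF jN] by blast
    moreover have "?b ` D = ?b ` {..<j} \<longleftrightarrow> D = {..<j}"
      using inj_on_image_eq_iff[OF p(1) DN] \<open>{..<j} \<subseteq> {..<?N}\<close> by blast
    moreover have "card (?b ` {..<j}) = j"
      using inj_on_subset[OF p(1) \<open>{..<j} \<subseteq> {..<?N}\<close>] by (simp add: card_image)
    moreover have "G = interval_tile ?B (?b ` D) (?b ` {..<j})"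
      using Gmem by (auto simp: interval_tile_def)
    ultimately show ?thesis
      using True by (intro exI[of _ "?b ` D"] exI[of _ "?b ` {..<j}"]) auto
  next
    case False
    then obtain i where i: "i \<in> D" "j \<le> i" by (meson lessThan_iff not_le subsetI)
    have iN: "Suc i < ?N" by (rule D[OF i(1)])
    have ci: "?b i \<notin> ?b ` {..<j}" using sep i(2) iN by force
    have sub: "?b ` (D - {i}) \<subseteq> ?B - {?b i}"
      using sep DN iN bB by (auto simp: subset_iff)
    have "?b (?N - 1) \<in> ?B - {?b i}" using sep[of "?N - 1" i] bB[of "?N - 1"] iN by auto
    moreover have "?b (?N - 1) \<notin> ?b ` (D - {i})"
    proof
      assume "?b (?N - 1) \<in> ?b ` (D - {i})"
      then obtain d where d: "d \<in> D" "?b (?N - 1) = ?b d" by blast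
      have "?N - 1 < ?N" "d < ?N" "?N - 1 \<noteq> d" using D[OF d(1)] by linarith+
      then show False using sep d(2) by blast
    qed
    ultimately have ne: "?b ` (D - {i}) \<noteq> ?B - {?b i}" by blast
    have "x \<in> G \<longleftrightarrow> x \<in> interval_tile ?B (?b ` (D - {i})) (?B - {?b i})" for x
    proof -
      have S: "supp ?B x \<subseteq> ?B" by (rule supp_subset)
      have "?b ` D = insert (?b i) (?b ` (D - {i}))" using i(1) by auto
      then have "?b ` D \<subseteq> supp ?B x \<and> \<not> supp ?B x \<subseteq> ?b ` {..<j} \<longleftrightarrow>
          ?b ` (D - {i}) \<subseteq> supp ?B x \<and> ?b i \<in> supp ?B x"
        using ci by (simp only: insert_subset) blast
      moreover have "?b i \<in> supp ?B x \<longleftrightarrow> \<not> supp ?B x \<subseteq> ?B - {?b i}" using S by blast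
      ultimately show ?thesis unfolding Gmem interval_tile_def by simp
    qed
    then have "G = interval_tile ?B (?b ` (D - {i})) (?B - {?b i})" by blast
    moreover have "D \<noteq> {..<j}" using i by auto
    moreover have "?B - {?b i} \<subset> ?B" using bB[of i] iN by auto
    ultimately show ?thesis
      using sub ne by (intro exI[of _ "?b ` (D - {i})"] exI[of _ "?B - {?b i}"]) auto
  qed
  then obtain R' t' where R': "R' \<subseteq> t'" "t' \<subset> ?B" "G = interval_tile ?B R' t'"
    "\<And>k. R' = t' \<and> card R' = k \<longleftrightarrow> D = {..<j} \<and> k = j"
    by blast
  show "\<exists>R' t'. R' \<subseteq> t' \<and> t' \<subset> ?B \<and> G = interval_tile ?B R' t'" using R' by blast
  show "critical_tile k G \<longleftrightarrow> D = {..<j} \<and> k = j"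
    using critical_interval_tile_iff[OF p(2) R'(1,2), of k] R'(3,4) by simp
qed

section \<open>Subdividing one tile by sorting coordinates\<close>

text \<open>Sorting by the number of predecessors avoids the need for a linear order on the type.\<close>

lemma ex_sorted_list:
  assumes "finite V" and trans: "transp r" and irrefl: "irreflp r"
    and total: "\<And>v v'. v \<in> V \<Longrightarrow> v' \<in> V \<Longrightarrow> v \<noteq> v' \<Longrightarrow> r v v' \<or> r v' v"
  obtains w where "distinct w" "set w = V" "sorted_wrt r w"
proof -
  obtain xs where xs: "set xs = V" "distinct xs" using finite_distinct_list[OF assms(1)] by blast
  define rank where "rank v = card {u \<in> V. r u v}" for v
  have mono: "rank v < rank v'" if "v \<in> V" "r v v'" for v v'
  proof -
    have "{u \<in> V. r u v} \<subset> {u \<in> V. r u v'}"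
      using that transpD[OF trans] irreflpD[OF irrefl] by blast
    then show ?thesis unfolding rank_def by (rule psubset_card_mono[rotated]) (simp add: assms(1))
  qed
  define w where "w = sort_key rank xs"
  have w: "distinct w" "set w = V" using xs by (simp_all add: w_def)
  have sorted: "sorted (map rank w)" by (simp add: w_def)
  have "sorted_wrt r w"
  proof (rule sorted_wrt_iff_nth_less[THEN iffD2], intro allI impI)
    fix i j assume ij: "i < j" "j < length w"
    have mem: "w ! i \<in> V" "w ! j \<in> V" using ij w(2) by auto
    have ne: "w ! i \<noteq> w ! j" using ij w(1) by (simp add: nth_eq_iff_index_eq)
    have "rank (w ! i) \<le> rank (w ! j)" using sorted_nth_mono[OF sorted, of i j] ij by simp
    then have "\<not> r (w ! j) (w ! i)" using mono[OF mem(2), of "w ! i"] by auto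
    then show "r (w ! i) (w ! j)" using total[OF mem ne] by blast
  qed
  then show ?thesis using that w by blast
qed

lemma key_sorted_unique:
  fixes \<rho> :: "'v \<Rightarrow> nat"
  assumes "sorted_wrt (\<lambda>a b. \<rho> a < \<rho> b) xs" "sorted_wrt (\<lambda>a b. \<rho> a < \<rho> b) ys" "set xs = set ys"
    "inj_on \<rho> (set xs)"
  shows "xs = ys"
proof -
  have "sorted_wrt (<) (map \<rho> xs)" "sorted_wrt (<) (map \<rho> ys)"
    using assms(1,2) by (simp_all add: sorted_wrt_map)
  then have "map \<rho> xs = map \<rho> ys"
    using assms(3) by (intro sorted_distinct_set_unique) (auto simp: strict_sorted_iff)
  then show ?thesis by (rule map_inj_on) (use assms(3,4) in simp)
qed

definition precedes :: "('a::euclidean_space \<Rightarrow> nat) \<Rightarrow> 'a set \<Rightarrow> 'a \<Rightarrow> 'a \<Rightarrow> 'a \<Rightarrow> bool" where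
  "precedes \<rho> V x v v' \<longleftrightarrow> bary_coord V x v' < bary_coord V x v \<or>
     bary_coord V x v = bary_coord V x v' \<and> \<rho> v < \<rho> v'"

text \<open>The order of the vertices at \<open>x\<close> is equivalent to its inversions with respect to \<open>\<rho>\<close>. They are
  used as the label of a piece since inclusion of inversion sets, the weak order on permutations,
  describes which pieces a closed piece meets.\<close>

definition inversions :: "('a::euclidean_space \<Rightarrow> nat) \<Rightarrow> 'a set \<Rightarrow> 'a \<Rightarrow> ('a \<times> 'a) set" where
  "inversions \<rho> V x = {(v, v'). v \<in> V \<and> v' \<in> V \<and> \<rho> v < \<rho> v' \<and> bary_coord V x v < bary_coord V x v'}"

lemma precedes_transp: "transp (precedes \<rho> V x)"
  by (rule transpI) (auto simp: precedes_def)

lemma precedes_irreflp: "irreflp (precedes \<rho> V x)"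
  by (rule irreflpI) (auto simp: precedes_def)

lemma precedes_total:
  assumes "inj_on \<rho> V" "v \<in> V" "v' \<in> V" "v \<noteq> v'"
  shows "precedes \<rho> V x v v' \<or> precedes \<rho> V x v' v"
proof -
  have "\<rho> v \<noteq> \<rho> v'" using assms by (auto dest: inj_onD)
  then show ?thesis by (auto simp: precedes_def)
qed

lemma ex_vertex_order:
  assumes "finite V" "inj_on \<rho> V"
  obtains w where "distinct w" "set w = V" "sorted_wrt (precedes \<rho> V x) w"
  using ex_sorted_list[OF assms(1) precedes_transp precedes_irreflp precedes_total[OF assms(2)]] .

lemma precedes_iff_inversions:
  assumes "inj_on \<rho> V" "v \<in> V" "v' \<in> V"
  shows "precedes \<rho> V x v v' \<longleftrightarrow>
    \<rho> v < \<rho> v' \<and> (v, v') \<notin> inversions \<rho> V x \<or> \<rho> v' < \<rho> v \<and> (v', v) \<in> inversions \<rho> V x"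
proof (cases "v = v'")
  case True
  then show ?thesis by (simp add: precedes_def)
next
  case False
  then have "\<rho> v \<noteq> \<rho> v'" using assms by (auto dest: inj_onD)
  then show ?thesis using assms(2,3) by (auto simp: precedes_def inversions_def)
qed

text \<open>A strict total order on a finite set and the list sorted by it determine each other.\<close>

lemma inversions_eq_iff_sorted:
  assumes inj: "inj_on \<rho> (set w)" and w: "distinct w" "sorted_wrt (precedes \<rho> (set w) y) w"
  shows "inversions \<rho> (set w) x = inversions \<rho> (set w) y \<longleftrightarrow> sorted_wrt (precedes \<rho> (set w) x) w"
proof
  assume eq: "inversions \<rho> (set w) x = inversions \<rho> (set w) y"
  show "sorted_wrt (precedes \<rho> (set w) x) w"
    using w(2) by (rule sorted_wrt_mono_rel[rotated]) (simp add: precedes_iff_inversions[OF inj] eq)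
next
  assume sx: "sorted_wrt (precedes \<rho> (set w) x) w"
  have idx: "precedes \<rho> (set w) z (w ! i) (w ! j) \<longleftrightarrow> i < j"
    if sz: "sorted_wrt (precedes \<rho> (set w) z) w" and ij: "i < length w" "j < length w" for z i j
  proof -
    have fwd: "precedes \<rho> (set w) z (w ! a) (w ! b)" if "a < b" "b < length w" for a b
      using sz that by (simp add: sorted_wrt_iff_nth_less)
    show ?thesis
    proof
      assume p: "precedes \<rho> (set w) z (w ! i) (w ! j)"
      show "i < j"
      proof (rule ccontr)
        assume "\<not> i < j"
        then consider "i = j" | "j < i" by linarith
        then show False
        proof cases
          case 1
          then show False using p irreflpD[OF precedes_irreflp] by metis
        next
          case 2
          then show False
            using p fwd[OF 2 ij(1)] transpD[OF precedes_transp] irreflpD[OF precedes_irreflp] by metis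
        qed
      qed
    qed (use fwd ij in blast)
  qed
  have "(v, v') \<in> inversions \<rho> (set w) x \<longleftrightarrow> (v, v') \<in> inversions \<rho> (set w) y" for v v'
  proof (cases "v \<in> set w \<and> v' \<in> set w \<and> \<rho> v < \<rho> v'")
    case True
    then obtain i j where ij: "i < length w" "v = w ! i" "j < length w" "v' = w ! j"
      by (metis in_set_conv_nth)
    have "(v, v') \<in> inversions \<rho> (set w) z \<longleftrightarrow> precedes \<rho> (set w) z v' v" for z
      using precedes_iff_inversions[OF inj, of v' v z] True by simp
    then show ?thesis using idx[OF sx ij(3,1)] idx[OF w(2) ij(3,1)] ij by simp
  next
    case False
    then show ?thesis by (auto simp: inversions_def)
  qed
  then show "inversions \<rho> (set w) x = inversions \<rho> (set w) y" by auto
qed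

definition descents :: "('a \<Rightarrow> nat) \<Rightarrow> 'a list \<Rightarrow> nat set" where
  "descents \<rho> w = {i. Suc i < length w \<and> \<rho> (w ! Suc i) < \<rho> (w ! i)}"

lemma sorted_iff_listed_coord:
  assumes inj: "inj_on \<rho> (set w)" and dist: "distinct w"
  shows "sorted_wrt (precedes \<rho> (set w) x) w \<longleftrightarrow>
    (\<forall>i. Suc i < length w \<longrightarrow> listed_coord w x (Suc i) \<le> listed_coord w x i) \<and>
    (\<forall>i\<in>descents \<rho> w. listed_coord w x (Suc i) < listed_coord w x i)"
proof -
  have "precedes \<rho> (set w) x (w ! i) (w ! Suc i) \<longleftrightarrow>
      listed_coord w x (Suc i) \<le> listed_coord w x i \<and>
      (i \<in> descents \<rho> w \<longrightarrow> listed_coord w x (Suc i) < listed_coord w x i)" if i: "Suc i < length w" for i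
  proof -
    have "w ! i \<noteq> w ! Suc i" using dist i by (simp add: nth_eq_iff_index_eq)
    then have "\<rho> (w ! i) \<noteq> \<rho> (w ! Suc i)" using inj_onD[OF inj, of "w ! i" "w ! Suc i"] i by auto
    then show ?thesis using i by (auto simp: precedes_def listed_coord_def descents_def)
  qed
  then show ?thesis
    unfolding sorted_wrt_iff_nth_Suc_transp[OF precedes_transp] by (auto simp: descents_def)
qed

text \<open>On the closed simplex of \<open>w\<close> the coordinates are weakly decreasing along \<open>w\<close>, so a pair with a
  strict inequality appears in \<open>w\<close> in that order.\<close>

lemma inversions_mono_on_prefix_simplex:
  fixes w :: "'a::euclidean_space list"
  assumes K: "simplicial_complex K" and hull: "convex hull (set w) \<in> K"
    and indep: "\<not> affine_dependent (set w)" and dist: "distinct w"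
    and w: "sorted_wrt (precedes \<rho> (set w) y) w"
    and x: "x \<in> convex hull (prefix_vertices w)"
  shows "inversions \<rho> (set w) x \<subseteq> inversions \<rho> (set w) y"
proof
  fix p assume p: "p \<in> inversions \<rho> (set w) x"
  obtain v v' where vv: "p = (v, v')" by (cases p)
  then have v: "v \<in> set w" "v' \<in> set w" "\<rho> v < \<rho> v'" "bary_coord (set w) x v < bary_coord (set w) x v'"
    using p by (auto simp: inversions_def)
  obtain i j where ij: "i < length w" "v = w ! i" "j < length w" "v' = w ! j"
    using v(1,2) by (metis in_set_conv_nth)
  have dec: "\<And>k. listed_coord w x (Suc k) \<le> listed_coord w x k"
    using prefix_simplex_iff[OF K hull indep dist] x by blast
  have "j < i"
  proof (rule ccontr)
    assume "\<not> j < i"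
    then have "listed_coord w x j \<le> listed_coord w x i" by (intro listed_coord_antimono[OF dec]) simp
    then show False using v(4) ij by (simp add: listed_coord_def)
  qed
  then have "precedes \<rho> (set w) y v' v" using w ij by (simp add: sorted_wrt_iff_nth_less)
  then show "p \<in> inversions \<rho> (set w) y" using v(1-3) vv by (auto simp: precedes_def inversions_def)
qed

text \<open>A list that descends on its first \<open>j\<close> positions and ascends afterwards has its minimum at
  position \<open>j\<close>, and is determined by the set of its first \<open>j\<close> entries.\<close>

lemma descents_initial_segment:
  fixes \<rho> :: "'v \<Rightarrow> nat"
  assumes dist: "distinct w" and inj: "inj_on \<rho> (set w)"
    and m: "m \<in> set w" "\<And>v. v \<in> set w \<Longrightarrow> \<rho> m \<le> \<rho> v"
    and D: "descents \<rho> w = {..<j}"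
  shows "sorted_wrt (\<lambda>a b. \<rho> a < \<rho> b) (rev (take j w))" "sorted_wrt (\<lambda>a b. \<rho> a < \<rho> b) (drop j w)"
    "j < length w" "w ! j = m"
proof -
  have down: "Suc i < length w \<and> \<rho> (w ! Suc i) < \<rho> (w ! i)" if "i < j" for i
    using D that by (auto simp: descents_def)
  have up: "\<rho> (w ! i) < \<rho> (w ! Suc i)" if "j \<le> i" "Suc i < length w" for i
  proof -
    have "i \<notin> descents \<rho> w" using D that by auto
    then have le: "\<rho> (w ! i) \<le> \<rho> (w ! Suc i)" using that by (simp add: descents_def)
    have "w ! i \<noteq> w ! Suc i" using dist that by (simp add: nth_eq_iff_index_eq)
    then have "\<rho> (w ! i) \<noteq> \<rho> (w ! Suc i)" using inj_onD[OF inj, of "w ! i" "w ! Suc i"] that by auto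
    then show ?thesis using le by simp
  qed
  show jl: "j < length w"
  proof (cases j)
    case 0
    then show ?thesis using m(1) by (cases w) auto
  next
    case (Suc i)
    then show ?thesis using down[of i] by simp
  qed
  have t: "transp (\<lambda>a b. \<rho> b < \<rho> a)" "transp (\<lambda>a b. \<rho> a < \<rho> b)" by (auto intro: transpI)
  have "sorted_wrt (\<lambda>a b. \<rho> b < \<rho> a) (take j w)"
    unfolding sorted_wrt_iff_nth_Suc_transp[OF t(1)] using down by auto
  then show "sorted_wrt (\<lambda>a b. \<rho> a < \<rho> b) (rev (take j w))" by (simp add: sorted_wrt_rev)
  show "sorted_wrt (\<lambda>a b. \<rho> a < \<rho> b) (drop j w)"
    unfolding sorted_wrt_iff_nth_Suc_transp[OF t(2)] using up jl by auto
  obtain i where i: "i < length w" "w ! i = m" using m(1) by (metis in_set_conv_nth)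
  have "i = j"
  proof (rule linorder_cases)
    assume "i < j"
    then show ?thesis using down[of i] m(2)[of "w ! Suc i"] i by auto
  next
    assume "j < i"
    then obtain i' where "i = Suc i'" "j \<le> i'" by (cases i) auto
    then show ?thesis using up[of i'] m(2)[of "w ! i'"] i by auto
  qed
  then show "w ! j = m" using i by simp
qed

text \<open>The function \<open>f\<close> sends a point to its inversions, for an order \<open>\<rho>\<close> adapted to the tile, and the
  pieces are its fibers. The \<open>\<rho>\<close>-smallest vertex \<open>m\<close> is in \<open>t - R\<close> for a regular tile and outside \<open>t\<close>
  for a critical one. In a critical piece \<open>m\<close> is the vertex whose addition makes the prefix a face of
  the tile. For \<open>m \<notin> R\<close> this is possible only if the prefix before \<open>m\<close> contains \<open>R\<close>, is contained
  in \<open>t\<close>, and \<open>m \<notin> t\<close>. So there are no critical pieces when \<open>m \<in> t - R\<close>, and when \<open>R = t\<close> the prefix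
  is \<open>R\<close> and the list is forced.\<close>

lemma tile_subdivision:
  fixes V :: "'a::euclidean_space set"
  assumes K: "simplicial_complex K" and hull: "convex hull V \<in> K"
    and indep: "\<not> affine_dependent V" and Rt: "R \<subseteq> t" "t \<subset> V"
  defines "T \<equiv> interval_tile V R t"
  obtains f :: "'a \<Rightarrow> ('a \<times> 'a) set" where
    "finite (f ` T)"
    "\<And>y. y \<in> T \<Longrightarrow> morse_tile (barycentric_subdivision K) (card V - 1) {x \<in> T. f x = f y}"
    "\<And>y. y \<in> T \<Longrightarrow> \<exists>Q\<in>barycentric_subdivision K. {x \<in> T. f x = f y} \<subseteq> Q \<and> (\<forall>x\<in>T \<inter> Q. f x \<subseteq> f y)"
    "\<And>y k. R \<noteq> t \<Longrightarrow> y \<in> T \<Longrightarrow> \<not> critical_tile k {x \<in> T. f x = f y}"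
    "R = t \<Longrightarrow> \<exists>y\<in>T. critical_tile (card R) {x \<in> T. f x = f y}"
    "\<And>y k. R = t \<Longrightarrow> y \<in> T \<Longrightarrow> critical_tile k {x \<in> T. f x = f y} \<Longrightarrow> k = card R"
    "\<And>y y' k. R = t \<Longrightarrow> y \<in> T \<Longrightarrow> y' \<in> T \<Longrightarrow> critical_tile k {x \<in> T. f x = f y} \<Longrightarrow>
      critical_tile k {x \<in> T. f x = f y'} \<Longrightarrow> f y = f y'"
proof -
  have fin: "finite V" by (rule aff_independent_finite[OF indep])
  obtain m where m: "m \<in> V" "m \<notin> R" "R \<noteq> t \<Longrightarrow> m \<in> t"
  proof (cases "R = t")
    case True
    then show ?thesis using that Rt by blast
  next
    case False
    then show ?thesis using that Rt by blast
  qed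
  obtain \<rho>0 :: "'a \<Rightarrow> nat" where \<rho>0: "inj_on \<rho>0 V"
    using finite_imp_inj_to_nat_seg[OF fin] by blast
  define \<rho> where "\<rho> v = (if v = m then 0 else Suc (\<rho>0 v))" for v
  have inj: "inj_on \<rho> V" using \<rho>0 by (auto simp: inj_on_def \<rho>_def)
  have \<rho>m: "\<rho> m = 0" by (simp add: \<rho>_def)
  define f where "f = inversions \<rho> V"
  define Fib where "Fib y = {x \<in> T. f x = f y}" for y
  define J where "J w = (LEAST i. R \<subseteq> set (take (Suc i) w) \<and> \<not> set (take (Suc i) w) \<subseteq> t)" for w
  have fib: "Fib y \<subseteq> convex hull (prefix_vertices w)"
      "\<exists>R' t'. R' \<subseteq> t' \<and> t' \<subset> prefix_vertices w \<and> Fib y = interval_tile (prefix_vertices w) R' t'"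
      "critical_tile k (Fib y) \<longleftrightarrow> descents \<rho> w = {..<J w} \<and> k = J w"
    if w: "distinct w" "set w = V" "sorted_wrt (precedes \<rho> V y) w" for y w k
  proof -
    have Fib: "Fib y = {x \<in> interval_tile (set w) R t. (\<forall>i. Suc i < length w \<longrightarrow>
        listed_coord w x (Suc i) \<le> listed_coord w x i) \<and>
        (\<forall>i\<in>descents \<rho> w. listed_coord w x (Suc i) < listed_coord w x i)}"
      unfolding Fib_def f_def T_def
      using inversions_eq_iff_sorted[of \<rho> w y] sorted_iff_listed_coord[of \<rho> w] inj w by simp
    have D: "Suc i < length w" if "i \<in> descents \<rho> w" for i using that by (simp add: descents_def)
    note s = sorted_part_of_tile[of K w R t "descents \<rho> w" "J w", folded Fib]
    have a: "convex hull (set w) \<in> K" "\<not> affine_dependent (set w)" "t \<subset> set w"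
      using hull indep Rt w(2) by simp_all
    show "Fib y \<subseteq> convex hull (prefix_vertices w)"
      by (rule s(1)[OF K a(1,2) w(1) Rt(1) a(3) D]) (simp_all add: J_def)
    show "\<exists>R' t'. R' \<subseteq> t' \<and> t' \<subset> prefix_vertices w \<and> Fib y = interval_tile (prefix_vertices w) R' t'"
      by (rule s(2)[OF K a(1,2) w(1) Rt(1) a(3) D]) (simp_all add: J_def)
    show "critical_tile k (Fib y) \<longleftrightarrow> descents \<rho> w = {..<J w} \<and> k = J w"
      by (rule s(3)[OF K a(1,2) w(1) Rt(1) a(3) D]) (simp_all add: J_def)
  qed
  \<comment> \<open>\<open>J w\<close> is the position at which the prefixes of \<open>w\<close> enter the tile.\<close>
  have order: "\<exists>w. distinct w \<and> set w = V \<and> sorted_wrt (precedes \<rho> V y) w" for y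
    using ex_vertex_order[OF fin inj] by metis
  have crit: "R = t \<and> set (take j w) = R \<and> j = card R"
      "sorted_wrt (\<lambda>a b. \<rho> a < \<rho> b) (rev (take j w))" "sorted_wrt (\<lambda>a b. \<rho> a < \<rho> b) (drop j w)"
    if w: "distinct w" "set w = V" and j: "j = J w" "descents \<rho> w = {..<j}" for w j
  proof -
    have mw: "m \<in> set w" "\<And>v. v \<in> set w \<Longrightarrow> \<rho> m \<le> \<rho> v" "inj_on \<rho> (set w)"
      using m w inj \<rho>m by simp_all
    note d = descents_initial_segment[OF w(1) mw(3,1,2) j(2)]
    show "sorted_wrt (\<lambda>a b. \<rho> a < \<rho> b) (rev (take j w))" by (rule d(1))
    show "sorted_wrt (\<lambda>a b. \<rho> a < \<rho> b) (drop j w)" by (rule d(2))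
    define good where "good i \<longleftrightarrow> R \<subseteq> set (take (Suc i) w) \<and> \<not> set (take (Suc i) w) \<subseteq> t" for i
    have "good (length w - 1)" using Rt w d(3) by (auto simp: good_def)
    then have gj: "good j" unfolding j(1) J_def good_def by (rule LeastI)
    have ins: "set (take (Suc j) w) = insert m (set (take j w))"
      using d(3,4) by (simp add: take_Suc_conv_app_nth)
    have Rsub: "R \<subseteq> set (take j w)" using gj m(2) ins by (auto simp: good_def)
    have "set (take j w) \<subseteq> t"
    proof (cases j)
      case (Suc i)
      then have "\<not> good i" using not_less_Least[of i good] j(1) by (simp add: J_def good_def)
      then show ?thesis using Suc Rsub by (auto simp: good_def)
    qed simp
    then have "\<not> m \<in> t" using gj ins by (auto simp: good_def)
    then have "R = t" using m(3) by blast
    then have "set (take j w) = R" using Rsub \<open>set (take j w) \<subseteq> t\<close> by blast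
    moreover have "card (set (take j w)) = j" using w(1) d(3) by (simp add: distinct_card)
    ultimately show "R = t \<and> set (take j w) = R \<and> j = card R" using \<open>R = t\<close> by simp
  qed
  show ?thesis
  proof (rule that[of f, folded Fib_def])
    have "f ` T \<subseteq> Pow (V \<times> V)" by (auto simp: f_def inversions_def)
    then show "finite (f ` T)" using fin by (meson finite_Pow_iff finite_SigmaI finite_subset)
  next
    fix y assume "y \<in> T"
    obtain w where w: "distinct w" "set w = V" "sorted_wrt (precedes \<rho> V y) w" using order by blast
    note p = prefix_simplex[OF K, of w, unfolded w(2), OF hull indep w(1)]
    obtain R' t' where R': "R' \<subseteq> t'" "t' \<subset> prefix_vertices w"
      "Fib y = interval_tile (prefix_vertices w) R' t'"
      using fib(2)[OF w] by blast
    have "card (prefix_vertices w) = card V" using p(4) w distinct_card by metis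
    then show "morse_tile (barycentric_subdivision K) (card V - 1) (Fib y)"
      unfolding morse_tile_def using interval_tile_is_tile[OF p(2) R'(1,2)] p(3) R'(3) by metis
  next
    fix y assume "y \<in> T"
    obtain w where w: "distinct w" "set w = V" "sorted_wrt (precedes \<rho> V y) w" using order by blast
    note p = prefix_simplex[OF K, of w, unfolded w(2), OF hull indep w(1)]
    have "f x \<subseteq> f y" if "x \<in> convex hull (prefix_vertices w)" for x
      using inversions_mono_on_prefix_simplex[OF K, of w \<rho> y x, unfolded w(2), OF hull indep w(1,3) that]
      by (simp add: f_def)
    then show "\<exists>Q\<in>barycentric_subdivision K. Fib y \<subseteq> Q \<and> (\<forall>x\<in>T \<inter> Q. f x \<subseteq> f y)"
      using fib(1)[OF w] p(3) by blast
  next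
    fix y k assume "R \<noteq> t" "y \<in> T"
    obtain w where w: "distinct w" "set w = V" "sorted_wrt (precedes \<rho> V y) w" using order by blast
    show "\<not> critical_tile k (Fib y)"
      using fib(3)[OF w] crit(1)[OF w(1,2) refl] \<open>R \<noteq> t\<close> by blast
  next
    fix y k assume "R = t" "y \<in> T" "critical_tile k (Fib y)"
    obtain w where w: "distinct w" "set w = V" "sorted_wrt (precedes \<rho> V y) w" using order by blast
    show "k = card R"
      using fib(3)[OF w, of k] crit(1)[OF w(1,2) refl] \<open>critical_tile k (Fib y)\<close> by blast
  next
    fix y y' k assume y: "R = t" "y \<in> T" "y' \<in> T" "critical_tile k (Fib y)" "critical_tile k (Fib y')"
    obtain w where w: "distinct w" "set w = V" "sorted_wrt (precedes \<rho> V y) w" using order by blast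
    obtain w' where w': "distinct w'" "set w' = V" "sorted_wrt (precedes \<rho> V y') w'" using order by blast
    have k: "k = J w" "descents \<rho> w = {..<k}" using fib(3)[OF w, of k] y(4) by auto
    have k': "k = J w'" "descents \<rho> w' = {..<k}" using fib(3)[OF w', of k] y(5) by auto
    note c = crit[OF w(1,2) k] and c' = crit[OF w'(1,2) k']
    have sub: "inj_on \<rho> (set (rev (take k w)))" "inj_on \<rho> (set (drop k w))"
      using inj w(2) set_take_subset set_drop_subset by (metis inj_on_subset set_rev)+
    have take_R: "set (take k w) = R" "set (take k w') = R" using c(1) c'(1) by blast+
    have "rev (take k w) = rev (take k w')"
      by (rule key_sorted_unique[OF c(2) c'(2) _ sub(1)]) (simp only: set_rev take_R)
    then have tk: "take k w = take k w'" by simp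
    have "set (drop k u) = V - R" if "distinct u" "set u = V" "set (take k u) = R" for u
    proof -
      have "set (take k u) \<union> set (drop k u) = V" by (metis append_take_drop_id set_append that(2))
      moreover have "set (take k u) \<inter> set (drop k u) = {}"
        by (rule set_take_disj_set_drop_if_distinct) (use that in auto)
      ultimately show ?thesis using that(3) by blast
    qed
    then have "set (drop k w) = set (drop k w')" using w(1,2) w'(1,2) take_R by simp
    then have "drop k w = drop k w'" by (intro key_sorted_unique[OF c(3) c'(3) _ sub(2)])
    then have "w = w'" using tk by (metis append_take_drop_id)
    then show "f y = f y'"
      using inversions_eq_iff_sorted[of \<rho> w y' y] inj w w' by (simp add: f_def)
  next
    assume eq: "R = t"
    have RV: "R \<subseteq> V" using Rt by auto
    then have fR: "finite R" "finite (V - R)" using fin by (auto intro: finite_subset)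
    have ord: "transp (\<lambda>a b. \<rho> a < \<rho> b)" "irreflp (\<lambda>a b. \<rho> a < \<rho> b)"
      by (auto intro: transpI irreflpI)
    have tot: "\<rho> a < \<rho> b \<or> \<rho> b < \<rho> a" if "a \<in> V" "b \<in> V" "a \<noteq> b" for a b
      using inj_onD[OF inj _ that(1,2)] that(3) by (meson linorder_neqE_nat)
    obtain xs where xs: "distinct xs" "set xs = R" "sorted_wrt (\<lambda>a b. \<rho> a < \<rho> b) xs"
      by (rule ex_sorted_list[OF fR(1) ord tot[OF subsetD[OF RV] subsetD[OF RV]]])
    obtain ys where ys: "distinct ys" "set ys = V - R" "sorted_wrt (\<lambda>a b. \<rho> a < \<rho> b) ys"
      by (rule ex_sorted_list[OF fR(2) ord tot[OF DiffD1 DiffD1]])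
    \<comment> \<open>The list of the critical piece: \<open>R\<close> in decreasing order, then \<open>m\<close>, then the rest in
      increasing order.\<close>
    define w where "w = rev xs @ ys"
    define j where "j = length xs"
    have w: "distinct w" "set w = V" using xs ys Rt eq by (auto simp: w_def)
    have cj: "j = card R" using xs distinct_card j_def by metis
    have ysne: "0 < length ys" using ys(2) m(1,2) by (cases ys) auto
    have lw: "length w = j + length ys" by (simp add: w_def j_def)
    have nth2: "w ! (j + i) = ys ! i" for i by (simp add: w_def j_def nth_append)
    have "m \<in> set ys" using ys(2) m by blast
    then obtain i0 where i0: "i0 < length ys" "ys ! i0 = m" by (metis in_set_conv_nth)
    have wj: "\<rho> (w ! j) = 0"
    proof (cases i0)
      case 0
      then show ?thesis using nth2[of 0] i0 \<rho>m by simp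
    next
      case (Suc i)
      then have "\<rho> (ys ! 0) < \<rho> (ys ! i0)" using sorted_wrt_nth_less[OF ys(3), of 0 i0] i0 Suc by simp
      then show ?thesis using i0 \<rho>m by simp
    qed
    have D: "descents \<rho> w = {..<j}"
    proof -
      have "i \<in> descents \<rho> w \<longleftrightarrow> i < j" for i
      proof (cases "i < j")
        case True
        have "Suc i < length w" using True lw ysne by linarith
        moreover have "\<rho> (w ! Suc i) < \<rho> (w ! i)"
        proof (cases "Suc i = j")
          case True
          have "w ! i \<noteq> m"
          proof -
            have "w ! i \<in> set (rev xs)" using \<open>i < j\<close> by (simp add: w_def j_def nth_append rev_nth)
            then show ?thesis using xs(2) m(2) by auto
          qed
          then have "0 < \<rho> (w ! i)" by (simp add: \<rho>_def)
          then show ?thesis using True wj by simp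
        next
          case False
          then have "Suc i < j" using True by simp
          moreover have "sorted_wrt (\<lambda>a b. \<rho> b < \<rho> a) (rev xs)" using xs(3) by (simp add: sorted_wrt_rev)
          ultimately show ?thesis
            using sorted_wrt_nth_less[of _ "rev xs" i "Suc i"] by (simp add: w_def j_def nth_append)
        qed
        ultimately show ?thesis using True by (simp add: descents_def)
      next
        case False
        then obtain a where a: "i = j + a" by (metis le_iff_add not_less)
        have "\<not> \<rho> (w ! Suc i) < \<rho> (w ! i)" if "Suc i < length w"
        proof -
          have "\<rho> (ys ! a) < \<rho> (ys ! Suc a)"
            using sorted_wrt_nth_less[OF ys(3), of a "Suc a"] that a lw by simp
          then show ?thesis using nth2[of a] nth2[of "Suc a"] a by simp
        qed
        then show ?thesis using False by (auto simp: descents_def)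
      qed
      then show ?thesis by auto
    qed
    have Jj: "J w = j" unfolding J_def
    proof (rule Least_equality)
      have "take (Suc j) w = rev xs @ [ys ! 0]"
        using ysne by (cases ys) (auto simp: w_def j_def)
      moreover have "ys ! 0 \<notin> t" using ys(2) ysne eq nth_mem by blast
      ultimately show "R \<subseteq> set (take (Suc j) w) \<and> \<not> set (take (Suc j) w) \<subseteq> t"
        using xs(2) by auto
    next
      fix i assume i: "R \<subseteq> set (take (Suc i) w) \<and> \<not> set (take (Suc i) w) \<subseteq> t"
      show "j \<le> i"
      proof (rule ccontr)
        assume "\<not> j \<le> i"
        then have "take (Suc i) w = take (Suc i) (rev xs)" by (simp add: w_def j_def)
        then have "set (take (Suc i) w) \<subseteq> R" using set_take_subset[of "Suc i" "rev xs"] xs(2) by simp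
        then show False using i eq by blast
      qed
    qed
    \<comment> \<open>Positive coordinates that strictly decrease along \<open>w\<close> give a point of this piece.\<close>
    define A where "A = (\<Sum>k<length w. real (length w - k))"
    define s where "s k = real (length w - k) / A" for k
    have wpos: "0 < length w" using lw ysne by simp
    then have "0 < A" unfolding A_def by (intro sum_pos) auto
    have s1: "(\<Sum>k<length w. s k) = 1" using \<open>0 < A\<close> by (simp add: s_def A_def flip: sum_divide_distrib)
    define y where "y = (\<Sum>k<length w. s k *\<^sub>R (w ! k))"
    have indw: "\<not> affine_dependent (set w)" using indep w(2) by simp
    have ly: "listed_coord w y k = s k" if "k < length w" for k
      by (rule listed_coord_eq[OF indw w(1) s1 _ that]) (simp add: y_def)
    have yV: "y \<in> convex hull V"
      unfolding y_def
    proof (rule convex_sum)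
      show "0 \<le> s k" for k using \<open>0 < A\<close> by (simp add: s_def)
      show "w ! k \<in> convex hull V" if "k \<in> {..<length w}" for k
        using that w(2) by (intro hull_inc) auto
    qed (use s1 in auto)
    have "supp V y = V"
    proof -
      have "bary_coord V y v \<noteq> 0" if v: "v \<in> V" for v
      proof -
        obtain k where k: "k < length w" "v = w ! k" using v w(2) by (metis in_set_conv_nth)
        then show ?thesis using ly[OF k(1)] w(2) \<open>0 < A\<close> by (simp add: listed_coord_def s_def)
      qed
      then show ?thesis by (auto simp: supp_def)
    qed
    then have yT: "y \<in> T" using yV Rt by (auto simp: T_def interval_tile_def)
    have "listed_coord w y (Suc i) < listed_coord w y i" if "Suc i < length w" for i
      using ly[OF that] ly[of i] that \<open>0 < A\<close> by (simp add: s_def divide_strict_right_mono)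
    then have "sorted_wrt (precedes \<rho> V y) w"
      using sorted_iff_listed_coord[of \<rho> w y] inj w by (auto simp: descents_def less_imp_le)
    then have "critical_tile (card R) (Fib y)" using fib(3)[OF w, of y "card R"] D Jj cj by simp
    then show "\<exists>y\<in>T. critical_tile (card R) (Fib y)" using yT by blast
  qed
qed

section \<open>Relatively closed subsets\<close>

lemma subcomplexI:
  assumes K: "simplicial_complex K" and "L \<subseteq> K" and faces: "\<And>\<sigma> F. \<sigma> \<in> L \<Longrightarrow> F face_of \<sigma> \<Longrightarrow> F \<in> L"
  shows "subcomplex L K"
proof -
  have "finite L" using K \<open>L \<subseteq> K\<close> unfolding simplicial_complex_def by (meson finite_subset)
  then show ?thesis
    using K \<open>L \<subseteq> K\<close> faces unfolding subcomplex_def simplicial_complex_def by (auto simp: subset_iff)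
qed

lemma subcomplexD:
  assumes "subcomplex L K"
  shows "L \<subseteq> K" "\<sigma> \<in> L \<Longrightarrow> F face_of \<sigma> \<Longrightarrow> F \<in> L"
  using assms unfolding subcomplex_def simplicial_complex_def by blast+

definition relatively_closed :: "'a::euclidean_space set set \<Rightarrow> 'a set \<Rightarrow> 'a set \<Rightarrow> bool" where
  "relatively_closed K S U \<longleftrightarrow> (\<exists>L. subcomplex L K \<and> U = S \<inter> \<Union>L)"

lemma relatively_closed_empty:
  assumes "simplicial_complex K"
  shows "relatively_closed K S {}"
proof -
  have "subcomplex {} K" by (rule subcomplexI[OF assms]) auto
  then show ?thesis unfolding relatively_closed_def by (intro exI[of _ "{}"]) auto
qed

lemma relatively_closed_Un:
  assumes K: "simplicial_complex K" and "relatively_closed K S U" "relatively_closed K S U'"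
  shows "relatively_closed K S (U \<union> U')"
proof -
  obtain L L' where L: "subcomplex L K" "U = S \<inter> \<Union>L" "subcomplex L' K" "U' = S \<inter> \<Union>L'"
    using assms(2,3) unfolding relatively_closed_def by blast
  have "subcomplex (L \<union> L') K"
    using subcomplexD[OF L(1)] subcomplexD[OF L(3)] by (intro subcomplexI[OF K]) blast+
  then show ?thesis using L unfolding relatively_closed_def by (intro exI[of _ "L \<union> L'"]) auto
qed

text \<open>A common point of two simplices of \<open>K\<close> lies in their intersection, which is a face of both and so
  belongs to both subcomplexes.\<close>

lemma relatively_closed_Int:
  assumes K: "simplicial_complex K" and "relatively_closed K S U" "relatively_closed K S U'"
  shows "relatively_closed K S (U \<inter> U')"
proof -
  obtain L L' where L: "subcomplex L K" "U = S \<inter> \<Union>L" "subcomplex L' K" "U' = S \<inter> \<Union>L'"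
    using assms(2,3) unfolding relatively_closed_def by blast
  have "subcomplex (L \<inter> L') K"
    using subcomplexD[OF L(1)] subcomplexD[OF L(3)] by (intro subcomplexI[OF K]) blast+
  moreover have "\<Union>L \<inter> \<Union>L' \<subseteq> \<Union>(L \<inter> L')"
  proof
    fix x assume "x \<in> \<Union>L \<inter> \<Union>L'"
    then obtain \<sigma> \<tau> where st: "\<sigma> \<in> L" "\<tau> \<in> L'" "x \<in> \<sigma> \<inter> \<tau>" by blast
    have "\<sigma> \<in> K" "\<tau> \<in> K" using st subcomplexD(1)[OF L(1)] subcomplexD(1)[OF L(3)] by blast+
    then have "\<sigma> \<inter> \<tau> face_of \<sigma>" "\<tau> \<inter> \<sigma> face_of \<tau>" using K unfolding simplicial_complex_def by blast+
    then have "\<sigma> \<inter> \<tau> \<in> L" "\<tau> \<inter> \<sigma> \<in> L'"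
      using subcomplexD(2)[OF L(1) st(1)] subcomplexD(2)[OF L(3) st(2)] by blast+
    then show "x \<in> \<Union>(L \<inter> L')" using st(3) by (auto simp: Int_commute)
  qed
  ultimately show ?thesis
    using L unfolding relatively_closed_def by (intro exI[of _ "L \<inter> L'"]) auto
qed

lemma relatively_closed_simplex:
  assumes K: "simplicial_complex K" and Q: "Q \<in> K"
  shows "relatively_closed K S (S \<inter> Q)"
proof -
  let ?L = "{F. F face_of Q}"
  have "?L \<subseteq> K" using K Q unfolding simplicial_complex_def by blast
  then have "subcomplex ?L K" by (rule subcomplexI[OF K]) (auto intro: face_of_trans)
  moreover have "Q face_of Q" using face_of_refl complex_simplex(5)[OF K Q] by blast
  then have "\<Union>?L = Q" using face_of_imp_subset by blast
  ultimately show ?thesis unfolding relatively_closed_def by (intro exI[of _ ?L]) simp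
qed

lemma relatively_closed_finite_Union:
  assumes K: "simplicial_complex K" and "finite A" "\<And>a. a \<in> A \<Longrightarrow> relatively_closed K S (U a)"
  shows "relatively_closed K S (\<Union>a\<in>A. U a)"
  using assms(2,3)
proof (induction A rule: finite_induct)
  case empty
  then show ?case using relatively_closed_empty[OF K] by simp
next
  case (insert a A)
  then show ?case using relatively_closed_Un[OF K] by simp
qed

section \<open>Shellings built one tile at a time\<close>

text \<open>A filtration grows by one tile at a time, so it can be replaced by the inductively
  generated collections of tiles. Refining the filtration tile by tile then is an induction, with no
  reindexing of sequences.\<close>

inductive shelled :: "'a::euclidean_space set set \<Rightarrow> 'a set \<Rightarrow> 'a set set \<Rightarrow> bool" for K S where
  empty: "shelled K S {}"
| insert: "shelled K S \<U> \<Longrightarrow> T \<noteq> {} \<Longrightarrow> T \<inter> \<Union>\<U> = {} \<Longrightarrow> relatively_closed K S (\<Union>\<U> \<union> T) \<Longrightarrow>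
    shelled K S (insert T \<U>)"

lemma shelled_relatively_closed:
  assumes "simplicial_complex K" "shelled K S \<U>"
  shows "relatively_closed K S (\<Union>\<U>)"
  using assms(2)
proof cases
  case empty
  then show ?thesis using relatively_closed_empty[OF assms(1)] by simp
next
  case (insert \<V> T)
  then show ?thesis by (simp add: Un_commute)
qed

lemma morse_tiled_subset_eq:
  "morse_tiled_subset K S \<T> U \<longleftrightarrow> (\<exists>\<U>\<subseteq>\<T>. U = \<Union>\<U>) \<and> relatively_closed K S U"
  by (simp add: morse_tiled_subset_def relatively_closed_def)

lemma morse_shellable_imp_shelled:
  assumes "morse_shellable K S"
  obtains \<T> where "morse_tiling K S \<T>" "shelled K S \<T>"
proof -
  obtain \<T> and N :: nat and A where \<T>: "morse_tiling K S \<T>" and A: "A 0 = {}" "A N = S"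
    "\<forall>i\<le>N. morse_tiled_subset K S \<T> (A i)"
    "\<forall>i\<in>{1..N}. A (i - 1) \<subset> A i \<and> A i - A (i - 1) \<in> \<T>"
    using assms unfolding morse_shellable_def by (elim exE conjE) (rule that; assumption)
  have part: "partition_on S \<T>" using \<T> unfolding morse_tiling_def by blast
  define \<D> where "\<D> i = (\<lambda>i. A (Suc i) - A i) ` {..<i}" for i :: nat
  have step: "A i \<subset> A (Suc i)" "A (Suc i) - A i \<in> \<T>" if "i < N" for i
    using A(4)[rule_format, of "Suc i"] that by auto
  have "i \<le> N \<Longrightarrow> shelled K S (\<D> i) \<and> \<Union>(\<D> i) = A i" for i
  proof (induction i)
    case 0
    then show ?case using A(1) by (simp add: \<D>_def shelled.empty)
  next
    case (Suc i)
    then have IH: "shelled K S (\<D> i)" "\<Union>(\<D> i) = A i" and s: "A i \<subset> A (Suc i)"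
      using step(1)[of i] by auto
    have un: "\<Union>(\<D> i) \<union> (A (Suc i) - A i) = A (Suc i)" using IH(2) s by blast
    have "relatively_closed K S (A (Suc i))" using A(3) Suc.prems by (simp add: morse_tiled_subset_eq)
    then have "shelled K S (insert (A (Suc i) - A i) (\<D> i))"
      using IH s un by (intro shelled.insert) auto
    moreover have "insert (A (Suc i) - A i) (\<D> i) = \<D> (Suc i)"
      by (simp add: \<D>_def lessThan_Suc)
    ultimately show ?case using un by (metis Union_insert Un_commute)
  qed
  then have sh: "shelled K S (\<D> N)" and un: "\<Union>(\<D> N) = S" using A(2) by auto
  have sub: "\<D> N \<subseteq> \<T>" using step(2) by (auto simp: \<D>_def)
  have "\<T> \<subseteq> \<D> N"
  proof
    fix T assume T: "T \<in> \<T>"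
    then have "T \<noteq> {}" "T \<subseteq> S" using partition_onD1[OF part] partition_onD3[OF part] by auto
    then obtain x where x: "x \<in> T" "x \<in> \<Union>(\<D> N)" using un by blast
    then obtain T' where T': "T' \<in> \<D> N" "x \<in> T'" by blast
    have "T' \<in> \<T>" using T' sub by blast
    then have "T = T'" using disjointD[OF partition_onD2[OF part] T] x(1) T'(2) by blast
    then show "T \<in> \<D> N" using T' by simp
  qed
  then have "\<D> N = \<T>" using sub by blast
  then show ?thesis using that \<T> sh by blast
qed

lemma shelled_imp_morse_shellable:
  assumes \<T>: "morse_tiling K S \<T>" and sh: "shelled K S \<T>"
  shows "morse_shellable K S"
proof -
  have K: "simplicial_complex K" using \<T> unfolding morse_tiling_def by blast
  have "\<U> \<subseteq> \<T> \<Longrightarrow> \<exists>(N::nat) A. A 0 = {} \<and> A N = \<Union>\<U> \<and> (\<forall>i\<le>N. morse_tiled_subset K S \<T> (A i)) \<and>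
      (\<forall>i\<in>{1..N}. A (i - 1) \<subset> A i \<and> A i - A (i - 1) \<in> \<T>)" if "shelled K S \<U>" for \<U>
    using that
  proof (induction rule: shelled.induct)
    case empty
    have "morse_tiled_subset K S \<T> {}"
      unfolding morse_tiled_subset_eq using relatively_closed_empty[OF K] by blast
    then show ?case by (intro exI[of _ 0] exI[of _ "\<lambda>_. {}"]) auto
  next
    case (insert \<U> T)
    then have sub: "\<U> \<subseteq> \<T>" by simp
    obtain N :: nat and A where A: "A 0 = {}" "A N = \<Union>\<U>"
      "\<forall>i\<le>N. morse_tiled_subset K S \<T> (A i)"
      "\<forall>i\<in>{1..N}. A (i - 1) \<subset> A i \<and> A i - A (i - 1) \<in> \<T>"
      using insert.IH[OF sub] by (elim exE conjE) (rule that; assumption)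
    let ?A = "A(Suc N := \<Union>\<U> \<union> T)"
    have un: "\<Union>\<U> \<union> T = \<Union>(insert T \<U>)" by blast
    have "morse_tiled_subset K S \<T> (\<Union>\<U> \<union> T)"
      unfolding morse_tiled_subset_eq using insert.hyps(4) insert.prems un by blast
    then have "morse_tiled_subset K S \<T> (?A i)" if "i \<le> Suc N" for i
      using A(3) that by auto
    moreover have "?A (i - 1) \<subset> ?A i \<and> ?A i - ?A (i - 1) \<in> \<T>" if i: "i \<in> {1..Suc N}" for i
    proof (cases "i = Suc N")
      case True
      have psub: "\<Union>\<U> \<subset> \<Union>\<U> \<union> T" using insert.hyps(2,3) by blast
      have "\<Union>\<U> \<union> T - \<Union>\<U> = T" using insert.hyps(3) by blast
      then have "?A i - ?A (i - 1) = T" using True A(2) by simp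
      moreover have "?A (i - 1) \<subset> ?A i" using True A(2) psub by simp
      ultimately show ?thesis using insert.prems by simp
    next
      case False
      then show ?thesis using A(4)[rule_format, of i] i by auto
    qed
    ultimately show ?case
      using A(1) un by (intro exI[of _ "Suc N"] exI[of _ ?A]) auto
  qed
  then have "\<exists>(N::nat) A. A 0 = {} \<and> A N = \<Union>\<T> \<and> (\<forall>i\<le>N. morse_tiled_subset K S \<T> (A i)) \<and>
      (\<forall>i\<in>{1..N}. A (i - 1) \<subset> A i \<and> A i - A (i - 1) \<in> \<T>)" using sh by simp
  moreover have "\<Union>\<T> = S"
    using \<T> partition_onD1 unfolding morse_tiling_def by metis
  ultimately show ?thesis unfolding morse_shellable_def using \<T> by metis
qed

section \<open>Refining a tiling\<close>

definition fibers :: "('a \<Rightarrow> 'b) \<Rightarrow> 'a set \<Rightarrow> 'a set set" where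
  "fibers f P = (\<lambda>y. {x \<in> P. f x = f y}) ` P"

lemma Union_fibers: "\<Union>(fibers f P) = P"
  by (auto simp: fibers_def)

lemma fibers_subset: "X \<in> fibers f P \<Longrightarrow> X \<subseteq> P"
  by (auto simp: fibers_def)

lemma fibers_nonempty: "X \<in> fibers f P \<Longrightarrow> X \<noteq> {}"
  by (auto simp: fibers_def)

lemma fibers_disjoint: "X \<in> fibers f P \<Longrightarrow> X' \<in> fibers f P \<Longrightarrow> X \<inter> X' \<noteq> {} \<Longrightarrow> X = X'"
  by (auto simp: fibers_def)

text \<open>The fibers of \<open>f\<close> can be added in any order that extends the order of their labels: each is
  contained in a simplex \<open>Q\<close> that meets, within \<open>P\<close>, only this fiber and fibers with
  smaller labels.\<close>

definition layered :: "'a::euclidean_space set set \<Rightarrow> 'a set \<Rightarrow> ('a \<Rightarrow> 'b::order) \<Rightarrow> bool" where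
  "layered K P f \<longleftrightarrow> finite (f ` P) \<and>
     (\<forall>y\<in>P. \<exists>Q\<in>K. {x \<in> P. f x = f y} \<subseteq> Q \<and> (\<forall>x\<in>P \<inter> Q. f x \<le> f y))"

text \<open>The union of the fibers over a lower set is also the union of the simplices \<open>Q\<close> that belong
  to these fibers, intersected with \<open>P\<close>.\<close>

lemma layered_lower_set_closed:
  assumes K: "simplicial_complex K" and lay: "layered K P f"
    and A: "A \<subseteq> f ` P" "\<And>a b. a \<in> A \<Longrightarrow> b \<in> f ` P \<Longrightarrow> b \<le> a \<Longrightarrow> b \<in> A"
  shows "relatively_closed K P {x \<in> P. f x \<in> A}"
proof -
  have fin: "finite A" using lay A(1) unfolding layered_def by (meson finite_subset)
  have "\<forall>a\<in>A. \<exists>Q. Q \<in> K \<and> {x \<in> P. f x = a} \<subseteq> Q \<and> (\<forall>x\<in>P \<inter> Q. f x \<le> a)"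
  proof
    fix a assume "a \<in> A"
    then obtain y where "y \<in> P" "a = f y" using A(1) by blast
    then show "\<exists>Q. Q \<in> K \<and> {x \<in> P. f x = a} \<subseteq> Q \<and> (\<forall>x\<in>P \<inter> Q. f x \<le> a)"
      using lay unfolding layered_def by blast
  qed
  from bchoice[OF this] obtain Q where
    "\<forall>a\<in>A. Q a \<in> K \<and> {x \<in> P. f x = a} \<subseteq> Q a \<and> (\<forall>x\<in>P \<inter> Q a. f x \<le> a)" by (rule exE)
  then have Q: "\<And>a. a \<in> A \<Longrightarrow> Q a \<in> K" "\<And>a. a \<in> A \<Longrightarrow> {x \<in> P. f x = a} \<subseteq> Q a"
      "\<And>a x. a \<in> A \<Longrightarrow> x \<in> P \<Longrightarrow> x \<in> Q a \<Longrightarrow> f x \<le> a"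
    by simp_all
  have "{x \<in> P. f x \<in> A} = (\<Union>a\<in>A. P \<inter> Q a)"
  proof (intro equalityI subsetI)
    fix x assume "x \<in> {x \<in> P. f x \<in> A}"
    then show "x \<in> (\<Union>a\<in>A. P \<inter> Q a)" using Q(2)[of "f x"] by auto
  next
    fix x assume "x \<in> (\<Union>a\<in>A. P \<inter> Q a)"
    then obtain a where a: "a \<in> A" "x \<in> P" "x \<in> Q a" by blast
    then have "f x \<in> A" using A(2)[OF a(1) imageI[OF a(2)] Q(3)[OF a]] by simp
    then show "x \<in> {x \<in> P. f x \<in> A}" using a by simp
  qed
  moreover have "relatively_closed K P (\<Union>a\<in>A. P \<inter> Q a)"
    using Q(1) by (intro relatively_closed_finite_Union[OF K fin] relatively_closed_simplex[OF K])
  ultimately show ?thesis by simp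
qed

text \<open>Fibers are added one at a time in an order extending that of their labels. If \<open>U\<close> and \<open>U \<union> P\<close> are
  relatively closed in \<open>S\<close> and \<open>P \<inter> \<Union>M\<close> is a relatively closed part of \<open>P\<close>, then the set
  \<open>U \<union> (P \<inter> \<Union>M) = U \<union> ((U \<union> P) \<inter> \<Union>M)\<close> is relatively closed in \<open>S\<close>.\<close>

lemma shelled_add_layers:
  assumes K: "simplicial_complex K" and sh: "shelled K S \<U>" and disj: "P \<inter> \<Union>\<U> = {}"
    and cl: "relatively_closed K S (\<Union>\<U> \<union> P)" and lay: "layered K P f"
  shows "shelled K S (\<U> \<union> fibers f P)"
proof -
  define \<F> where "\<F> a = {x \<in> P. f x = a}" for a
  have U: "relatively_closed K S (\<Union>\<U>)" by (rule shelled_relatively_closed[OF K sh])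
  have main: "A \<subseteq> f ` P \<Longrightarrow> (\<forall>a\<in>A. \<forall>b\<in>f ` P. b \<le> a \<longrightarrow> b \<in> A) \<Longrightarrow> shelled K S (\<U> \<union> \<F> ` A)" for A
  proof (induction "card A" arbitrary: A)
    case 0
    have "finite A" using lay 0(2) unfolding layered_def by (meson finite_subset)
    then have "A = {}" using 0(1) by simp
    then show ?case using sh by simp
  next
    case (Suc n)
    have fin: "finite A" using lay Suc.prems(1) unfolding layered_def by (meson finite_subset)
    have "A \<noteq> {}" using Suc.hyps(2) by auto
    from finite_has_maximal[OF fin this]
    obtain b where b: "b \<in> A" and max: "\<forall>a\<in>A. b \<le> a \<longrightarrow> b = a" by (rule bexE)
    let ?A = "A - {b}"
    have cA: "card ?A = n" using Suc.hyps(2) b fin by simp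
    have "\<forall>a\<in>?A. \<forall>c\<in>f ` P. c \<le> a \<longrightarrow> c \<in> ?A"
    proof (intro ballI impI)
      fix a c assume ac: "a \<in> ?A" "c \<in> f ` P" "c \<le> a"
      then have "c \<in> A" using Suc.prems(2) by auto
      moreover have "c \<noteq> b" using ac max by auto
      ultimately show "c \<in> ?A" by simp
    qed
    moreover have "?A \<subseteq> f ` P" using Suc.prems(1) by blast
    ultimately have IH: "shelled K S (\<U> \<union> \<F> ` ?A)" using Suc.hyps(1)[of ?A] cA by simp
    have "relatively_closed K P {x \<in> P. f x \<in> A}"
      by (rule layered_lower_set_closed[OF K lay Suc.prems(1)]) (use Suc.prems(2) in blast)
    then obtain M where M: "subcomplex M K" "{x \<in> P. f x \<in> A} = P \<inter> \<Union>M"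
      unfolding relatively_closed_def by blast
    have "relatively_closed K S (S \<inter> \<Union>M)" using M(1) unfolding relatively_closed_def by blast
    then have "relatively_closed K S (\<Union>\<U> \<union> ((\<Union>\<U> \<union> P) \<inter> (S \<inter> \<Union>M)))"
      by (rule relatively_closed_Un[OF K U relatively_closed_Int[OF K cl]])
    moreover have "\<Union>\<U> \<union> P \<subseteq> S" using cl unfolding relatively_closed_def by blast
    then have "\<Union>\<U> \<union> ((\<Union>\<U> \<union> P) \<inter> (S \<inter> \<Union>M)) = \<Union>\<U> \<union> {x \<in> P. f x \<in> A}" using M(2) by blast
    moreover have "\<Union>\<U> \<union> {x \<in> P. f x \<in> A} = \<Union>(\<U> \<union> \<F> ` ?A) \<union> \<F> b"
      using b by (auto simp: \<F>_def)
    ultimately have c: "relatively_closed K S (\<Union>(\<U> \<union> \<F> ` ?A) \<union> \<F> b)" by simp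
    have ne: "\<F> b \<noteq> {}" using b Suc.prems(1) by (auto simp: \<F>_def)
    have dis: "\<F> b \<inter> \<Union>(\<U> \<union> \<F> ` ?A) = {}" using disj by (auto simp: \<F>_def)
    have "shelled K S (insert (\<F> b) (\<U> \<union> \<F> ` ?A))" by (rule shelled.insert[OF IH ne dis c])
    moreover have "insert (\<F> b) (\<U> \<union> \<F> ` ?A) = \<U> \<union> \<F> ` A" using b by blast
    ultimately show ?case by simp
  qed
  have "\<F> ` f ` P = fibers f P" by (auto simp: \<F>_def fibers_def)
  then show ?thesis using main[of "f ` P"] by simp
qed

text \<open>The assumption on subcomplexes says that closed subsets for \<open>K\<close> restrict to closed
  subsets for \<open>K'\<close>. It holds for a subdivision \<open>K'\<close> of \<open>K\<close> with \<open>S' = S\<close>, and for \<open>K' = K\<close> with a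
  smaller set \<open>S'\<close>.\<close>

lemma shelled_refine:
  assumes K': "simplicial_complex K'" and "S' \<subseteq> S"
    and sub: "\<And>L. subcomplex L K \<Longrightarrow> \<exists>L'. subcomplex L' K' \<and> S' \<inter> \<Union>L' = S' \<inter> \<Union>L"
    and sh: "shelled K S \<U>" and lay: "\<And>T. T \<in> \<U> \<Longrightarrow> layered K' (T \<inter> S') (f T)"
  shows "shelled K' S' (\<Union>T\<in>\<U>. fibers (f T) (T \<inter> S'))"
  using sh lay
proof (induction rule: shelled.induct)
  case empty
  then show ?case by (simp add: shelled.empty)
next
  case (insert \<U> T)
  let ?\<V> = "\<Union>T\<in>\<U>. fibers (f T) (T \<inter> S')"
  have IH: "shelled K' S' ?\<V>" using insert.IH insert.prems by blast
  have un: "\<Union>?\<V> = \<Union>\<U> \<inter> S'"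
  proof -
    have "\<Union>?\<V> = (\<Union>T\<in>\<U>. \<Union>(fibers (f T) (T \<inter> S')))" by blast
    then show ?thesis by (simp add: Union_fibers)
  qed
  obtain L where L: "subcomplex L K" "\<Union>\<U> \<union> T = S \<inter> \<Union>L"
    using insert.hyps(4) unfolding relatively_closed_def by blast
  obtain L' where L': "subcomplex L' K'" "S' \<inter> \<Union>L' = S' \<inter> \<Union>L" using sub[OF L(1)] by blast
  have "\<Union>?\<V> \<union> T \<inter> S' = (\<Union>\<U> \<union> T) \<inter> S'" unfolding un by blast
  also have "\<dots> = S' \<inter> \<Union>L'" using L(2) L'(2) \<open>S' \<subseteq> S\<close> by auto
  finally have "relatively_closed K' S' (\<Union>?\<V> \<union> T \<inter> S')"
    using L'(1) unfolding relatively_closed_def by blast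
  moreover have "T \<inter> S' \<inter> \<Union>?\<V> = {}" unfolding un using insert.hyps(3) by blast
  ultimately have "shelled K' S' (?\<V> \<union> fibers (f T) (T \<inter> S'))"
    using insert.prems by (intro shelled_add_layers[OF K' IH]) auto
  then show ?case by (simp add: Un_commute)
qed

text \<open>The condition on dimensions is the one for which the pieces of dimension larger than
  \<open>j\<close> are either the pieces of the tiles of dimension larger than \<open>j\<close>, or do not exist.\<close>

lemma morse_tiling_refine:
  assumes K': "simplicial_complex K'" and "S' \<subseteq> S" "S' \<subseteq> \<Union>K'"
    and sub: "\<And>L. subcomplex L K \<Longrightarrow> \<exists>L'. subcomplex L' K' \<and> S' \<inter> \<Union>L' = S' \<inter> \<Union>L"
    and \<T>: "morse_tiling K S \<T>"
    and tile: "\<And>T X. T \<in> \<T> \<Longrightarrow> X \<in> fibers (f T) (T \<inter> S') \<Longrightarrow> \<exists>n. morse_tile K' n X"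
    and dims: "\<And>j. (\<forall>T\<in>\<T>. \<forall>X\<in>fibers (f T) (T \<inter> S').
        (\<exists>n>j. morse_tile K' n X) \<longleftrightarrow> (\<exists>n>j. morse_tile K n T)) \<or>
      (\<forall>T\<in>\<T>. \<forall>X\<in>fibers (f T) (T \<inter> S'). \<not> (\<exists>n>j. morse_tile K' n X))"
  shows "morse_tiling K' S' (\<Union>T\<in>\<T>. fibers (f T) (T \<inter> S'))"
proof -
  let ?\<V> = "\<Union>T\<in>\<T>. fibers (f T) (T \<inter> S')"
  have part: "partition_on S \<T>" using \<T> unfolding morse_tiling_def by blast
  have "partition_on S' ?\<V>"
  proof (rule partition_onI)
    have "\<Union>?\<V> = (\<Union>T\<in>\<T>. \<Union>(fibers (f T) (T \<inter> S')))" by blast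
    also have "\<dots> = \<Union>\<T> \<inter> S'" by (simp add: Union_fibers)
    finally show "\<Union>?\<V> = S'" using partition_onD1[OF part] \<open>S' \<subseteq> S\<close> by blast
    show "{} \<notin> ?\<V>" using fibers_nonempty by blast
    show "disjnt X X'" if X: "X \<in> ?\<V>" "X' \<in> ?\<V>" "X \<noteq> X'" for X X'
    proof (rule ccontr)
      assume "\<not> disjnt X X'"
      then have ne: "X \<inter> X' \<noteq> {}" by (simp add: disjnt_def)
      obtain T T' where T: "T \<in> \<T>" "X \<in> fibers (f T) (T \<inter> S')" "T' \<in> \<T>" "X' \<in> fibers (f T') (T' \<inter> S')"
        using X(1,2) by blast
      have "T \<inter> T' \<noteq> {}" using ne fibers_subset[OF T(2)] fibers_subset[OF T(4)] by blast
      then have "T = T'" using disjointD[OF partition_onD2[OF part] T(1,3)] by blast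
      then show False using fibers_disjoint[OF T(2) _ ne] T(4) X(3) by simp
    qed
  qed
  moreover have "\<exists>L'. subcomplex L' K' \<and> \<Union>{X \<in> ?\<V>. \<exists>n>j. morse_tile K' n X} = S' \<inter> \<Union>L'" for j
    using dims[of j]
  proof
    assume eq: "\<forall>T\<in>\<T>. \<forall>X\<in>fibers (f T) (T \<inter> S').
        (\<exists>n>j. morse_tile K' n X) \<longleftrightarrow> (\<exists>n>j. morse_tile K n T)"
    obtain L where L: "subcomplex L K" "\<Union>{T \<in> \<T>. \<exists>n>j. morse_tile K n T} = S \<inter> \<Union>L"
      using \<T> unfolding morse_tiling_def by blast
    obtain L' where L': "subcomplex L' K'" "S' \<inter> \<Union>L' = S' \<inter> \<Union>L" using sub[OF L(1)] by blast
    have "{X \<in> ?\<V>. \<exists>n>j. morse_tile K' n X} =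
        (\<Union>T\<in>{T \<in> \<T>. \<exists>n>j. morse_tile K n T}. fibers (f T) (T \<inter> S'))"
      using eq by blast
    then have "\<Union>{X \<in> ?\<V>. \<exists>n>j. morse_tile K' n X} =
        (\<Union>T\<in>{T \<in> \<T>. \<exists>n>j. morse_tile K n T}. \<Union>(fibers (f T) (T \<inter> S')))"
      by (simp only:) blast
    also have "\<dots> = \<Union>{T \<in> \<T>. \<exists>n>j. morse_tile K n T} \<inter> S'" by (simp add: Union_fibers)
    also have "\<dots> = S' \<inter> \<Union>L'" using L(2) L'(2) \<open>S' \<subseteq> S\<close> by auto
    finally show ?thesis using L'(1) by blast
  next
    assume "\<forall>T\<in>\<T>. \<forall>X\<in>fibers (f T) (T \<inter> S'). \<not> (\<exists>n>j. morse_tile K' n X)"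
    then have "{X \<in> ?\<V>. \<exists>n>j. morse_tile K' n X} = {}" by blast
    then have "\<Union>{X \<in> ?\<V>. \<exists>n>j. morse_tile K' n X} = {}" by (simp only: Union_empty)
    then show ?thesis
      using relatively_closed_empty[OF K', of S'] unfolding relatively_closed_def by (simp only:)
  qed
  ultimately show ?thesis
    unfolding morse_tiling_def using K' \<open>S' \<subseteq> \<Union>K'\<close> tile by blast
qed

section \<open>Skeleta\<close>

lemma simplex_subset_if_meets_rel_interior:
  assumes K: "simplicial_complex K" and "\<Delta> \<in> K" "\<sigma> \<in> K" "x \<in> rel_interior \<Delta>" "x \<in> \<sigma>"
  shows "\<Delta> \<subseteq> \<sigma>"
proof -
  have f: "\<Delta> \<inter> \<sigma> face_of \<Delta>" using K assms(2,3) unfolding simplicial_complex_def by blast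
  have "x \<in> (\<Delta> \<inter> \<sigma>) \<inter> rel_interior \<Delta>" using assms(4,5) rel_interior_subset by blast
  then have "\<Delta> \<subseteq> \<Delta> \<inter> \<sigma>" using subset_of_face_of[OF f order_refl] by blast
  then show ?thesis by blast
qed

lemma supp_face:
  fixes V :: "'a::euclidean_space set"
  assumes indep: "\<not> affine_dependent V" and B: "B \<subseteq> V" and x: "x \<in> convex hull B"
  shows "supp B x = supp V x"
proof
  have indB: "\<not> affine_dependent B" by (rule affine_independent_subset[OF indep B])
  have xV: "x \<in> convex hull V" using x hull_mono[OF B] by blast
  have sB: "supp V x \<subseteq> B" using in_hull_subset_iff[OF indep B xV] x by simp
  have "x \<in> convex hull (supp V x)"
    using in_hull_subset_iff[OF indep _ xV, of "supp V x"] supp_subset by blast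
  then show "supp B x \<subseteq> supp V x" using in_hull_subset_iff[OF indB sB x] by simp
  have "x \<in> convex hull (supp B x)" using in_hull_subset_iff[OF indB _ x, of "supp B x"] supp_subset by blast
  moreover have "supp B x \<subseteq> V" using supp_subset B by blast
  ultimately show "supp V x \<subseteq> supp B x" using in_hull_subset_iff[OF indep _ xV] by blast
qed

text \<open>If \<open>R \<subseteq> t\<close>, only the part of \<open>t\<close> inside \<open>B\<close> matters. Otherwise every support that contains \<open>R\<close>
  contains some \<open>a \<notin> t\<close>, and the condition on \<open>t\<close> can be traded for \<open>a\<close>.\<close>

lemma face_part_is_tile:
  fixes B :: "'a::euclidean_space set"
  assumes K: "convex hull B \<in> K" and indB: "\<not> affine_dependent B" and RB: "R \<subseteq> B"
    and y: "y \<in> convex hull B" "\<not> supp B y \<subseteq> t"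
  shows "morse_tile K (card B - 1) {x \<in> convex hull B. R \<subseteq> supp B x \<and> \<not> supp B x \<subseteq> t}"
proof -
  have tile: "morse_tile K (card B - 1) (interval_tile B R' t')" if "R' \<subseteq> t'" "t' \<subset> B" for R' t'
    unfolding morse_tile_def using interval_tile_is_tile[OF indB that] K by blast
  have s: "supp B x \<subseteq> B" for x by (rule supp_subset)
  show ?thesis
  proof (cases "R \<subseteq> t")
    case True
    have "supp B x \<subseteq> t \<longleftrightarrow> supp B x \<subseteq> t \<inter> B" for x using s by blast
    then have "{x \<in> convex hull B. R \<subseteq> supp B x \<and> \<not> supp B x \<subseteq> t} = interval_tile B R (t \<inter> B)"
      unfolding interval_tile_def by simp
    moreover have "t \<inter> B \<subset> B" using y(2) s[of y] by blast
    ultimately show ?thesis using tile[of R "t \<inter> B"] True RB by simp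
  next
    case False
    then obtain a where a: "a \<in> R" "a \<notin> t" by blast
    have "R \<subseteq> supp B x \<and> \<not> supp B x \<subseteq> t \<longleftrightarrow> R - {a} \<subseteq> supp B x \<and> \<not> supp B x \<subseteq> B - {a}" for x
      using s[of x] a by blast
    then have "{x \<in> convex hull B. R \<subseteq> supp B x \<and> \<not> supp B x \<subseteq> t} = interval_tile B (R - {a}) (B - {a})"
      unfolding interval_tile_def by simp
    moreover have "R - {a} \<subseteq> B - {a}" "B - {a} \<subset> B" using a RB by blast+
    ultimately show ?thesis using tile by simp
  qed
qed

text \<open>When \<open>n = i + 1\<close>, the points of the tile in the \<open>i\<close>-skeleton are those whose support misses some
  vertex. Label such a point by the smallest missing vertex \<open>v\<close>. Its piece consists of the points in the
  facet opposite to \<open>v\<close> whose support contains \<open>R\<close> and all vertices smaller than \<open>v\<close> and is not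
  contained in \<open>t\<close>. The other points of the tile in that facet miss \<open>v\<close> too, so they have a smaller label.\<close>

lemma tile_skeleton:
  fixes T :: "'a::euclidean_space set"
  assumes K: "simplicial_complex K" and T: "morse_tile K n T" and sub: "T \<subseteq> \<Union>(skeleton (Suc i) K)"
  obtains f :: "'a \<Rightarrow> nat" where "layered K (T \<inter> \<Union>(skeleton i K)) f"
    "\<And>X. X \<in> fibers f (T \<inter> \<Union>(skeleton i K)) \<Longrightarrow> morse_tile K (min n i) X" "n \<le> Suc i"
proof -
  obtain \<Delta> l k where \<Delta>: "\<Delta> \<in> K" "tile_of_simplex \<Delta> n l k T" using T unfolding morse_tile_def by blast
  obtain V R t where V: "\<not> affine_dependent V" "\<Delta> = convex hull V" "card V = Suc n"
    "R \<subseteq> t" "t \<subset> V" "T = interval_tile V R t"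
    using tile_of_simplex_imp_interval_tile[OF \<Delta>(2)] by metis
  have fin: "finite V" by (rule aff_independent_finite[OF V(1)])
  have dim: "aff_dim \<Delta> = int n"
    using aff_dim_affine_independent[OF V(1)] V(2,3) by (simp add: aff_dim_convex_hull)
  have T\<Delta>: "T \<subseteq> \<Delta>" using V(2,6) by (auto simp: interval_tile_def)
  have low: "int n \<le> int m" if "x \<in> rel_interior \<Delta>" "x \<in> \<Union>(skeleton m K)" for x m
  proof -
    obtain \<sigma> where \<sigma>: "\<sigma> \<in> K" "aff_dim \<sigma> \<le> int m" "x \<in> \<sigma>"
      using \<open>x \<in> \<Union>(skeleton m K)\<close> by (auto simp: skeleton_def)
    have "\<Delta> \<subseteq> \<sigma>" by (rule simplex_subset_if_meets_rel_interior[OF K \<Delta>(1) \<sigma>(1) that(1) \<sigma>(3)])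
    then show ?thesis using aff_dim_subset[of \<Delta> \<sigma>] dim \<sigma>(2) by linarith
  qed
  have Vne: "V \<noteq> {}" using V(5) by blast
  have "centroid V \<in> T" using interval_tile_iff_centroid[OF V(1) subset_refl Vne] V by auto
  then have "centroid V \<in> \<Union>(skeleton (Suc i) K)" using sub by blast
  moreover have "centroid V \<in> rel_interior \<Delta>"
    using rel_interior_iff_supp[OF V(1)] supp_centroid[OF V(1) subset_refl Vne]
      centroid_in_hull[OF fin Vne] V(2) by simp
  ultimately have ni: "n \<le> Suc i" using low[of "centroid V" "Suc i"] by linarith
  let ?P = "T \<inter> \<Union>(skeleton i K)"
  show ?thesis
  proof (cases "n \<le> i")
    case True
    then have "\<Delta> \<in> skeleton i K" using \<Delta>(1) dim by (simp add: skeleton_def)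
    then have P: "?P = T" using T\<Delta> by blast
    have "(\<lambda>_. 0::nat) ` T \<subseteq> {0}" by auto
    then have "finite ((\<lambda>_. 0::nat) ` T)" by (rule finite_subset) simp
    then have lay: "layered K ?P (\<lambda>_. 0::nat)"
      unfolding layered_def P using \<Delta>(1) T\<Delta> by (auto intro!: bexI[of _ \<Delta>])
    have "morse_tile K (min n i) X" if "X \<in> fibers (\<lambda>_. 0::nat) ?P" for X
      using that T True unfolding P fibers_def by auto
    then show ?thesis by (rule that[OF lay _ ni])
  next
    case False
    then have n: "n = Suc i" using ni by simp
    have P: "x \<in> ?P \<longleftrightarrow> x \<in> T \<and> supp V x \<noteq> V" for x
    proof
      assume x: "x \<in> ?P"
      then have "x \<in> convex hull V" using T\<Delta> V(2) by blast
      then show "x \<in> T \<and> supp V x \<noteq> V"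
        using x low[of x i] n rel_interior_iff_supp[OF V(1)] V(2) by auto
    next
      assume x: "x \<in> T \<and> supp V x \<noteq> V"
      then have xV: "x \<in> convex hull V" using T\<Delta> V(2) by blast
      obtain v where v: "v \<in> V" "v \<notin> supp V x" using x supp_subset[of V x] by blast
      have "convex hull (V - {v}) \<in> K"
        using K \<Delta>(1) hull_subset_face[OF V(1), of "V - {v}"] V(2) unfolding simplicial_complex_def by blast
      moreover have "\<not> affine_dependent (V - {v})" by (rule affine_independent_subset[OF V(1)]) blast
      then have "aff_dim (convex hull (V - {v})) \<le> int i"
        using aff_dim_affine_independent[of "V - {v}"] V(3) v(1) fin n by (simp add: aff_dim_convex_hull)
      moreover have "x \<in> convex hull (V - {v})"
        using in_hull_subset_iff[OF V(1) _ xV, of "V - {v}"] v supp_subset[of V x] by blast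
      ultimately show "x \<in> ?P" using x by (auto simp: skeleton_def)
    qed
    obtain \<rho> :: "'a \<Rightarrow> nat" where \<rho>: "inj_on \<rho> V" using finite_imp_inj_to_nat_seg[OF fin] by blast
    define f where "f x = Min (\<rho> ` (V - supp V x))" for x
    have fmin: "\<exists>v\<in>V - supp V x. f x = \<rho> v \<and> (\<forall>u\<in>V - supp V x. \<rho> v \<le> \<rho> u)" if x: "x \<in> ?P" for x
    proof -
      have ne: "\<rho> ` (V - supp V x) \<noteq> {}" using x P supp_subset[of V x] by blast
      have fi: "finite (\<rho> ` (V - supp V x))" using fin by simp
      have "f x \<in> \<rho> ` (V - supp V x)" unfolding f_def by (rule Min_in[OF fi ne])
      moreover have "f x \<le> \<rho> u" if "u \<in> V - supp V x" for u
        unfolding f_def using fi that by (intro Min_le) auto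
      ultimately show ?thesis by auto
    qed
    have main: "\<exists>Q\<in>K. {x \<in> ?P. f x = f y} \<subseteq> Q \<and> (\<forall>x\<in>?P \<inter> Q. f x \<le> f y)"
        "morse_tile K i {x \<in> ?P. f x = f y}" if y: "y \<in> ?P" for y
    proof -
      obtain v where v: "v \<in> V - supp V y" "f y = \<rho> v" "\<forall>u\<in>V - supp V y. \<rho> v \<le> \<rho> u"
        using fmin[OF y] by blast
      define B where "B = V - {v}"
      have BV: "B \<subseteq> V" by (auto simp: B_def)
      have indB: "\<not> affine_dependent B" by (rule affine_independent_subset[OF V(1) BV])
      have BK: "convex hull B \<in> K"
        using K \<Delta>(1) hull_subset_face[OF V(1) BV] V(2) unfolding simplicial_complex_def by blast
      have hullB: "x \<in> convex hull B \<longleftrightarrow> v \<notin> supp V x" if "x \<in> convex hull V" for x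
        using in_hull_subset_iff[OF V(1) BV that] supp_subset[of V x] by (auto simp: B_def)
      have PV: "x \<in> convex hull V" if "x \<in> T" for x using that T\<Delta> V(2) by blast
      have fle: "f x \<le> \<rho> v" if x: "x \<in> ?P" "v \<notin> supp V x" for x
      proof -
        obtain u where "f x = \<rho> u" "\<forall>w\<in>V - supp V x. \<rho> u \<le> \<rho> w" using fmin[OF x(1)] by blast
        then show ?thesis using v(1) x(2) by simp
      qed
      \<comment> \<open>The vertices that have to be in the support for \<open>v\<close> to be the smallest missing one.\<close>
      define R' where "R' = R \<union> {u \<in> V. \<rho> u < \<rho> v}"
      have yT: "y \<in> T" "R \<subseteq> supp V y" "\<not> supp V y \<subseteq> t" using y P V(6) by (auto simp: interval_tile_def)
      have R'B: "R' \<subseteq> B" using yT(2) v(1) V(4,5) by (auto simp: R'_def B_def)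
      have yB: "y \<in> convex hull B" using hullB[OF PV[OF yT(1)]] v(1) by blast
      have sB: "supp B x = supp V x" if "x \<in> convex hull B" for x by (rule supp_face[OF V(1) BV that])
      have "x \<in> ?P \<and> f x = f y \<longleftrightarrow> x \<in> convex hull B \<and> R' \<subseteq> supp B x \<and> \<not> supp B x \<subseteq> t" for x
      proof
        assume x: "x \<in> ?P \<and> f x = f y"
        obtain u where u: "u \<in> V - supp V x" "f x = \<rho> u" "\<forall>w\<in>V - supp V x. \<rho> u \<le> \<rho> w"
          using fmin[of x] x by blast
        have "u = v" using u(1,2) v(1,2) x inj_onD[OF \<rho>, of u v] by simp
        then have xB: "x \<in> convex hull B" using hullB[OF PV] x u(1) by blast
        have "w \<in> supp V x" if "w \<in> V" "\<rho> w < \<rho> v" for w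
          using u(3) that \<open>u = v\<close> by (meson DiffI not_less)
        then show "x \<in> convex hull B \<and> R' \<subseteq> supp B x \<and> \<not> supp B x \<subseteq> t"
          using x xB sB[OF xB] V(6) by (auto simp: R'_def interval_tile_def)
      next
        assume x: "x \<in> convex hull B \<and> R' \<subseteq> supp B x \<and> \<not> supp B x \<subseteq> t"
        then have s: "supp B x = supp V x" using sB by blast
        have xV: "x \<in> convex hull V" using x hull_mono[OF BV] by blast
        have vx: "v \<notin> supp V x" using hullB[OF xV] x by blast
        have "x \<in> T" using xV x s V(6) by (auto simp: R'_def interval_tile_def)
        then have xP: "x \<in> ?P" using P vx v(1) by blast
        obtain u where u: "u \<in> V - supp V x" "f x = \<rho> u" using fmin[OF xP] by blast
        have "\<not> \<rho> u < \<rho> v" using u(1) x s by (auto simp: R'_def)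
        then show "x \<in> ?P \<and> f x = f y" using xP fle[OF xP vx] u(2) v(2) by simp
      qed
      then have eq: "{x \<in> ?P. f x = f y} = {x \<in> convex hull B. R' \<subseteq> supp B x \<and> \<not> supp B x \<subseteq> t}"
        by blast
      have "card B - 1 = i" using V(3) v(1) fin n by (simp add: B_def)
      moreover have "\<not> supp B y \<subseteq> t" using yT(3) sB[OF yB] by simp
      ultimately show "morse_tile K i {x \<in> ?P. f x = f y}"
        unfolding eq using face_part_is_tile[OF BK indB R'B yB] by blast
      have "f x \<le> f y" if "x \<in> ?P \<inter> convex hull B" for x
        using fle[of x] hullB[OF PV] that v(2) by auto
      moreover have "{x \<in> ?P. f x = f y} \<subseteq> convex hull B" unfolding eq by blast
      ultimately show "\<exists>Q\<in>K. {x \<in> ?P. f x = f y} \<subseteq> Q \<and> (\<forall>x\<in>?P \<inter> Q. f x \<le> f y)"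
        using BK by blast
    qed
    have "f ` ?P \<subseteq> \<rho> ` V" using fmin by blast
    then have "finite (f ` ?P)" using fin by (meson finite_imageI finite_subset)
    then have lay: "layered K ?P f" unfolding layered_def using main(1) by blast
    have "morse_tile K (min n i) X" if "X \<in> fibers f ?P" for X
      using main(2) that n unfolding fibers_def by auto
    then show ?thesis by (rule that[OF lay _ ni])
  qed
qed

lemma tile_dim_gt_iff:
  assumes "morse_tile K m X"
  shows "(\<exists>n>j. morse_tile K n X) \<longleftrightarrow> m > j"
  using assms morse_tile_aff_dim by (metis of_nat_eq_iff)

lemma tiles_in_tiling:
  assumes "morse_tiling K S \<T>" "T \<in> \<T>"
  shows "T \<subseteq> S" "\<exists>n. morse_tile K n T"
proof -
  have part: "partition_on S \<T>" using assms unfolding morse_tiling_def by blast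
  show "T \<subseteq> S" using partition_onD1[OF part] assms(2) by blast
  show "\<exists>n. morse_tile K n T" using assms unfolding morse_tiling_def by blast
qed

text \<open>Pieces have dimension \<open>min n i\<close> where \<open>n\<close> is the dimension of their tile. So for \<open>j < i\<close> a piece has
  dimension larger than \<open>j\<close> iff its tile has, and for \<open>j \<ge> i\<close> no piece has.\<close>

lemma skeleton_step:
  fixes K :: "'a::euclidean_space set set"
  assumes \<T>: "morse_tiling K S \<T>" and sub: "S \<subseteq> \<Union>(skeleton (Suc i) K)"
  obtains \<T>' where "morse_tiling K (S \<inter> \<Union>(skeleton i K)) \<T>'"
    "shelled K S \<T> \<Longrightarrow> shelled K (S \<inter> \<Union>(skeleton i K)) \<T>'"
proof -
  let ?S = "S \<inter> \<Union>(skeleton i K)"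
  have K: "simplicial_complex K" and SK: "S \<subseteq> \<Union>K" using \<T> unfolding morse_tiling_def by blast+
  note tl = tiles_in_tiling[OF \<T>]
  have P: "T \<inter> \<Union>(skeleton i K) = T \<inter> ?S" if "T \<in> \<T>" for T using tl(1)[OF that] by blast
  have "\<exists>n. morse_tile K n T \<and> n \<le> Suc i \<and> (\<exists>f::'a \<Rightarrow> nat. layered K (T \<inter> ?S) f \<and>
      (\<forall>X\<in>fibers f (T \<inter> ?S). morse_tile K (min n i) X))" if T: "T \<in> \<T>" for T
  proof -
    obtain n where n: "morse_tile K n T" using tl(2)[OF T] by blast
    have "T \<subseteq> \<Union>(skeleton (Suc i) K)" using tl(1)[OF T] sub by blast
    from tile_skeleton[OF K n this] obtain f :: "'a \<Rightarrow> nat" where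
      "layered K (T \<inter> \<Union>(skeleton i K)) f"
      "\<And>X. X \<in> fibers f (T \<inter> \<Union>(skeleton i K)) \<Longrightarrow> morse_tile K (min n i) X" "n \<le> Suc i" by metis
    then show ?thesis using n unfolding P[OF T] by blast
  qed
  then have "\<forall>T\<in>\<T>. \<exists>n. \<exists>f::'a \<Rightarrow> nat. morse_tile K n T \<and> n \<le> Suc i \<and> layered K (T \<inter> ?S) f \<and>
      (\<forall>X\<in>fibers f (T \<inter> ?S). morse_tile K (min n i) X)" by blast
  from bchoice[OF this] obtain n where "\<forall>T\<in>\<T>. \<exists>f::'a \<Rightarrow> nat. morse_tile K (n T) T \<and> n T \<le> Suc i \<and>
      layered K (T \<inter> ?S) f \<and> (\<forall>X\<in>fibers f (T \<inter> ?S). morse_tile K (min (n T) i) X)" by (rule exE)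
  from bchoice[OF this] obtain f :: "'a set \<Rightarrow> 'a \<Rightarrow> nat" where f: "\<forall>T\<in>\<T>. morse_tile K (n T) T \<and>
      n T \<le> Suc i \<and> layered K (T \<inter> ?S) (f T) \<and>
      (\<forall>X\<in>fibers (f T) (T \<inter> ?S). morse_tile K (min (n T) i) X)" by (rule exE)
  have dims: "(\<forall>T\<in>\<T>. \<forall>X\<in>fibers (f T) (T \<inter> ?S).
        (\<exists>n>j. morse_tile K n X) \<longleftrightarrow> (\<exists>n>j. morse_tile K n T)) \<or>
      (\<forall>T\<in>\<T>. \<forall>X\<in>fibers (f T) (T \<inter> ?S). \<not> (\<exists>n>j. morse_tile K n X))" for j
  proof -
    have 1: "(\<exists>m>j. morse_tile K m X) \<longleftrightarrow> min (n T) i > j" "(\<exists>m>j. morse_tile K m T) \<longleftrightarrow> n T > j"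
        "n T \<le> Suc i" if "T \<in> \<T>" "X \<in> fibers (f T) (T \<inter> ?S)" for T X
      using f that tile_dim_gt_iff by blast+
    show ?thesis
    proof (cases "j < i")
      case True
      have "min (n T) i > j \<longleftrightarrow> n T > j" for T using True by auto
      then show ?thesis using 1 by (intro disjI1 ballI) simp
    next
      case False
      have "\<not> min (n T) i > j" for T using False by auto
      then show ?thesis using 1 by (intro disjI2 ballI) simp
    qed
  qed
  have "morse_tiling K ?S (\<Union>T\<in>\<T>. fibers (f T) (T \<inter> ?S))"
    by (rule morse_tiling_refine[OF K _ _ _ \<T> _ dims]) (use SK f in blast)+
  moreover have "shelled K ?S (\<Union>T\<in>\<T>. fibers (f T) (T \<inter> ?S))" if "shelled K S \<T>"
    by (rule shelled_refine[OF K _ _ that]) (use f in blast)+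
  ultimately show ?thesis using that by blast
qed

lemma skeleton_large:
  fixes K :: "'a::euclidean_space set set"
  assumes "DIM('a) \<le> i"
  shows "skeleton i K = K"
proof -
  have "aff_dim \<sigma> \<le> int i" for \<sigma> :: "'a set"
    using aff_dim_le_DIM[of \<sigma>] assms by linarith
  then show ?thesis by (simp add: skeleton_def)
qed

lemma skeleton_mono: "i \<le> j \<Longrightarrow> \<Union>(skeleton i K) \<subseteq> \<Union>(skeleton j K)"
  by (force simp: skeleton_def)

text \<open>From a certain dimension on, the skeleton is the whole complex; the induction descends from
  there.\<close>

lemma skeleton_induct:
  fixes K :: "'a::euclidean_space set set"
  assumes "S \<subseteq> \<Union>K" and base: "P S"
    and step: "\<And>i. P (S \<inter> \<Union>(skeleton (Suc i) K)) \<Longrightarrow> P (S \<inter> \<Union>(skeleton i K))"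
  shows "P (S \<inter> \<Union>(skeleton i K))"
proof (cases "DIM('a) \<le> i")
  case True
  then show ?thesis using base assms(1) by (simp add: skeleton_large Int_absorb2)
next
  case False
  then have "i \<le> DIM('a)" by simp
  then show ?thesis
  proof (induction i rule: inc_induct)
    case base
    then show ?case using \<open>P S\<close> assms(1) by (simp add: skeleton_large Int_absorb2)
  next
    case (step i)
    then show ?case using assms(3) by blast
  qed
qed

lemma skeleton_tileable:
  assumes "morse_tileable K S"
  shows "morse_tileable K (S \<inter> \<Union>(skeleton i K))"
proof (rule skeleton_induct[where P = "morse_tileable K"])
  show "S \<subseteq> \<Union>K" using assms unfolding morse_tileable_def morse_tiling_def by blast
  show "morse_tileable K S" by (fact assms)
next
  fix i assume "morse_tileable K (S \<inter> \<Union>(skeleton (Suc i) K))"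
  then obtain \<T> where \<T>: "morse_tiling K (S \<inter> \<Union>(skeleton (Suc i) K)) \<T>"
    unfolding morse_tileable_def by blast
  have "S \<inter> \<Union>(skeleton (Suc i) K) \<inter> \<Union>(skeleton i K) = S \<inter> \<Union>(skeleton i K)"
    using skeleton_mono[of i "Suc i" K] by auto
  then show "morse_tileable K (S \<inter> \<Union>(skeleton i K))"
    using skeleton_step[OF \<T> Int_lower2] unfolding morse_tileable_def by metis
qed

lemma skeleton_shellable:
  assumes "morse_shellable K S"
  shows "morse_shellable K (S \<inter> \<Union>(skeleton i K))"
proof (rule skeleton_induct[where P = "morse_shellable K"])
  show "S \<subseteq> \<Union>K" using assms unfolding morse_shellable_def morse_tiling_def by blast
  show "morse_shellable K S" by (fact assms)
next
  fix i assume "morse_shellable K (S \<inter> \<Union>(skeleton (Suc i) K))"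
  then obtain \<T> where \<T>: "morse_tiling K (S \<inter> \<Union>(skeleton (Suc i) K)) \<T>"
    "shelled K (S \<inter> \<Union>(skeleton (Suc i) K)) \<T>"
    by (rule morse_shellable_imp_shelled)
  have eq: "S \<inter> \<Union>(skeleton (Suc i) K) \<inter> \<Union>(skeleton i K) = S \<inter> \<Union>(skeleton i K)"
    using skeleton_mono[of i "Suc i" K] by auto
  obtain \<T>' where "morse_tiling K (S \<inter> \<Union>(skeleton i K)) \<T>'" "shelled K (S \<inter> \<Union>(skeleton i K)) \<T>'"
    using skeleton_step[OF \<T>(1) Int_lower2] \<T>(2) unfolding eq by metis
  then show "morse_shellable K (S \<inter> \<Union>(skeleton i K))" by (rule shelled_imp_morse_shellable)
qed

section \<open>Subdividing a tiling\<close>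

lemma Union_subdivision:
  assumes K: "simplicial_complex K"
  shows "\<Union>(barycentric_subdivision K) = \<Union>K"
proof (intro equalityI subsetI)
  fix x assume "x \<in> \<Union>(barycentric_subdivision K)"
  then obtain c where c: "face_chain K c" "x \<in> convex hull (barycenter ` c)"
    unfolding barycentric_subdivision_eq by blast
  have "c \<noteq> {}" using c(2) by auto
  then obtain \<sigma> where "\<sigma> \<in> c" "convex hull (barycenter ` c) \<subseteq> \<sigma>"
    using subdivision_simplex_subset[OF K c(1)] by metis
  then show "x \<in> \<Union>K" using c unfolding face_chain_def by blast
next
  fix x assume "x \<in> \<Union>K"
  then obtain \<sigma> where \<sigma>: "\<sigma> \<in> K" "x \<in> \<sigma>" by blast
  note s = complex_simplex[OF K \<sigma>(1)]
  obtain \<rho> :: "'a \<Rightarrow> nat" where \<rho>: "inj_on \<rho> (verts \<sigma>)" using finite_imp_inj_to_nat_seg[OF s(2)] by blast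
  obtain w where w: "distinct w" "set w = verts \<sigma>" "sorted_wrt (precedes \<rho> (verts \<sigma>) x) w"
    using ex_vertex_order[OF s(2) \<rho>] .
  have h: "convex hull (set w) \<in> K" "\<not> affine_dependent (set w)" "x \<in> convex hull (set w)"
    using s(1,3) \<sigma> w(2) by simp_all
  have "listed_coord w x (Suc k) \<le> listed_coord w x k" if "Suc k < length w" for k
    using sorted_iff_listed_coord[of \<rho> w x] \<rho> w that by simp
  then have "x \<in> convex hull (prefix_vertices w)" by (rule prefix_simplexI[OF K h(1,2) w(1) h(3)])
  then show "x \<in> \<Union>(barycentric_subdivision K)" using prefix_simplex(3)[OF K h(1,2) w(1)] by blast
qed

lemma subdivision_subcomplex:
  assumes "subcomplex L K"
  shows "subcomplex (barycentric_subdivision L) (barycentric_subdivision K)"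
    and "\<Union>(barycentric_subdivision L) = \<Union>L"
proof -
  have L: "simplicial_complex L" "L \<subseteq> K" using assms unfolding subcomplex_def by blast+
  show "subcomplex (barycentric_subdivision L) (barycentric_subdivision K)"
    unfolding subcomplex_def using simplicial_complex_subdivision[OF L(1)] subdivision_mono[OF L(2)] by blast
  show "\<Union>(barycentric_subdivision L) = \<Union>L" by (rule Union_subdivision[OF L(1)])
qed

lemma layered_tile_subdivision:
  fixes T :: "'a::euclidean_space set"
  assumes K: "simplicial_complex K" and T: "morse_tile K n T"
  shows "\<exists>f :: 'a \<Rightarrow> ('a \<times> 'a) set. layered (barycentric_subdivision K) T f \<and>
    (\<forall>X\<in>fibers f T. morse_tile (barycentric_subdivision K) n X) \<and>
    (\<forall>k. critical_tile k T \<longrightarrow> (\<exists>!X. X \<in> fibers f T \<and> critical_tile k X)) \<and>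
    (\<forall>k. \<forall>X\<in>fibers f T. critical_tile k X \<longrightarrow> critical_tile k T)"
proof -
  obtain \<Delta> l j where \<Delta>: "\<Delta> \<in> K" "tile_of_simplex \<Delta> n l j T" using T unfolding morse_tile_def by blast
  obtain V R t where V: "\<not> affine_dependent V" "\<Delta> = convex hull V" "card V = Suc n"
    "R \<subseteq> t" "t \<subset> V" "T = interval_tile V R t"
    using tile_of_simplex_imp_interval_tile[OF \<Delta>(2)] by metis
  have hull: "convex hull V \<in> K" using \<Delta>(1) V(2) by simp
  have crit: "critical_tile k T \<longleftrightarrow> R = t \<and> card R = k" for k
    unfolding V(6) by (rule critical_interval_tile_iff[OF V(1,4,5)])
  obtain f :: "'a \<Rightarrow> ('a \<times> 'a) set" where f: "finite (f ` T)"
    "\<And>y. y \<in> T \<Longrightarrow> morse_tile (barycentric_subdivision K) (card V - 1) {x \<in> T. f x = f y}"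
    "\<And>y. y \<in> T \<Longrightarrow> \<exists>Q\<in>barycentric_subdivision K. {x \<in> T. f x = f y} \<subseteq> Q \<and> (\<forall>x\<in>T \<inter> Q. f x \<subseteq> f y)"
    "\<And>y k. R \<noteq> t \<Longrightarrow> y \<in> T \<Longrightarrow> \<not> critical_tile k {x \<in> T. f x = f y}"
    "R = t \<Longrightarrow> \<exists>y\<in>T. critical_tile (card R) {x \<in> T. f x = f y}"
    "\<And>y k. R = t \<Longrightarrow> y \<in> T \<Longrightarrow> critical_tile k {x \<in> T. f x = f y} \<Longrightarrow> k = card R"
    "\<And>y y' k. R = t \<Longrightarrow> y \<in> T \<Longrightarrow> y' \<in> T \<Longrightarrow> critical_tile k {x \<in> T. f x = f y} \<Longrightarrow>
      critical_tile k {x \<in> T. f x = f y'} \<Longrightarrow> f y = f y'"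
    by (rule tile_subdivision[OF K hull V(1,4,5), folded V(6)]) (rule that)
  have "layered (barycentric_subdivision K) T f" unfolding layered_def using f(1,3) by blast
  moreover have "\<forall>X\<in>fibers f T. morse_tile (barycentric_subdivision K) n X"
    using f(2) V(3) unfolding fibers_def by auto
  moreover have "\<exists>!X. X \<in> fibers f T \<and> critical_tile k X" if "critical_tile k T" for k
  proof -
    have R: "R = t" "card R = k" using crit that by blast+
    obtain y where y: "y \<in> T" "critical_tile k {x \<in> T. f x = f y}" using f(5)[OF R(1)] R(2) by blast
    show ?thesis
    proof (rule ex1I[of _ "{x \<in> T. f x = f y}"])
      show "{x \<in> T. f x = f y} \<in> fibers f T \<and> critical_tile k {x \<in> T. f x = f y}"
        using y unfolding fibers_def by blast
      fix X assume "X \<in> fibers f T \<and> critical_tile k X"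
      then obtain y' where y': "y' \<in> T" "X = {x \<in> T. f x = f y'}" "critical_tile k X"
        unfolding fibers_def by blast
      then have "f y' = f y" using f(7)[OF R(1) y'(1) y(1), of k] y(2) by simp
      then show "X = {x \<in> T. f x = f y}" using y'(2) by simp
    qed
  qed
  moreover have "critical_tile k T" if X: "X \<in> fibers f T" "critical_tile k X" for k X
  proof -
    obtain y where y: "y \<in> T" "X = {x \<in> T. f x = f y}" using X(1) unfolding fibers_def by blast
    have "R = t" using f(4)[of y k] y X(2) by blast
    then show ?thesis using crit f(6)[of y k] y X(2) by simp
  qed
  ultimately show ?thesis by blast
qed

text \<open>Each tile has the dimension of its pieces, so a subcomplex witnessing the condition on
  dimensions is replaced by its subdivision. Sending a critical tile to its only critical piece is
  a bijection.\<close>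

lemma subdivision_step:
  fixes K :: "'a::euclidean_space set set"
  assumes \<T>: "morse_tiling K S \<T>"
  obtains \<T>' where "morse_tiling (barycentric_subdivision K) S \<T>'" "\<forall>X\<in>\<T>'. \<exists>T\<in>\<T>. X \<subseteq> T"
    "\<And>k. card {X \<in> \<T>'. critical_tile k X} = card {T \<in> \<T>. critical_tile k T}"
    "shelled K S \<T> \<Longrightarrow> shelled (barycentric_subdivision K) S \<T>'"
proof -
  let ?K = "barycentric_subdivision K"
  have K: "simplicial_complex K" and SK: "S \<subseteq> \<Union>K" and part: "partition_on S \<T>"
    using \<T> unfolding morse_tiling_def by blast+
  have K': "simplicial_complex ?K" by (rule simplicial_complex_subdivision[OF K])
  note tl = tiles_in_tiling[OF \<T>]
  have TS: "T \<inter> S = T" if "T \<in> \<T>" for T using tl(1)[OF that] by blast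
  have "\<forall>T\<in>\<T>. \<exists>n. morse_tile K n T" using tl(2) by blast
  from bchoice[OF this] obtain n where n: "\<forall>T\<in>\<T>. morse_tile K (n T) T" by (rule exE)
  have "\<forall>T\<in>\<T>. \<exists>f :: 'a \<Rightarrow> ('a \<times> 'a) set. layered ?K T f \<and> (\<forall>X\<in>fibers f T. morse_tile ?K (n T) X) \<and>
      (\<forall>k. critical_tile k T \<longrightarrow> (\<exists>!X. X \<in> fibers f T \<and> critical_tile k X)) \<and>
      (\<forall>k. \<forall>X\<in>fibers f T. critical_tile k X \<longrightarrow> critical_tile k T)"
    by (intro ballI layered_tile_subdivision[OF K]) (use n in blast)
  from bchoice[OF this] obtain f :: "'a set \<Rightarrow> 'a \<Rightarrow> ('a \<times> 'a) set" where
    f: "\<forall>T\<in>\<T>. layered ?K T (f T) \<and> (\<forall>X\<in>fibers (f T) T. morse_tile ?K (n T) X) \<and>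
      (\<forall>k. critical_tile k T \<longrightarrow> (\<exists>!X. X \<in> fibers (f T) T \<and> critical_tile k X)) \<and>
      (\<forall>k. \<forall>X\<in>fibers (f T) T. critical_tile k X \<longrightarrow> critical_tile k T)" by (rule exE)
  define \<V> where "\<V> = (\<Union>T\<in>\<T>. fibers (f T) (T \<inter> S))"
  have \<V>: "\<V> = (\<Union>T\<in>\<T>. fibers (f T) T)" unfolding \<V>_def using TS by simp
  have sub: "\<exists>L'. subcomplex L' ?K \<and> S \<inter> \<Union>L' = S \<inter> \<Union>L" if "subcomplex L K" for L
    using subdivision_subcomplex[OF that] by (intro exI[of _ "barycentric_subdivision L"]) simp
  have dims: "(\<forall>T\<in>\<T>. \<forall>X\<in>fibers (f T) (T \<inter> S).
        (\<exists>n>j. morse_tile ?K n X) \<longleftrightarrow> (\<exists>n>j. morse_tile K n T)) \<or>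
      (\<forall>T\<in>\<T>. \<forall>X\<in>fibers (f T) (T \<inter> S). \<not> (\<exists>n>j. morse_tile ?K n X))" for j
  proof (intro disjI1 ballI)
    fix T X assume T: "T \<in> \<T>" "X \<in> fibers (f T) (T \<inter> S)"
    have "morse_tile ?K (n T) X" "morse_tile K (n T) T" using T f n TS[OF T(1)] by auto
    then show "(\<exists>n>j. morse_tile ?K n X) \<longleftrightarrow> (\<exists>n>j. morse_tile K n T)" by (simp add: tile_dim_gt_iff)
  qed
  have "morse_tiling ?K S \<V>"
    unfolding \<V>_def
  proof (rule morse_tiling_refine[OF K' subset_refl _ sub \<T> _ dims])
    show "S \<subseteq> \<Union>?K" using SK Union_subdivision[OF K] by simp
    show "\<exists>n. morse_tile ?K n X" if "T \<in> \<T>" "X \<in> fibers (f T) (T \<inter> S)" for T X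
    proof -
      have "X \<in> fibers (f T) T" using that TS[OF that(1)] by simp
      then show ?thesis using f that(1) by blast
    qed
  qed
  moreover have "\<forall>X\<in>\<V>. \<exists>T\<in>\<T>. X \<subseteq> T" unfolding \<V> using fibers_subset by blast
  moreover have "card {X \<in> \<V>. critical_tile k X} = card {T \<in> \<T>. critical_tile k T}" for k
  proof -
    define g where "g T = (THE X. X \<in> fibers (f T) T \<and> critical_tile k X)" for T
    have g: "g T \<in> fibers (f T) T \<and> critical_tile k (g T)" if "T \<in> {T \<in> \<T>. critical_tile k T}" for T
      unfolding g_def by (rule theI') (use f that in blast)
    have uniq: "X = g T" if "T \<in> \<T>" "critical_tile k T" "X \<in> fibers (f T) T" "critical_tile k X" for T X
    proof -
      have "\<exists>!X. X \<in> fibers (f T) T \<and> critical_tile k X" using f that(1,2) by blast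
      then show ?thesis using g[of T] that by blast
    qed
    have "bij_betw g {T \<in> \<T>. critical_tile k T} {X \<in> \<V>. critical_tile k X}"
      unfolding bij_betw_def
    proof
      show "inj_on g {T \<in> \<T>. critical_tile k T}"
      proof (rule inj_onI)
        fix T T' assume T: "T \<in> {T \<in> \<T>. critical_tile k T}" "T' \<in> {T \<in> \<T>. critical_tile k T}" "g T = g T'"
        have "g T \<subseteq> T" "g T \<noteq> {}" using g[OF T(1)] fibers_subset fibers_nonempty by blast+
        moreover have "g T \<subseteq> T'" using g[OF T(2)] fibers_subset T(3) by metis
        ultimately have "T \<inter> T' \<noteq> {}" by blast
        then show "T = T'" using disjointD[OF partition_onD2[OF part], of T T'] T(1,2) by blast
      qed
      show "g ` {T \<in> \<T>. critical_tile k T} = {X \<in> \<V>. critical_tile k X}"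
      proof (intro equalityI subsetI)
        fix X assume "X \<in> g ` {T \<in> \<T>. critical_tile k T}"
        then show "X \<in> {X \<in> \<V>. critical_tile k X}" unfolding \<V> using g by blast
      next
        fix X assume X: "X \<in> {X \<in> \<V>. critical_tile k X}"
        then obtain T where T: "T \<in> \<T>" "X \<in> fibers (f T) T" unfolding \<V> by blast
        have "critical_tile k T" using f T X by blast
        then show "X \<in> g ` {T \<in> \<T>. critical_tile k T}" using uniq[OF T(1) _ T(2)] T(1) X by blast
      qed
    qed
    then show ?thesis by (rule bij_betw_same_card[symmetric])
  qed
  moreover have "shelled ?K S \<V>" if "shelled K S \<T>"
    unfolding \<V>_def
  proof (rule shelled_refine[OF K' subset_refl sub that])
    show "layered ?K (T \<inter> S) (f T)" if "T \<in> \<T>" for T using f that TS[OF that] by simp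
  qed
  ultimately show ?thesis using that by blast
qed

lemma iterated_subdivision:
  fixes K :: "'a::euclidean_space set set"
  assumes \<T>: "morse_tiling K S \<T>"
  shows "\<exists>\<T>'. induced_morse_tiling K S \<T> d \<T>' \<and>
    (\<forall>k. card {X \<in> \<T>'. critical_tile k X} = card {T \<in> \<T>. critical_tile k T}) \<and>
    (shelled K S \<T> \<longrightarrow> shelled ((barycentric_subdivision ^^ d) K) S \<T>')"
proof (induction d)
  case 0
  show ?case
    by (intro exI[of _ \<T>]) (use \<T> in \<open>auto simp: induced_morse_tiling_def\<close>)
next
  case (Suc d)
  then obtain \<U> where \<U>: "morse_tiling ((barycentric_subdivision ^^ d) K) S \<U>" "\<forall>X\<in>\<U>. \<exists>T\<in>\<T>. X \<subseteq> T"
    "\<forall>k. card {X \<in> \<U>. critical_tile k X} = card {T \<in> \<T>. critical_tile k T}"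
    "shelled K S \<T> \<longrightarrow> shelled ((barycentric_subdivision ^^ d) K) S \<U>"
    unfolding induced_morse_tiling_def by blast
  obtain \<V> where \<V>: "morse_tiling (barycentric_subdivision ((barycentric_subdivision ^^ d) K)) S \<V>"
    "\<forall>X\<in>\<V>. \<exists>T\<in>\<U>. X \<subseteq> T"
    "\<And>k. card {X \<in> \<V>. critical_tile k X} = card {T \<in> \<U>. critical_tile k T}"
    "shelled ((barycentric_subdivision ^^ d) K) S \<U> \<Longrightarrow>
      shelled (barycentric_subdivision ((barycentric_subdivision ^^ d) K)) S \<V>"
    by (rule subdivision_step[OF \<U>(1)]) (rule that)
  have "\<forall>X\<in>\<V>. \<exists>T\<in>\<T>. X \<subseteq> T" using \<V>(2) \<U>(2) by (meson order_trans)
  then show ?case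
    using \<V>(1,3,4) \<U>(3,4) by (intro exI[of _ \<V>]) (simp add: induced_morse_tiling_def)
qed

theorem theorem1p1:
  fixes K :: "'a::euclidean_space set set" and S :: "'a set"
  assumes "simplicial_complex K" and "S \<subseteq> \<Union>K"
  shows "(morse_tileable K S \<longrightarrow>
            (\<forall>i::nat. morse_tileable K (S \<inter> \<Union>(skeleton i K))) \<and>
            (\<forall>d\<ge>1. morse_tileable ((barycentric_subdivision ^^ d) K) S)) \<and>
         (morse_shellable K S \<longrightarrow>
            (\<forall>i::nat. morse_shellable K (S \<inter> \<Union>(skeleton i K))) \<and>
            (\<forall>d\<ge>1. morse_shellable ((barycentric_subdivision ^^ d) K) S)) \<and>
         (\<forall>\<T>. morse_tiling K S \<T> \<longrightarrow>
            (\<forall>d\<ge>1. \<exists>\<T>'. induced_morse_tiling K S \<T> d \<T>' \<and>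
               (\<forall>k. card {T' \<in> \<T>'. critical_tile k T'} = card {T \<in> \<T>. critical_tile k T})))"
proof (intro conjI impI allI)
  fix i assume "morse_tileable K S"
  then show "morse_tileable K (S \<inter> \<Union>(skeleton i K))" by (rule skeleton_tileable)
next
  fix d :: nat assume "morse_tileable K S"
  then obtain \<T> where "morse_tiling K S \<T>" unfolding morse_tileable_def by blast
  from iterated_subdivision[OF this, of d]
  show "morse_tileable ((barycentric_subdivision ^^ d) K) S"
    unfolding morse_tileable_def induced_morse_tiling_def by blast
next
  fix i assume "morse_shellable K S"
  then show "morse_shellable K (S \<inter> \<Union>(skeleton i K))" by (rule skeleton_shellable)
next
  fix d :: nat assume "morse_shellable K S"
  then obtain \<T> where \<T>: "morse_tiling K S \<T>" "shelled K S \<T>" by (rule morse_shellable_imp_shelled)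
  then obtain \<T>' where "morse_tiling ((barycentric_subdivision ^^ d) K) S \<T>'"
    "shelled ((barycentric_subdivision ^^ d) K) S \<T>'"
    using iterated_subdivision[OF \<T>(1), of d] unfolding induced_morse_tiling_def by blast
  then show "morse_shellable ((barycentric_subdivision ^^ d) K) S" by (rule shelled_imp_morse_shellable)
next
  fix \<T> and d :: nat assume "morse_tiling K S \<T>"
  from iterated_subdivision[OF this, of d]
  show "\<exists>\<T>'. induced_morse_tiling K S \<T> d \<T>' \<and>
      (\<forall>k. card {T' \<in> \<T>'. critical_tile k T'} = card {T \<in> \<T>. critical_tile k T})"
    by blast
qed

end
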